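(* Let $N\ge2$. Then for all $u\in C_0^\infty(\mathbb{R}^N)$ the following inequality holds: $$\left(\int_{\mathbb{R}^N}|\nabla u|^2dx\right)^{\frac12}\left(\int_{\mathbb{R}^N}|u|^2dx\right)^{\frac12}-\frac{N-1}{2}\int_{\mathbb{R}^N}\frac{|u|^2}{|x|}dx\ge\inf_{c\in\mathbb{R},\lambda>0}\int_{\mathbb{R}^N}\frac{|u-ce^{-\lambda|x|}|^2}{|x|}dx.$$ The constant $1$ on the right-hand side is sharp and can be attained. Moreover, the following stability of the stability inequality holds: $$\left(\int_{\mathbb{R}^N}|\nabla u|^2dx\right)^{\frac12}\left(\int_{\mathbb{R}^N}|u|^2dx\right)^{\frac12}-\frac{N-1}{2}\int_{\mathbb{R}^N}\frac{|u|^2}{|x|}dx-\inf_{c\in\mathbb{R},\lambda>0}\int_{\mathbb{R}^N}\frac{|u-ce^{-\lambda|x|}|^2}{|x|}dx$$ $$\ge\inf_{c,d\in\mathbb{R},\,\mathbf{a}\in\mathbb{R}^N,\,\lambda>0}\int_{\mathbb{R}^N}\frac{\left|u-(c+d|x|+\mathbf{a}\cdot x)e^{-\lambda|x|}\right|^2}{|x|}dx.$$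
   Context: Functions are real-valued. "Sharp" means that the constant cannot be replaced by a larger one; "attained" means that equality occurs for some nontrivial function, not of the form $ce^{-\lambda|x|}$, in the natural function space (all integrals finite), not necessarily compactly supported. *)

theory Defs
  imports "HOL-Analysis.Analysis"
begin

definition gradient :: "(real^'n \<Rightarrow> real) \<Rightarrow> real^'n \<Rightarrow> real^'n" where
  "gradient u x = (THE D. GDERIV u x :> D)"

primrec C_k :: "nat \<Rightarrow> (real^'n \<Rightarrow> real) \<Rightarrow> bool" where
  "C_k 0 u \<longleftrightarrow> continuous_on UNIV u"
| "C_k (Suc k) u \<longleftrightarrow> (\<forall>x. \<exists>D. GDERIV u x :> D) \<and> (\<forall>i. C_k k (\<lambda>x. gradient u x $ i))"

definition test_functions :: "(real^'n \<Rightarrow> real) set" where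
  "test_functions = {u. (\<forall>k. C_k k u) \<and> compact (closure {x. u x \<noteq> 0})}"

definition weak_gradient :: "(real^'n \<Rightarrow> real) \<Rightarrow> (real^'n \<Rightarrow> real^'n) \<Rightarrow> bool" where
  "weak_gradient u G \<longleftrightarrow>
     u \<in> borel_measurable lborel \<and> G \<in> borel_measurable lborel \<and>
     (\<forall>K. compact K \<longrightarrow> set_integrable lborel K u \<and> set_integrable lborel K G) \<and>
     (\<forall>\<phi>\<in>test_functions.
        (\<integral>x. u x *\<^sub>R gradient \<phi> x \<partial>lborel) = - (\<integral>x. \<phi> x *\<^sub>R G x \<partial>lborel))"

text \<open>
  The natural function space of the inequality: Sobolev functions (with a given weak gradient)
  for which the three integrals in the deficit are finite. Finiteness of the integrals
  defining the distances below follows, since the exponential profiles (times affine factors)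
  are square integrable against \<open>1 / norm x\<close> in dimension at least two.
\<close>

definition natural_space :: "(real^'n \<Rightarrow> real) \<Rightarrow> (real^'n \<Rightarrow> real^'n) \<Rightarrow> bool" where
  "natural_space u G \<longleftrightarrow>
     weak_gradient u G \<and>
     integrable lborel (\<lambda>x. (norm (G x))\<^sup>2) \<and>
     integrable lborel (\<lambda>x. \<bar>u x\<bar>\<^sup>2) \<and>
     integrable lborel (\<lambda>x. \<bar>u x\<bar>\<^sup>2 / norm x)"

text \<open>
  The gradient field \<open>G\<close> is a parameter, so that the deficit makes sense both with the
  classical gradient of a test function and with the weak gradient of a Sobolev function.
\<close>

definition deficit :: "(real^'n \<Rightarrow> real) \<Rightarrow> (real^'n \<Rightarrow> real^'n) \<Rightarrow> real" where
  "deficit u G =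
     sqrt (\<integral>x. (norm (G x))\<^sup>2 \<partial>lborel) * sqrt (\<integral>x. \<bar>u x\<bar>\<^sup>2 \<partial>lborel)
     - (real CARD('n) - 1) / 2 * (\<integral>x. \<bar>u x\<bar>\<^sup>2 / norm x \<partial>lborel)"

definition exp_dist :: "(real^'n \<Rightarrow> real) \<Rightarrow> real" where
  "exp_dist u =
     Inf {(\<integral>x. \<bar>u x - c * exp (- l * norm x)\<bar>\<^sup>2 / norm x \<partial>lborel) | c l :: real. l > 0}"

definition affine_exp_dist :: "(real^'n \<Rightarrow> real) \<Rightarrow> real" where
  "affine_exp_dist u =
     Inf {(\<integral>x. \<bar>u x - (c + d * norm x + a \<bullet> x) * exp (- l * norm x)\<bar>\<^sup>2 / norm x \<partial>lborel)
          | (c :: real) (d :: real) (a :: real^'n) (l :: real). l > 0}"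

end

theory Submission
  imports Defs "HOL-Computational_Algebra.Polynomial"
begin

text \<open>
  Write \<open>u = v exp (- l |x|)\<close> where \<open>l\<close> is the ratio of the norms of the gradient of \<open>u\<close> and of \<open>u\<close>,
  and put \<open>s = 2 l\<close>. Integrating by parts turns the deficit into the energy
  \<open>1 / s \<integral> |\<nabla>v|\<^sup>2 exp (- s |x|)\<close>, which belongs to the operator \<open>- |x| \<Delta> + s x \<cdot> \<nabla>\<close>, symmetric on
  \<open>L\<^sup>2 (exp (- s |x|) / |x|)\<close>. Polynomials in \<open>x\<close> and \<open>|x|\<close> are sums of eigenfunctions of this operator
  with eigenvalues \<open>s k\<close> and are dense, so the spectrum is \<open>{s k}\<close>; the eigenspaces for \<open>k = 0\<close> and
  \<open>k = 1\<close> consist of affine functions of \<open>x\<close> and \<open>|x|\<close>. Both stability inequalities follow from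
  \<open>k \<ge> [k \<ge> 1] + [k \<ge> 2]\<close>. An eigenfunction for \<open>k = 1\<close>, namely \<open>v = x \<bullet> b\<close>, gives equality, and
  smoothing and truncating it oddly gives the sharpness of the constant.
\<close>

subsection \<open>Integrability of exponentials against the Coulomb weight\<close>

text \<open>The deficit contains a product of norms and is not quadratic. The scale \<open>l\<close>
  is the one at which half the sum of the two squared norms, weighted by \<open>1 / l\<close> and
  \<open>l\<close>, equals that product, so a quadratic form results. The same \<open>l\<close> is
  admissible in both infima, hence both distances can be bounded at once. The operator is singular
  at the origin and \<open>norm\<close> is not differentiable there. Functions are therefore
  controlled by a Lipschitz bound that may blow up like \<open>1 / norm x\<close>, still integrable
  in dimension two. Neither completeness nor self-adjointness enters. The spectral bound is tested
  on finite spans of eigenfunctions, which needs one derivative of \<open>v\<close> only and density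
  only in the weighted square norm, not in the energy norm. With \<open>norm\<close> counted as a
  coordinate of degree one, \<open>norm x\<close> times the Laplacian lowers degree by one, so the
  operator is triangular and its eigenvalues can be read off from Euler's identity. It is done in an
  algebra with exponential factors, which are then exchanged for Taylor polynomials.\<close>

lemma power_le_fact_exp:
  fixes y :: real
  assumes "0 \<le> y"
  shows "y ^ n \<le> fact n * exp y"
proof -
  have "(\<Sum>k\<in>{n}. y ^ k / fact k) \<le> (\<Sum>k. y ^ k / fact k)"
    using assms summable_exp_generic[of y]
    by (intro sum_le_suminf) (auto simp: divide_inverse scaleR_conv_of_real mult.commute)
  also have "\<dots> = exp y"
    by (simp add: exp_def scaleR_conv_of_real divide_inverse mult.commute)
  finally show ?thesis by (simp add: field_simps)
qed

text \<open>Half of the exponential rate absorbs the polynomial; the other half remains as a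
  geometric ratio.\<close>

lemma summable_power_times_exp:
  fixes d :: real
  assumes "0 < d"
  shows "summable (\<lambda>k. (real k + 1) ^ n * exp (- d * real k))"
proof (rule summable_comparison_test)
  define C where "C = fact n * (2 / d) ^ n * exp (d / 2)"
  show "\<exists>N. \<forall>k\<ge>N. norm ((real k + 1) ^ n * exp (- d * real k)) \<le> C * exp (- d / 2) ^ k"
  proof (intro exI allI impI)
    fix k :: nat
    have "(real k + 1) ^ n = (2 / d) ^ n * (d / 2 * (real k + 1)) ^ n"
      using assms unfolding power_mult_distrib[symmetric] by (intro arg_cong[where f="\<lambda>y. y ^ n"]) simp
    also have "\<dots> \<le> (2 / d) ^ n * (fact n * exp (d / 2 * (real k + 1)))"
      using assms by (intro mult_left_mono power_le_fact_exp) auto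
    also have "\<dots> = C * exp (d / 2 * real k)"
      by (simp add: C_def ring_distribs exp_add)
    finally have "(real k + 1) ^ n * exp (- d * real k) \<le> C * exp (d / 2 * real k) * exp (- d * real k)"
      by (intro mult_right_mono) auto
    also have "\<dots> = C * exp (- d / 2) ^ k"
      by (simp add: mult.assoc exp_add[symmetric] exp_of_nat_mult[symmetric] mult.commute)
    finally show "norm ((real k + 1) ^ n * exp (- d * real k)) \<le> C * exp (- d / 2) ^ k" by simp
  qed
  show "summable (\<lambda>k. C * exp (- d / 2) ^ k)"
    using assms by (intro summable_mult summable_geometric) simp
qed

text \<open>Unit shells catch the decay and dyadic balls the pole, whose contributions
  \<open>2 ^ (k + 1) * ((1/2) ^ k) ^ N\<close> are summable once \<open>N \<ge> 2\<close>. Balls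
  instead of annuli overcount, which is harmless for an upper bound and needs only the volume of a
  ball.\<close>

lemma integrable_exp_over_norm:
  fixes d :: real
  assumes d: "0 < d" and dim: "2 \<le> DIM('a::euclidean_space)"
  shows "integrable lborel (\<lambda>x::'a. exp (- d * norm x) / norm x)"
proof (rule integrableI_nonneg)
  let ?N = "DIM('a)"
  define V where "V = unit_ball_vol ?N"
  have V: "0 \<le> V" by (simp add: V_def)
  define h :: "nat \<Rightarrow> 'a \<Rightarrow> ennreal" where
    "h k x = ennreal (exp (- d * real k)) * indicator (cball 0 (real k + 1)) x
       + ennreal (2 ^ (k + 1)) * indicator (cball 0 ((1/2) ^ k)) x" for k x
  define r where "r k = exp (- d * real k) * (V * (real k + 1) ^ ?N) + V * 2 * (1/2) ^ k" for k
  have bound: "ennreal (exp (- d * norm x) / norm x) \<le> (\<Sum>k. h k x)" for x :: 'a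
  proof -
    have "\<exists>k. ennreal (exp (- d * norm x) / norm x) \<le> h k x"
    proof (cases "1 \<le> norm x")
      case True
      define k where "k = nat \<lfloor>norm x\<rfloor>"
      have k: "real k \<le> norm x" "norm x \<le> real k + 1" by (auto simp: k_def)
      have "exp (- d * norm x) / norm x \<le> exp (- d * norm x)"
        using True by (simp add: divide_le_eq)
      also have "\<dots> \<le> exp (- d * real k)" using k d by simp
      finally have "ennreal (exp (- d * norm x) / norm x) \<le> ennreal (exp (- d * real k))"
        by (rule ennreal_leI)
      also have "\<dots> \<le> h k x" using k by (simp add: h_def)
      finally show ?thesis by blast
    next
      case False
      show ?thesis
      proof (cases "x = 0")
        case True then show ?thesis by simp
      next
        case x: False
        obtain m where m: "(1/2::real) ^ m < norm x"
          using real_arch_pow_inv[of "norm x" "1/2"] x by auto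
        \<comment> \<open>The least exponent brackets the norm,
          \<open>(1/2) ^ n < norm x \<le> (1/2) ^ (n - 1)\<close>: the ball of index
          \<open>k = n - 1\<close> contains \<open>x\<close>, and \<open>1 / norm x\<close> stays
          below \<open>2 ^ (k + 1)\<close>.\<close>
        define n where "n = (LEAST m. (1/2::real) ^ m < norm x)"
        have n: "(1/2) ^ n < norm x" unfolding n_def using m by (rule LeastI)
        have "n \<noteq> 0" using n False by (intro notI) simp
        then obtain k where k: "n = Suc k" by (cases n) auto
        have "\<not> (1/2) ^ k < norm x"
          using not_less_Least[of k "\<lambda>m. (1/2::real) ^ m < norm x"] k unfolding n_def by simp
        then have kx: "norm x \<le> (1/2) ^ k" by simp
        have "exp (- d * norm x) / norm x \<le> 1 / norm x"
          using x d by (intro divide_right_mono) auto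
        also have "\<dots> \<le> 1 / (1/2) ^ n" using n x by (intro divide_left_mono) auto
        also have "\<dots> = 2 ^ (k + 1)" by (simp add: k power_divide)
        finally have "ennreal (exp (- d * norm x) / norm x) \<le> ennreal (2 ^ (k + 1))"
          by (rule ennreal_leI)
        also have "\<dots> \<le> h k x" using kx by (simp add: h_def)
        finally show ?thesis by blast
      qed
    qed
    then obtain k where "ennreal (exp (- d * norm x) / norm x) \<le> h k x" ..
    also have "h k x = (\<Sum>k\<in>{k}. h k x)" by simp
    also have "\<dots> \<le> (\<Sum>k. h k x)" by (rule sum_le_suminf) auto
    finally show ?thesis .
  qed
  have [measurable]: "cball (0::'a) \<rho> \<in> sets borel" for \<rho> by simp
  have hm: "h k \<in> borel_measurable lborel" for k
    unfolding h_def by measurable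
  have int_h: "(\<integral>\<^sup>+x. h k x \<partial>lborel) \<le> ennreal (r k)" for k
  proof -
    have "(\<integral>\<^sup>+x. h k x \<partial>lborel) = ennreal (exp (- d * real k)) * emeasure lborel (cball (0::'a) (real k + 1))
       + ennreal (2 ^ (k + 1)) * emeasure lborel (cball (0::'a) ((1/2) ^ k))"
      unfolding h_def by (simp add: nn_integral_add nn_integral_cmult_indicator)
    also have "\<dots> = ennreal (exp (- d * real k) * (V * (real k + 1) ^ ?N) + 2 ^ (k + 1) * (V * ((1/2) ^ k) ^ ?N))"
      by (simp add: emeasure_cball V_def[symmetric] ennreal_mult[symmetric] V flip: ennreal_plus)
    also have "\<dots> \<le> ennreal (r k)"
    proof (rule ennreal_leI)
      have "((1/2::real) ^ k) ^ ?N \<le> ((1/2) ^ k) ^ 2"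
        using dim by (intro power_decreasing) (auto simp: power_le_one)
      then have "2 ^ (k + 1) * (V * ((1/2) ^ k) ^ ?N) \<le> 2 ^ (k + 1) * (V * ((1/2) ^ k) ^ 2)"
        using V by (intro mult_left_mono) auto
      also have "\<dots> = V * 2 * (1/2) ^ k"
        by (simp add: power2_eq_square power_divide field_simps)
      finally show "exp (- d * real k) * (V * (real k + 1) ^ ?N) + 2 ^ (k + 1) * (V * ((1/2) ^ k) ^ ?N) \<le> r k"
        by (simp add: r_def)
    qed
    finally show ?thesis .
  qed
  have r0: "0 \<le> r k" for k using V by (simp add: r_def)
  have sr: "summable r" unfolding r_def
    using summable_mult[OF summable_power_times_exp[OF d, of ?N], of V]
    by (intro summable_add summable_mult summable_geometric) (auto simp: mult_ac)
  have "(\<integral>\<^sup>+x. ennreal (exp (- d * norm x) / norm x) \<partial>(lborel :: 'a measure)) \<le> (\<integral>\<^sup>+x. (\<Sum>k. h k x) \<partial>lborel)"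
    using bound by (intro nn_integral_mono) auto
  also have "\<dots> = (\<Sum>k. \<integral>\<^sup>+x. h k x \<partial>lborel)" by (rule nn_integral_suminf[OF hm])
  also have "\<dots> \<le> (\<Sum>k. ennreal (r k))" using int_h by (intro suminf_le) auto
  also have "\<dots> = ennreal (\<Sum>k. r k)" by (rule suminf_ennreal2[OF r0 sr])
  also have "\<dots> < \<infinity>" by simp
  finally show "(\<integral>\<^sup>+x. ennreal (exp (- d * norm x) / norm x) \<partial>(lborel :: 'a measure)) < \<infinity>" .
qed auto

subsection \<open>Functions with a Lipschitz bound degenerating at the origin\<close>

text \<open>The factor \<open>norm x\<close> lets the local Lipschitz constant blow up like
  \<open>1 / norm x\<close>, as it does for \<open>sgn x\<close>, the gradient of the norm.
  Difference quotients are then dominated by a multiple of \<open>exp (d * norm x) / norm x\<close>,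
  which is integrable for \<open>d < 0\<close> in dimension at least two. Steps have length at most
  one so that the exponential weights at both ends are comparable.\<close>

definition tempered :: "real \<Rightarrow> real \<Rightarrow> ('a::euclidean_space \<Rightarrow> real) \<Rightarrow> bool" where
  "tempered C d f \<longleftrightarrow> (\<forall>x. \<bar>f x\<bar> \<le> C * exp (d * norm x) \<and>
     (\<forall>y. norm (x - y) \<le> 1 \<longrightarrow> norm x * \<bar>f x - f y\<bar> \<le> C * exp (d * norm x) * norm (x - y)))"

text \<open>Asking for every positive rate makes the class closed under products, since the allowed
  rate can be shared between the factors.\<close>

definition tame :: "('a::euclidean_space \<Rightarrow> real) \<Rightarrow> bool" where
  "tame f \<longleftrightarrow> (\<forall>d>0. \<exists>C. tempered C d f)"

definition decaying :: "('a::euclidean_space \<Rightarrow> real) \<Rightarrow> bool" where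
  "decaying f \<longleftrightarrow> (\<exists>s>0. \<exists>C. tempered C (- s) f)"

lemma tempered_nonneg:
  assumes "tempered C d f" shows "0 \<le> C"
proof -
  have "\<bar>f 0\<bar> \<le> C" using assms unfolding tempered_def by (metis exp_zero mult.right_neutral mult_zero_right norm_zero)
  then show ?thesis by linarith
qed

lemma tempered_add:
  assumes f: "tempered C d f" and g: "tempered C' d g"
  shows "tempered (C + C') d (\<lambda>x. f x + g x)"
  unfolding tempered_def
proof (intro allI conjI impI)
  fix x :: 'a
  have "\<bar>f x\<bar> \<le> C * exp (d * norm x)" "\<bar>g x\<bar> \<le> C' * exp (d * norm x)"
    using f g by (auto simp: tempered_def)
  then show "\<bar>f x + g x\<bar> \<le> (C + C') * exp (d * norm x)" by (simp add: ring_distribs)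
next
  fix x y :: 'a assume xy: "norm (x - y) \<le> 1"
  have "norm x * \<bar>(f x + g x) - (f y + g y)\<bar> \<le> norm x * (\<bar>f x - f y\<bar> + \<bar>g x - g y\<bar>)"
    by (intro mult_left_mono) auto
  also have "\<dots> = norm x * \<bar>f x - f y\<bar> + norm x * \<bar>g x - g y\<bar>" by (simp add: ring_distribs)
  also have "\<dots> \<le> C * exp (d * norm x) * norm (x - y) + C' * exp (d * norm x) * norm (x - y)"
    using f g xy by (intro add_mono) (auto simp: tempered_def)
  finally show "norm x * \<bar>(f x + g x) - (f y + g y)\<bar> \<le> (C + C') * exp (d * norm x) * norm (x - y)"
    by (simp add: ring_distribs)
qed

lemma tempered_mult:
  assumes f: "tempered C d f" and g: "tempered C' d' g"
  shows "tempered (C * C' * (1 + exp \<bar>d'\<bar>)) (d + d') (\<lambda>x. f x * g x)"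
  unfolding tempered_def
proof (intro allI conjI impI)
  note C = tempered_nonneg[OF f] tempered_nonneg[OF g]
  {
    fix x :: 'a
    have "\<bar>f x * g x\<bar> \<le> (C * exp (d * norm x)) * (C' * exp (d' * norm x))"
      using f g unfolding abs_mult by (intro mult_mono) (auto simp: tempered_def C)
    also have "\<dots> = C * C' * exp ((d + d') * norm x)" by (simp add: ring_distribs exp_add)
    also have "\<dots> \<le> C * C' * (1 + exp \<bar>d'\<bar>) * exp ((d + d') * norm x)"
      using C by (intro mult_right_mono) (auto simp: ring_distribs)
    finally show "\<bar>f x * g x\<bar> \<le> C * C' * (1 + exp \<bar>d'\<bar>) * exp ((d + d') * norm x)" .
  }
  fix x y :: 'a assume xy: "norm (x - y) \<le> 1"
  \<comment> \<open>A step of length at most one changes the weight of \<open>g\<close> by a factor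
    of at most \<open>exp \<bar>d'\<bar>\<close>; this is the origin of
    \<open>1 + exp \<bar>d'\<bar>\<close> in the constant.\<close>
  have "\<bar>d' * norm y - d' * norm x\<bar> = \<bar>d'\<bar> * \<bar>norm x - norm y\<bar>"
    by (simp add: abs_mult[symmetric] ring_distribs abs_minus_commute)
  also have "\<dots> \<le> \<bar>d'\<bar> * 1"
    using norm_triangle_ineq3[of x y] xy by (intro mult_left_mono) linarith+
  finally have "d' * norm y \<le> \<bar>d'\<bar> + d' * norm x" by linarith
  then have ee: "exp (d' * norm y) \<le> exp \<bar>d'\<bar> * exp (d' * norm x)" by (simp add: exp_add[symmetric])
  have "\<bar>g y\<bar> \<le> C' * exp (d' * norm y)" using g by (simp add: tempered_def)
  also have "\<dots> \<le> C' * (exp \<bar>d'\<bar> * exp (d' * norm x))" using ee C by (intro mult_left_mono) auto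
  finally have gy: "\<bar>g y\<bar> \<le> C' * (exp \<bar>d'\<bar> * exp (d' * norm x))" .
  have "f x * g x - f y * g y = f x * (g x - g y) + g y * (f x - f y)" by (simp add: algebra_simps)
  then have "norm x * \<bar>f x * g x - f y * g y\<bar> \<le> norm x * (\<bar>f x * (g x - g y)\<bar> + \<bar>g y * (f x - f y)\<bar>)"
    by (intro mult_left_mono) auto
  also have "\<dots> = \<bar>f x\<bar> * (norm x * \<bar>g x - g y\<bar>) + \<bar>g y\<bar> * (norm x * \<bar>f x - f y\<bar>)"
    by (simp only: abs_mult distrib_left) (simp only: mult_ac)
  also have "\<dots> \<le> (C * exp (d * norm x)) * (C' * exp (d' * norm x) * norm (x - y))
     + (C' * (exp \<bar>d'\<bar> * exp (d' * norm x))) * (C * exp (d * norm x) * norm (x - y))"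
  proof -
    have "\<bar>f x\<bar> \<le> C * exp (d * norm x)" "norm x * \<bar>f x - f y\<bar> \<le> C * exp (d * norm x) * norm (x - y)"
      "norm x * \<bar>g x - g y\<bar> \<le> C' * exp (d' * norm x) * norm (x - y)"
      using f g xy by (auto simp: tempered_def)
    then show ?thesis using gy C by (intro add_mono mult_mono[of "\<bar>f x\<bar>"] mult_mono[of "\<bar>g y\<bar>"]) auto
  qed
  also have "\<dots> = C * C' * (1 + exp \<bar>d'\<bar>) * exp ((d + d') * norm x) * norm (x - y)"
    by (simp add: ring_distribs exp_add)
  finally show "norm x * \<bar>f x * g x - f y * g y\<bar>
      \<le> C * C' * (1 + exp \<bar>d'\<bar>) * exp ((d + d') * norm x) * norm (x - y)" .
qed

lemma tempered_mono:
  assumes f: "tempered C d f" and "C \<le> C'" "d \<le> d'"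
  shows "tempered C' d' f"
  unfolding tempered_def
proof (intro allI conjI impI)
  note C = tempered_nonneg[OF f]
  have le: "C * exp (d * norm x) \<le> C' * exp (d' * norm x)" for x :: 'a
    using assms C by (intro mult_mono) (auto intro: mult_right_mono)
  fix x :: 'a
  show "\<bar>f x\<bar> \<le> C' * exp (d' * norm x)" using f le[of x] unfolding tempered_def by (meson order_trans)
  fix y :: 'a assume "norm (x - y) \<le> 1"
  then have "norm x * \<bar>f x - f y\<bar> \<le> C * exp (d * norm x) * norm (x - y)" using f by (simp add: tempered_def)
  also have "\<dots> \<le> C' * exp (d' * norm x) * norm (x - y)" using le by (intro mult_right_mono) auto
  finally show "norm x * \<bar>f x - f y\<bar> \<le> C' * exp (d' * norm x) * norm (x - y)" .
qed

lemma tame_add: "tame f \<Longrightarrow> tame g \<Longrightarrow> tame (\<lambda>x. f x + g x)"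
  unfolding tame_def using tempered_add by blast

lemma tame_mult:
  assumes "tame f" "tame g" shows "tame (\<lambda>x. f x * g x)"
  unfolding tame_def
proof (intro allI impI)
  fix d :: real assume "0 < d"
  then obtain C C' where "tempered C (d/2) f" "tempered C' (d/2) g"
    using assms unfolding tame_def by (meson half_gt_zero)
  from tempered_mult[OF this] show "\<exists>C. tempered C d (\<lambda>x. f x * g x)" by auto
qed

lemma decaying_mult_tame:
  assumes "decaying f" "tame g" shows "decaying (\<lambda>x. f x * g x)"
proof -
  obtain s C where s: "0 < s" "tempered C (- s) f" using assms by (auto simp: decaying_def)
  moreover obtain C' where "tempered C' (s/2) g" using assms s unfolding tame_def by (meson half_gt_zero)
  ultimately have "tempered (C * C' * (1 + exp \<bar>s/2\<bar>)) (- (s/2)) (\<lambda>x. f x * g x)"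
    using tempered_mult[of C "-s" f C' "s/2" g] by simp
  with s show ?thesis unfolding decaying_def by (meson half_gt_zero)
qed

lemma norm_le_exp:
  assumes "(0::real) < d" shows "norm x \<le> 1 / d * exp (d * norm x)"
proof -
  have "d * norm x \<le> exp (d * norm x)" using exp_ge_add_one_self[of "d * norm x"] by linarith
  then show ?thesis using assms by (simp add: field_simps)
qed

text \<open>The factor \<open>norm x\<close> in front of the increment costs an arbitrarily small
  exponential, by \<open>norm x \<le> 1 / d * exp (d * norm x)\<close>.\<close>

lemma tame_lipschitz:
  assumes bnd: "\<And>x. \<bar>f x\<bar> \<le> B + B * norm x" and lip: "\<And>x y. \<bar>f x - f y\<bar> \<le> L * norm (x - y)"
  shows "tame f"
  unfolding tame_def
proof (intro allI impI)
  fix d :: real assume d: "0 < d"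
  have B: "0 \<le> B" using bnd[of 0] by simp
  obtain e :: 'a where e: "norm e = 1" by (metis norm_Basis nonempty_Basis ex_in_conv)
  have L: "0 \<le> L" using lip[of e 0] e by simp
  have "tempered (B + B / d + L / d) d f" unfolding tempered_def
  proof (intro allI conjI impI)
    fix x :: 'a
    have "B + B * norm x \<le> B * exp (d * norm x) + B * (1 / d * exp (d * norm x))"
      using B d norm_le_exp[OF d, of x] by (intro add_mono mult_left_mono) (auto simp: mult_le_cancel_left1)
    also have "\<dots> \<le> (B + B / d + L / d) * exp (d * norm x)" using L d by (simp add: ring_distribs)
    finally show "\<bar>f x\<bar> \<le> (B + B / d + L / d) * exp (d * norm x)" using bnd[of x] by linarith
    fix y :: 'a assume "norm (x - y) \<le> 1"
    have "norm x * \<bar>f x - f y\<bar> \<le> (1 / d * exp (d * norm x)) * (L * norm (x - y))"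
      using lip norm_le_exp[OF d, of x] d by (intro mult_mono) auto
    also have "\<dots> \<le> (B + B / d + L / d) * exp (d * norm x) * norm (x - y)"
      using B d by (simp add: ring_distribs mult_ac)
    finally show "norm x * \<bar>f x - f y\<bar> \<le> (B + B / d + L / d) * exp (d * norm x) * norm (x - y)" .
  qed
  then show "\<exists>C. tempered C d f" by blast
qed

lemma tame_const: "tame (\<lambda>x. c)"
  by (rule tame_lipschitz[where B = "\<bar>c\<bar>" and L = 0]) auto

lemma tame_norm: "tame (\<lambda>x. norm x)"
  by (rule tame_lipschitz[where B = 1 and L = 1]) (auto intro: norm_triangle_ineq3)

lemma tame_inner: "tame (\<lambda>x. a \<bullet> x)"
proof (rule tame_lipschitz[where B = "norm a" and L = "norm a"])
  show "\<bar>a \<bullet> x\<bar> \<le> norm a + norm a * norm x" for x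
    using Cauchy_Schwarz_ineq2[of a x] by (simp add: add_increasing)
  show "\<bar>a \<bullet> x - a \<bullet> y\<bar> \<le> norm a * norm (x - y)" for x y
    using Cauchy_Schwarz_ineq2[of a "x - y"] by (simp add: inner_diff_right)
qed

text \<open>The direction field jumps at the origin, but its Lipschitz constant grows only like
  \<open>1 / norm x\<close>. This is the estimate that \<open>tempered\<close> is designed to
  accommodate. Multiplied by \<open>norm x\<close>, the difference splits into \<open>x - y\<close>
  and a multiple of \<open>sgn y\<close> of length at most \<open>norm (x - y)\<close>.\<close>

lemma norm_sgn_diff_le: "norm x * norm (sgn x - sgn y) \<le> 2 * norm (x - y)"
  for x y :: "'a::real_normed_vector"
proof (cases "y = 0")
  case True then show ?thesis by (cases "x = 0") (auto simp: norm_sgn)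
next
  case y: False
  show ?thesis
  proof (cases "x = 0")
    case True then show ?thesis by simp
  next
    case x: False
    have "norm x *\<^sub>R (sgn x - sgn y) = (x - y) + (norm y - norm x) *\<^sub>R sgn y"
      using x y by (simp add: sgn_div_norm algebra_simps)
    then have "norm x * norm (sgn x - sgn y) = norm ((x - y) + (norm y - norm x) *\<^sub>R sgn y)"
      by (metis norm_scaleR abs_norm_cancel)
    also have "\<dots> \<le> norm (x - y) + \<bar>norm y - norm x\<bar> * norm (sgn y)"
      by (metis norm_triangle_ineq norm_scaleR)
    also have "\<dots> \<le> norm (x - y) + \<bar>norm x - norm y\<bar>" by (simp add: norm_sgn abs_minus_commute)
    also have "\<dots> \<le> 2 * norm (x - y)" using norm_triangle_ineq3[of x y] by simp
    finally show ?thesis .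
  qed
qed

lemma tame_sgn_inner: "tame (\<lambda>x. sgn x \<bullet> b)"
  unfolding tame_def
proof (intro allI impI)
  fix d :: real assume d: "0 < d"
  have "tempered (2 * norm b) d (\<lambda>x. sgn x \<bullet> b)" unfolding tempered_def
  proof (intro allI conjI impI)
    fix x :: 'a
    have e: "1 \<le> exp (d * norm x)" using d by simp
    have "\<bar>sgn x \<bullet> b\<bar> \<le> norm (sgn x) * norm b" by (rule Cauchy_Schwarz_ineq2)
    also have "\<dots> \<le> 2 * norm b * 1" by (auto simp: norm_sgn)
    also have "\<dots> \<le> 2 * norm b * exp (d * norm x)" using e by (intro mult_left_mono) auto
    finally show "\<bar>sgn x \<bullet> b\<bar> \<le> 2 * norm b * exp (d * norm x)" .
    fix y :: 'a
    have "norm x * \<bar>sgn x \<bullet> b - sgn y \<bullet> b\<bar> \<le> norm x * (norm (sgn x - sgn y) * norm b)"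
      using Cauchy_Schwarz_ineq2[of "sgn x - sgn y" b] by (intro mult_left_mono) (auto simp: inner_diff_left)
    also have "\<dots> \<le> 2 * norm (x - y) * norm b * 1"
      using mult_right_mono[OF norm_sgn_diff_le[of x y], of "norm b"] by (simp add: mult_ac)
    also have "\<dots> \<le> 2 * norm (x - y) * norm b * exp (d * norm x)" using e by (intro mult_left_mono) auto
    finally show "norm x * \<bar>sgn x \<bullet> b - sgn y \<bullet> b\<bar> \<le> 2 * norm b * exp (d * norm x) * norm (x - y)"
      by (simp add: mult_ac)
  qed
  then show "\<exists>C. tempered C d (\<lambda>x. sgn x \<bullet> b)" by blast
qed

text \<open>A mean value estimate with the derivative evaluated at the end \<open>a\<close>, at the
  price of \<open>exp c\<close>. The asymmetry matches \<open>tempered\<close>, whose bound sits at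
  one of the two points.\<close>

lemma exp_diff_le:
  fixes a b :: real assumes "\<bar>a - b\<bar> \<le> c"
  shows "\<bar>exp a - exp b\<bar> \<le> exp c * exp a * \<bar>a - b\<bar>"
proof -
  have "\<bar>exp t - 1\<bar> \<le> exp c * \<bar>t\<bar>" if "\<bar>t\<bar> \<le> c" for t :: real
  proof (cases "0 \<le> t")
    case True
    have "1 - t \<le> exp (- t)" using exp_ge_add_one_self[of "- t"] by simp
    then have "exp t - 1 \<le> exp t * t" by (simp add: exp_minus field_simps)
    also have "\<dots> \<le> exp c * t" using True that by (intro mult_right_mono) auto
    finally show ?thesis using True by simp
  next
    case False
    have "1 - exp t \<le> - t" using exp_ge_add_one_self[of t] by linarith
    also have "\<dots> \<le> exp c * (- t)" using False that by (simp add: mult_le_cancel_right1)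
    finally show ?thesis using False by simp
  qed
  from this[of "b - a"] assms have *: "\<bar>exp (b - a) - 1\<bar> \<le> exp c * \<bar>a - b\<bar>" by (simp add: abs_minus_commute)
  have "\<bar>exp a - exp b\<bar> = exp a * \<bar>exp (b - a) - 1\<bar>"
    by (simp add: exp_diff field_simps abs_minus_commute)
  also have "\<dots> \<le> exp a * (exp c * \<bar>a - b\<bar>)" using * by (intro mult_left_mono) auto
  finally show ?thesis by (simp add: mult_ac)
qed

text \<open>The rate is raised by some \<open>d > 0\<close> because the derivative of the
  exponential comes multiplied by the unbounded factor \<open>norm x\<close>.\<close>

lemma tempered_exp_norm:
  assumes d: "0 < d"
  shows "\<exists>C. tempered C (t + d) (\<lambda>x. exp (t * norm x))"
proof -
  define C where "C = 1 + \<bar>t\<bar> * exp \<bar>t\<bar> / d"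
  have C: "1 \<le> C" using d by (simp add: C_def)
  have "tempered C (t + d) (\<lambda>x::'a. exp (t * norm x))" unfolding tempered_def
  proof (intro allI conjI impI)
    fix x :: 'a
    have "1 * exp (t * norm x) \<le> C * exp ((t + d) * norm x)"
      using C d by (intro mult_mono) (auto simp: ring_distribs)
    then show "\<bar>exp (t * norm x)\<bar> \<le> C * exp ((t + d) * norm x)" by simp
    fix y :: 'a assume xy: "norm (x - y) \<le> 1"
    have n: "\<bar>norm x - norm y\<bar> \<le> norm (x - y)" by (rule norm_triangle_ineq3)
    have e: "\<bar>t * norm x - t * norm y\<bar> = \<bar>t\<bar> * \<bar>norm x - norm y\<bar>"
      by (simp add: abs_mult[symmetric] ring_distribs)
    have le: "\<bar>t * norm x - t * norm y\<bar> \<le> \<bar>t\<bar> * norm (x - y)" unfolding e using n by (intro mult_left_mono) auto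
    also have "\<dots> \<le> \<bar>t\<bar> * 1" using xy by (intro mult_left_mono) auto
    finally have "\<bar>exp (t * norm x) - exp (t * norm y)\<bar> \<le> exp \<bar>t\<bar> * exp (t * norm x) * \<bar>t * norm x - t * norm y\<bar>"
      by (intro exp_diff_le) simp
    also have "\<dots> \<le> exp \<bar>t\<bar> * exp (t * norm x) * (\<bar>t\<bar> * norm (x - y))" using le by (intro mult_left_mono) auto
    finally have "norm x * \<bar>exp (t * norm x) - exp (t * norm y)\<bar>
        \<le> (1 / d * exp (d * norm x)) * (exp \<bar>t\<bar> * exp (t * norm x) * (\<bar>t\<bar> * norm (x - y)))"
      using norm_le_exp[OF d, of x] d by (intro mult_mono) auto
    also have "\<dots> = (\<bar>t\<bar> * exp \<bar>t\<bar> / d) * exp ((t + d) * norm x) * norm (x - y)"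
      by (simp add: ring_distribs exp_add)
    also have "\<dots> \<le> C * exp ((t + d) * norm x) * norm (x - y)"
      by (intro mult_right_mono) (auto simp: C_def)
    finally show "norm x * \<bar>exp (t * norm x) - exp (t * norm y)\<bar> \<le> C * exp ((t + d) * norm x) * norm (x - y)" .
  qed
  then show ?thesis ..
qed

lemma decaying_exp: assumes "0 < s" shows "decaying (\<lambda>x. exp (- s * norm x))"
proof -
  obtain C where "tempered C (- s + s / 2) (\<lambda>x::'a. exp (- s * norm x))"
    using tempered_exp_norm[of "s/2" "- s"] assms by auto
  then have "tempered C (- (s / 2)) (\<lambda>x::'a. exp (- s * norm x))" by simp
  then show ?thesis unfolding decaying_def using assms by (meson half_gt_zero)
qed

lemma tame_exp: assumes "s \<le> 0" shows "tame (\<lambda>x. exp (s * norm x))"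
  unfolding tame_def
proof (intro allI impI)
  fix d :: real assume d: "0 < d"
  obtain C where "tempered C (s + d) (\<lambda>x::'a. exp (s * norm x))" using tempered_exp_norm[OF d] by blast
  then have "tempered C d (\<lambda>x::'a. exp (s * norm x))" by (rule tempered_mono) (use assms in auto)
  then show "\<exists>C. tempered C d (\<lambda>x::'a. exp (s * norm x))" ..
qed

lemma decaying_imp_tame: "decaying f \<Longrightarrow> tame f"
  unfolding decaying_def tame_def
  by (metis less_imp_le neg_le_0_iff_le order.trans tempered_mono order_refl)

lemma tame_cmult: "tame f \<Longrightarrow> tame (\<lambda>x. c * f x)"
  by (rule tame_mult[OF tame_const])

lemma tame_diff: "tame f \<Longrightarrow> tame g \<Longrightarrow> tame (\<lambda>x. f x - g x)"
  using tame_add[of f "\<lambda>x. - 1 * g x"] tame_cmult[of g "- 1"] by simp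

lemma tame_sum: "(\<And>i. i \<in> I \<Longrightarrow> tame (f i)) \<Longrightarrow> tame (\<lambda>x. \<Sum>i\<in>I. f i x)"
  by (induction I rule: infinite_finite_induct) (auto intro: tame_add tame_const)

lemma tame_power: "tame f \<Longrightarrow> tame (\<lambda>x. f x ^ n)"
  by (induction n) (auto intro: tame_mult tame_const)

lemma tame_continuous:
  assumes "tame f" "x \<noteq> 0" shows "isCont f x"
proof -
  obtain C where C: "tempered C 1 f" using assms by (auto simp: tame_def intro: zero_less_one)
  define K where "K = C * exp (norm x) / norm x"
  have bnd: "\<bar>f x - f y\<bar> \<le> K * norm (x - y)" if "norm (x - y) \<le> 1" for y
  proof -
    have "norm x * \<bar>f x - f y\<bar> \<le> C * exp (1 * norm x) * norm (x - y)" using C that unfolding tempered_def by blast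
    then show ?thesis using assms by (simp add: K_def field_simps)
  qed
  have "((\<lambda>y. f y - f x) \<longlongrightarrow> 0) (at x)"
  proof (rule Lim_null_comparison[where g = "\<lambda>y. K * norm (x - y)"])
    show "\<forall>\<^sub>F y in at x. norm (f y - f x) \<le> K * norm (x - y)"
      unfolding eventually_at
      by (rule exI[of _ 1]) (use bnd in \<open>auto simp: dist_norm norm_minus_commute abs_minus_commute\<close>)
    have "((\<lambda>y. K * norm (x - y)) \<longlongrightarrow> K * norm (x - x)) (at x)" by (intro tendsto_intros)
    then show "((\<lambda>y. K * norm (x - y)) \<longlongrightarrow> 0) (at x)" by simp
  qed
  then show ?thesis using Lim_null isCont_def by blast
qed

lemma measurable_cont_off_0:
  fixes f :: "'a::euclidean_space \<Rightarrow> 'b::topological_space"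
  assumes "\<And>x. x \<noteq> 0 \<Longrightarrow> isCont f x" shows "f \<in> borel_measurable borel"
  by (rule borel_measurable_continuous_countable_exceptions[where X = "{0}"])
     (auto intro: continuous_at_imp_continuous_on assms)

lemma tame_measurable: "tame f \<Longrightarrow> f \<in> borel_measurable borel"
  by (rule measurable_cont_off_0) (rule tame_continuous)

subsection \<open>Integration by parts\<close>

lemma integral_lborel_shift:
  fixes f :: "'a::euclidean_space \<Rightarrow> real"
  assumes "integrable lborel f"
  shows "integrable lborel (\<lambda>x. f (x + a))" "(\<integral>x. f (x + a) \<partial>lborel) = (\<integral>x. f x \<partial>lborel)"
proof -
  have f: "f \<in> borel_measurable borel" using assms by auto
  have "(\<lambda>x. x + a) = (+) a" by (simp add: fun_eq_iff add.commute)
  then have d: "distr lborel borel (\<lambda>x. x + a) = lborel"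
    using lborel_distr_plus[of a] by simp
  have "integrable (distr lborel borel (\<lambda>x. x + a)) f" using assms by (simp add: d)
  then show "integrable lborel (\<lambda>x. f (x + a))" using f by (subst (asm) integrable_distr_eq) auto
  have "(\<integral>x. f x \<partial>lborel) = (\<integral>x. f x \<partial>distr lborel borel (\<lambda>x. x + a))" by (simp add: d)
  also have "\<dots> = (\<integral>x. f (x + a) \<partial>lborel)" using f by (subst integral_distr) auto
  finally show "(\<integral>x. f (x + a) \<partial>lborel) = (\<integral>x. f x \<partial>lborel)" by simp
qed

lemma AE_lborel_nonzero: "AE x in lborel. x \<noteq> (0::'a::euclidean_space)"
  by (rule AE_lborel_singleton)

lemma directional_quotient_LIMSEQ:
  fixes F :: "'a::real_normed_vector \<Rightarrow> real"
  assumes "(F has_derivative F') (at x)"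
  shows "(\<lambda>n. (F (x + inverse (real (Suc n)) *\<^sub>R b) - F x) / inverse (real (Suc n))) \<longlonglongrightarrow> F' b"
proof -
  have "((\<lambda>t. F (x + t *\<^sub>R b)) has_derivative (\<lambda>t. F' (t *\<^sub>R b))) (at 0)"
    by (rule has_derivative_compose[where f = "\<lambda>t. x + t *\<^sub>R b" and g = F]) (auto intro!: derivative_eq_intros assms)
  then have "((\<lambda>t. F (x + t *\<^sub>R b)) has_real_derivative F' b) (at 0)"
    using has_derivative_linear[OF assms]
    by (simp add: has_field_derivative_def linear_cmul mult.commute mult_commute_abs)
  then have "(\<lambda>t. (F (x + t *\<^sub>R b) - F x) / t) \<midarrow>0\<rightarrow> F' b"
    by (simp add: DERIV_def)
  moreover have "filterlim (\<lambda>n. inverse (real (Suc n))) (at 0) sequentially"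
    using LIMSEQ_inverse_real_of_nat by (simp add: filterlim_at)
  ultimately show ?thesis by (rule filterlim_compose)
qed

text \<open>\<open>DIM\<close> depends on the type alone, so the hypothesis is attached to a type
  token. Two is the least dimension in which \<open>1 / norm x\<close> is integrable near the
  origin.\<close>

locale dim_ge2 =
  fixes T :: "'a::euclidean_space itself"
  assumes dim: "2 \<le> DIM('a)"
begin

lemma decaying_integrable_over_norm:
  fixes f :: "'a \<Rightarrow> real"
  assumes "decaying f" shows "integrable lborel (\<lambda>x. f x / norm x)"
proof -
  obtain s C where s: "0 < s" and C: "tempered C (- s) f" using assms by (auto simp: decaying_def)
  have f: "f \<in> borel_measurable borel" using tame_measurable decaying_imp_tame assms by blast
  have "integrable lborel (\<lambda>x::'a. C * (exp (- s * norm x) / norm x))"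
    using integrable_exp_over_norm[OF s dim] by (rule integrable_mult_right)
  then show ?thesis
  proof (rule Bochner_Integration.integrable_bound)
    show "(\<lambda>x. f x / norm x) \<in> borel_measurable lborel" using f by simp
    have "norm (f x / norm x) \<le> norm (C * (exp (- s * norm x) / norm x))" for x
    proof -
      have "\<bar>f x\<bar> / norm x \<le> C * exp (- s * norm x) / norm x"
        using C by (intro divide_right_mono) (auto simp: tempered_def)
      then show ?thesis using tempered_nonneg[OF C] by (simp add: abs_mult)
    qed
    then show "AE x in lborel. norm (f x / norm x) \<le> norm (C * (exp (- s * norm x) / norm x))" by simp
  qed
qed

lemma decaying_integrable:
  fixes f :: "'a \<Rightarrow> real"
  assumes "decaying f" shows "integrable lborel f"
proof -
  have "integrable lborel (\<lambda>x. f x * norm x / norm x)"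
    by (intro decaying_integrable_over_norm decaying_mult_tame assms tame_norm)
  moreover have "f \<in> borel_measurable borel" using tame_measurable decaying_imp_tame assms by blast
  moreover have "AE x in lborel. f x * norm x / norm x = f x"
    using AE_lborel_nonzero by eventually_elim simp
  ultimately show ?thesis
    using integrable_cong_AE[of "\<lambda>x. f x * norm x / norm x" lborel f] by (simp add: borel_measurable_integrable)
qed

text \<open>Difference quotients integrate to zero by translation invariance, and
  \<open>tempered\<close> with a negative rate dominates them by a multiple of
  \<open>exp (- s * norm x) / norm x\<close>. Nothing is asked of the derivative at the origin, so
  no ball has to be cut out and no boundary term appears.\<close>

lemma integral_derivative_eq_0:
  fixes F :: "'a \<Rightarrow> real"
  assumes F: "decaying F" and der: "\<And>x. x \<noteq> 0 \<Longrightarrow> (F has_derivative F' x) (at x)" and b: "b \<in> Basis"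
  shows "integrable lborel (\<lambda>x. F' x b)" "(\<integral>x. F' x b \<partial>lborel) = 0"
proof -
  obtain s C where s: "0 < s" and C: "tempered C (- s) F" using F by (auto simp: decaying_def)
  define h where "h n = inverse (real (Suc n))" for n
  have h: "0 < h n" "h n \<le> 1" for n by (auto simp: h_def divide_simps)
  define q where "q n x = (F (x + h n *\<^sub>R b) - F x) / h n" for n x
  define w where "w x = C * (exp (- s * norm x) / norm x)" for x :: 'a
  have [measurable]: "F \<in> borel_measurable borel" using tame_measurable decaying_imp_tame F by blast
  have q[measurable]: "q n \<in> borel_measurable borel" for n unfolding q_def by measurable
  have iF: "integrable lborel F" by (rule decaying_integrable[OF F])
  have q0: "(\<integral>x. q n x \<partial>lborel) = 0" for n
    unfolding q_def using integral_lborel_shift[OF iF, of "h n *\<^sub>R b"] iF by simp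
  have lim: "(\<lambda>n. q n x) \<longlonglongrightarrow> F' x b" if "x \<noteq> 0" for x
    unfolding q_def h_def by (rule directional_quotient_LIMSEQ[OF der[OF that]])
  \<comment> \<open>Convergence of the quotients is unknown at the origin. The value there is
    replaced by zero, measurability follows from the pointwise limit, and the value is then
    restored.\<close>
  have "(\<lambda>x. if x = 0 then 0 else F' x b) \<in> borel_measurable borel"
  proof (rule borel_measurable_LIMSEQ_real)
    show "(\<lambda>n. if x = 0 then 0 else q n x) \<longlonglongrightarrow> (if x = 0 then 0 else F' x b)" for x using lim[of x] by simp
  qed measurable
  then have "(\<lambda>x. if x = 0 then F' 0 b else (if x = 0 then 0 else F' x b)) \<in> borel_measurable borel"
    by measurable
  also have "(\<lambda>x. if x = 0 then F' 0 b else (if x = 0 then 0 else F' x b)) = (\<lambda>x. F' x b)" by auto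
  finally have m: "(\<lambda>x. F' x b) \<in> borel_measurable lborel" by simp
  have w: "integrable lborel w"
    unfolding w_def using integrable_exp_over_norm[OF s dim] by (rule integrable_mult_right)
  have l: "AE x in lborel. (\<lambda>n. q n x) \<longlonglongrightarrow> F' x b"
    using AE_lborel_nonzero by eventually_elim (rule lim)
  have bnd: "AE x in lborel. norm (q n x) \<le> w x" for n
    using AE_lborel_nonzero
  proof eventually_elim
    case (elim x)
    have nh: "norm (x - (x + h n *\<^sub>R b)) = h n" using h[of n] b by simp
    then have "norm x * \<bar>F x - F (x + h n *\<^sub>R b)\<bar> \<le> C * exp (- s * norm x) * h n"
      using C h(2)[of n] unfolding tempered_def by metis
    then show ?case using elim h[of n]
      by (simp add: q_def w_def field_simps abs_minus_commute)
  qed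
  show "integrable lborel (\<lambda>x. F' x b)"
    by (rule integrable_dominated_convergence[OF m _ w l bnd]) simp
  have "(\<lambda>n. \<integral>x. q n x \<partial>lborel) \<longlonglongrightarrow> (\<integral>x. F' x b \<partial>lborel)"
    by (rule integral_dominated_convergence[OF m _ w l bnd]) simp
  then have "(\<lambda>n. 0::real) \<longlonglongrightarrow> (\<integral>x. F' x b \<partial>lborel)" by (simp add: q0)
  then show "(\<integral>x. F' x b \<partial>lborel) = 0" using LIMSEQ_unique tendsto_const by blast
qed

end

subsection \<open>Polynomials in the coordinates and the norm\<close>

text \<open>\<open>G\<close> is the gradient of \<open>q\<close> and \<open>M\<close> is
  \<open>norm x\<close> times its Laplacian, both off the origin. The factor keeps \<open>M\<close>
  tame: the Laplacian of the norm itself has a pole, but \<open>norm x\<close> times it is constant.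
  Both are explicit data so that they can be computed by sum and product rules.\<close>

definition regular :: "('a::euclidean_space \<Rightarrow> real) \<Rightarrow> ('a \<Rightarrow> 'a) \<Rightarrow> ('a \<Rightarrow> real) \<Rightarrow> bool" where
  "regular q G M \<longleftrightarrow> tame q \<and> tame M \<and> (\<forall>b. tame (\<lambda>x. G x \<bullet> b)) \<and>
     (\<forall>x. x \<noteq> 0 \<longrightarrow> (q has_derivative (\<lambda>h. h \<bullet> G x)) (at x)) \<and>
     (\<forall>x. x \<noteq> 0 \<longrightarrow> (\<exists>D. (\<forall>b. ((\<lambda>y. G y \<bullet> b) has_derivative D b) (at x)) \<and>
        M x = norm x * (\<Sum>b\<in>Basis. D b b)))"

lemma regularD:
  assumes "regular q G M"
  shows "tame q" "tame M" "tame (\<lambda>x. G x \<bullet> b)" "x \<noteq> 0 \<Longrightarrow> (q has_derivative (\<lambda>h. h \<bullet> G x)) (at x)"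
  using assms by (auto simp: regular_def)

lemma regular_divergence:
  assumes "regular q G M" "x \<noteq> 0"
  obtains D where "\<And>b. ((\<lambda>y. G y \<bullet> b) has_derivative D b) (at x)" "M x = norm x * (\<Sum>b\<in>Basis. D b b)"
proof -
  have "\<exists>D. (\<forall>b. ((\<lambda>y. G y \<bullet> b) has_derivative D b) (at x)) \<and> M x = norm x * (\<Sum>b\<in>Basis. D b b)"
    using assms unfolding regular_def by simp
  then show ?thesis using that by blast
qed

lemma tame_inner_fields:
  fixes F G :: "'a::euclidean_space \<Rightarrow> 'a"
  assumes "\<And>b. tame (\<lambda>x. F x \<bullet> b)" "\<And>b. tame (\<lambda>x. G x \<bullet> b)"
  shows "tame (\<lambda>x. F x \<bullet> G x)"
proof -
  have "tame (\<lambda>x. \<Sum>b\<in>Basis. (F x \<bullet> b) * (G x \<bullet> b))" using assms by (intro tame_sum tame_mult)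
  then show ?thesis unfolding euclidean_inner[symmetric] .
qed

lemma tame_inner_right: "tame (\<lambda>x. x \<bullet> b)"
  using tame_inner[of b] by (simp add: inner_commute)

lemma regular_const: "regular (\<lambda>x. c) (\<lambda>x. 0) (\<lambda>x. 0)"
  unfolding regular_def by (simp add: tame_const) (intro allI impI exI[of _ "\<lambda>_ _. 0"], simp)

lemma regular_add:
  assumes "regular q G M" "regular q' G' M'"
  shows "regular (\<lambda>x. q x + q' x) (\<lambda>x. G x + G' x) (\<lambda>x. M x + M' x)"
  unfolding regular_def
proof (intro conjI allI impI)
  show "tame (\<lambda>x. q x + q' x)" "tame (\<lambda>x. M x + M' x)" "tame (\<lambda>x. (G x + G' x) \<bullet> b)" for b
    unfolding inner_add_left by (intro tame_add regularD[OF assms(1)] regularD[OF assms(2)])+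
  fix x :: 'a assume x: "x \<noteq> 0"
  show "((\<lambda>x. q x + q' x) has_derivative (\<lambda>h. h \<bullet> (G x + G' x))) (at x)"
    using has_derivative_add[OF regularD(4)[OF assms(1) x] regularD(4)[OF assms(2) x]] by (simp add: inner_add_right)
  obtain D where D: "\<And>b. ((\<lambda>y. G y \<bullet> b) has_derivative D b) (at x)" "M x = norm x * (\<Sum>b\<in>Basis. D b b)"
    by (rule regular_divergence[OF assms(1) x]) blast
  obtain D' where D': "\<And>b. ((\<lambda>y. G' y \<bullet> b) has_derivative D' b) (at x)" "M' x = norm x * (\<Sum>b\<in>Basis. D' b b)"
    by (rule regular_divergence[OF assms(2) x]) blast
  show "\<exists>D. (\<forall>b. ((\<lambda>y. (G y + G' y) \<bullet> b) has_derivative D b) (at x)) \<and> M x + M' x = norm x * (\<Sum>b\<in>Basis. D b b)"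
  proof (rule exI[of _ "\<lambda>b h. D b h + D' b h"], intro conjI allI)
    show "((\<lambda>y. (G y + G' y) \<bullet> b) has_derivative (\<lambda>h. D b h + D' b h)) (at x)" for b
      unfolding inner_add_left using D D' by (intro has_derivative_add)
    show "M x + M' x = norm x * (\<Sum>b\<in>Basis. D b b + D' b b)"
      using D D' by (simp add: sum.distrib ring_distribs)
  qed
qed

lemma regular_mult:
  assumes "regular q G M" "regular q' G' M'"
  shows "regular (\<lambda>x. q x * q' x) (\<lambda>x. q x *\<^sub>R G' x + q' x *\<^sub>R G x)
           (\<lambda>x. q x * M' x + q' x * M x + 2 * (norm x * (G x \<bullet> G' x)))"
  unfolding regular_def
proof (intro conjI allI impI)
  have t: "tame q" "tame M" "tame q'" "tame M'" "\<And>b. tame (\<lambda>x. G x \<bullet> b)" "\<And>b. tame (\<lambda>x. G' x \<bullet> b)"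
    by (fact regularD[OF assms(1)] regularD[OF assms(2)])+
  show "tame (\<lambda>x. q x * q' x)" "tame (\<lambda>x. (q x *\<^sub>R G' x + q' x *\<^sub>R G x) \<bullet> b)"
    "tame (\<lambda>x. q x * M' x + q' x * M x + 2 * (norm x * (G x \<bullet> G' x)))" for b
    unfolding inner_add_left inner_scaleR_left
    using tame_inner_fields[of G G', OF t(5,6)] by (auto intro!: tame_add tame_mult t tame_const tame_norm)
  fix x :: 'a assume x: "x \<noteq> 0"
  note d = regularD(4)[OF assms(1) x] regularD(4)[OF assms(2) x]
  show "((\<lambda>x. q x * q' x) has_derivative (\<lambda>h. h \<bullet> (q x *\<^sub>R G' x + q' x *\<^sub>R G x))) (at x)"
    using has_derivative_mult[OF d] by (simp add: inner_add_right mult.commute)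
  obtain D where D: "\<And>b. ((\<lambda>y. G y \<bullet> b) has_derivative D b) (at x)" "M x = norm x * (\<Sum>b\<in>Basis. D b b)"
    by (rule regular_divergence[OF assms(1) x]) blast
  obtain D' where D': "\<And>b. ((\<lambda>y. G' y \<bullet> b) has_derivative D' b) (at x)" "M' x = norm x * (\<Sum>b\<in>Basis. D' b b)"
    by (rule regular_divergence[OF assms(2) x]) blast
  let ?D = "\<lambda>b h. (q x * D' b h + (h \<bullet> G x) * (G' x \<bullet> b)) + (q' x * D b h + (h \<bullet> G' x) * (G x \<bullet> b))"
  show "\<exists>D. (\<forall>b. ((\<lambda>y. (q y *\<^sub>R G' y + q' y *\<^sub>R G y) \<bullet> b) has_derivative D b) (at x)) \<and>
      q x * M' x + q' x * M x + 2 * (norm x * (G x \<bullet> G' x)) = norm x * (\<Sum>b\<in>Basis. D b b)"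
  proof (rule exI[of _ ?D], intro conjI allI)
    show "((\<lambda>y. (q y *\<^sub>R G' y + q' y *\<^sub>R G y) \<bullet> b) has_derivative ?D b) (at x)" for b
      unfolding inner_add_left inner_scaleR_left
      by (intro has_derivative_add has_derivative_mult d D D')
    have "(\<Sum>b\<in>Basis. ?D b b) = q x * (\<Sum>b\<in>Basis. D' b b) + q' x * (\<Sum>b\<in>Basis. D b b)
        + (\<Sum>b\<in>Basis. (G x \<bullet> b) * (G' x \<bullet> b)) + (\<Sum>b\<in>Basis. (G x \<bullet> b) * (G' x \<bullet> b))"
      by (simp add: sum.distrib sum_distrib_left inner_commute algebra_simps)
    also have "(\<Sum>b\<in>Basis. (G x \<bullet> b) * (G' x \<bullet> b)) = G x \<bullet> G' x" by (rule euclidean_inner[symmetric])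
    finally show "q x * M' x + q' x * M x + 2 * (norm x * (G x \<bullet> G' x)) = norm x * (\<Sum>b\<in>Basis. ?D b b)"
      using D D' by (simp add: algebra_simps)
  qed
qed

lemma regular_cmult:
  "regular q G M \<Longrightarrow> regular (\<lambda>x. c * q x) (\<lambda>x. c *\<^sub>R G x) (\<lambda>x. c * M x)"
  using regular_mult[OF regular_const[of c]] by simp

lemma regular_sum:
  assumes "finite I" "\<And>i. i \<in> I \<Longrightarrow> regular (q i) (G i) (M i)"
  shows "regular (\<lambda>x. \<Sum>i\<in>I. q i x) (\<lambda>x. \<Sum>i\<in>I. G i x) (\<lambda>x. \<Sum>i\<in>I. M i x)"
  using assms
proof (induction I rule: finite_induct)
  case empty show ?case using regular_const[of 0] by simp
next
  case (insert i I)
  then show ?case using regular_add[of "q i" "G i" "M i"] by simp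
qed

section \<open>Linear forms on the cone and homogeneous functions\<close>

text \<open>A linear form in one more variable, restricted to the cone of points
  \<open>(norm x, x)\<close>. Giving the norm the rank of a coordinate of degree one makes every
  polynomial in \<open>x\<close> and \<open>norm x\<close> a sum of products of such forms.\<close>

definition lin :: "real \<Rightarrow> 'a::euclidean_space \<Rightarrow> 'a \<Rightarrow> real" where
  "lin \<tau> a x = \<tau> * norm x + a \<bullet> x"

definition glin :: "real \<Rightarrow> 'a::euclidean_space \<Rightarrow> 'a \<Rightarrow> 'a" where
  "glin \<tau> a x = \<tau> *\<^sub>R sgn x + a"

lemma has_derivative_norm_sgn:
  "x \<noteq> (0::'a::real_inner) \<Longrightarrow> (norm has_derivative (\<lambda>h. h \<bullet> sgn x)) (at x)"
  by (rule has_derivative_norm)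

lemma has_derivative_sgn_inner:
  fixes x :: "'a::euclidean_space"
  assumes x: "x \<noteq> 0"
  shows "((\<lambda>y. sgn y \<bullet> b) has_derivative (\<lambda>h. (h \<bullet> b) / norm x - (x \<bullet> b) * (h \<bullet> sgn x) / (norm x)\<^sup>2)) (at x)"
proof -
  have "((\<lambda>y. (y \<bullet> b) / norm y) has_derivative
      (\<lambda>h. (h \<bullet> b) / norm x - (x \<bullet> b) * (h \<bullet> sgn x) / (norm x)\<^sup>2)) (at x)"
    using x by (auto intro!: derivative_eq_intros has_derivative_norm_sgn simp: field_simps power2_eq_square)
  then show ?thesis by (simp add: sgn_div_norm divide_inverse mult.commute)
qed

lemma inner_sgn_self: "x \<bullet> sgn x = norm x" for x :: "'a::real_inner"
  by (cases "x = 0") (auto simp: sgn_div_norm power2_norm_eq_inner[symmetric] power2_eq_square)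

lemma norm_mult_sgn: "norm x *\<^sub>R sgn x = x" for x :: "'a::real_normed_vector"
  by (cases "x = 0") (auto simp: sgn_div_norm)

lemma regular_lin:
  "regular (lin \<tau> a) (glin \<tau> a) (\<lambda>x::'a::euclidean_space. \<tau> * (real DIM('a) - 1))"
  unfolding regular_def
proof (intro conjI allI impI)
  show "tame (lin \<tau> a)" unfolding lin_def[abs_def] by (intro tame_add tame_cmult tame_norm tame_inner)
  show "tame (\<lambda>x::'a. \<tau> * (real DIM('a) - 1))" by (rule tame_const)
  show "tame (\<lambda>x. glin \<tau> a x \<bullet> b)" for b
    unfolding glin_def[abs_def] inner_add_left inner_scaleR_left
    by (intro tame_add tame_cmult tame_const tame_sgn_inner)
  fix x :: 'a assume x: "x \<noteq> 0"
  show "(lin \<tau> a has_derivative (\<lambda>h. h \<bullet> glin \<tau> a x)) (at x)"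
    unfolding lin_def[abs_def] glin_def
    using x by (auto intro!: derivative_eq_intros has_derivative_norm_sgn simp: inner_add_right inner_commute)
  let ?D = "\<lambda>b h. \<tau> * ((h \<bullet> b) / norm x - (x \<bullet> b) * (h \<bullet> sgn x) / (norm x)\<^sup>2)"
  show "\<exists>D. (\<forall>b. ((\<lambda>y. glin \<tau> a y \<bullet> b) has_derivative D b) (at x)) \<and>
      \<tau> * (real DIM('a) - 1) = norm x * (\<Sum>b\<in>Basis. D b b)"
  proof (rule exI[of _ ?D], intro conjI allI)
    show "((\<lambda>y. glin \<tau> a y \<bullet> b) has_derivative ?D b) (at x)" for b
      unfolding glin_def inner_add_left inner_scaleR_left
      using has_derivative_add[OF has_derivative_mult_right[OF has_derivative_sgn_inner[OF x, of b], of \<tau>]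
          has_derivative_const[of "a \<bullet> b"]] by simp
    have "(\<Sum>b\<in>Basis. ?D b b) = \<tau> * ((\<Sum>b\<in>(Basis::'a set). (b \<bullet> b) / norm x) - (\<Sum>b\<in>Basis. (x \<bullet> b) * (sgn x \<bullet> b)) / (norm x)\<^sup>2)"
      by (simp add: sum_distrib_left sum_subtractf sum_divide_distrib inner_commute right_diff_distrib)
    also have "(\<Sum>b\<in>Basis. (x \<bullet> b) * (sgn x \<bullet> b)) = norm x"
      by (simp only: euclidean_inner[symmetric] inner_sgn_self)
    also have "(\<Sum>b\<in>(Basis::'a set). (b \<bullet> b) / norm x) = real DIM('a) / norm x"
      by (simp add: inner_same_Basis)
    finally show "\<tau> * (real DIM('a) - 1) = norm x * (\<Sum>b\<in>Basis. ?D b b)"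
      using x by (simp add: field_simps power2_eq_square)
  qed
qed

text \<open>Sums of products of \<open>n\<close> linear forms, together with the gradient and
  \<open>norm x\<close> times the Laplacian that the product rule assigns. Because
  \<open>norm x\<close> squared is also the sum of the squared coordinates, representations are not
  unique; attaching the data to each construction avoids any choice of normal form.\<close>

inductive hom :: "nat \<Rightarrow> ('a::euclidean_space \<Rightarrow> real) \<Rightarrow> ('a \<Rightarrow> 'a) \<Rightarrow> ('a \<Rightarrow> real) \<Rightarrow> bool" where
  hom_const: "hom 0 (\<lambda>x. c) (\<lambda>x. 0) (\<lambda>x. 0)"
| hom_mult: "hom n q G M \<Longrightarrow> hom (Suc n) (\<lambda>x. lin \<tau> a x * q x) (\<lambda>x. lin \<tau> a x *\<^sub>R G x + q x *\<^sub>R glin \<tau> a x)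
     (\<lambda>x::'a. lin \<tau> a x * M x + q x * (\<tau> * (real DIM('a) - 1)) + 2 * (norm x * (glin \<tau> a x \<bullet> G x)))"
| hom_add: "hom n q G M \<Longrightarrow> hom n q' G' M' \<Longrightarrow> hom n (\<lambda>x. q x + q' x) (\<lambda>x. G x + G' x) (\<lambda>x. M x + M' x)"

abbreviation "homogeneous n q \<equiv> (\<exists>G M. hom n q G M)"

lemma hom_regular: "hom n q G M \<Longrightarrow> regular q G M"
  by (induction rule: hom.induct) (auto intro: regular_const regular_add regular_mult[OF regular_lin])

lemma hom_euler: "hom n q G M \<Longrightarrow> x \<bullet> G x = real n * q x"
proof (induction rule: hom.induct)
  case (hom_mult n q G M \<tau> a)
  then show ?case
    by (simp add: lin_def glin_def inner_add_right inner_sgn_self inner_commute algebra_simps)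
qed (auto simp: inner_add_right algebra_simps)

lemma homogeneous_add: "homogeneous n q \<Longrightarrow> homogeneous n q' \<Longrightarrow> homogeneous n (\<lambda>x. q x + q' x)"
  by (blast intro: hom_add)

lemma homogeneous_lin_mult: "homogeneous n q \<Longrightarrow> homogeneous (Suc n) (\<lambda>x. lin \<tau> a x * q x)"
  by (blast intro: hom_mult)

lemma homogeneous_lin: "homogeneous 1 (lin \<tau> a)"
  using homogeneous_lin_mult[of 0 "\<lambda>x. 1" \<tau> a] hom_const[of 1] by (auto simp: lin_def[abs_def])

lemma homogeneous_cmult: "homogeneous n q \<Longrightarrow> homogeneous n (\<lambda>x. c * q x)"
proof -
  have "hom n q G M \<Longrightarrow> homogeneous n (\<lambda>x. c * q x)" for G M
  proof (induction rule: hom.induct)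
    case (hom_const d) show ?case by (blast intro: hom.hom_const)
  next
    case (hom_mult n q G M \<tau> a)
    then show ?case using homogeneous_lin_mult[of n "\<lambda>x. c * q x" \<tau> a] by (simp add: mult_ac)
  next
    case (hom_add n q G M q' G' M')
    then show ?case using homogeneous_add[of n "\<lambda>x. c * q x" "\<lambda>x. c * q' x"] by (simp add: ring_distribs)
  qed
  then show "homogeneous n q \<Longrightarrow> homogeneous n (\<lambda>x. c * q x)" by blast
qed

lemma homogeneous_0: "homogeneous n (\<lambda>x. 0)"
proof (induction n)
  case 0 show ?case by (blast intro: hom_const)
next
  case (Suc n) then show ?case using homogeneous_lin_mult[of n "\<lambda>x. 0" 0 0] by simp
qed

lemma homogeneous_mult: "homogeneous m p \<Longrightarrow> homogeneous n q \<Longrightarrow> homogeneous (m + n) (\<lambda>x. p x * q x)"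
proof -
  assume q: "homogeneous n q"
  have "hom m p G M \<Longrightarrow> homogeneous (m + n) (\<lambda>x. p x * q x)" for G M
  proof (induction rule: hom.induct)
    case (hom_const d) show ?case using homogeneous_cmult[OF q] by simp
  next
    case (hom_mult m p G M \<tau> a)
    then show ?case using homogeneous_lin_mult[of "m + n" "\<lambda>x. p x * q x" \<tau> a] by (simp add: mult_ac)
  next
    case (hom_add m p G M p' G' M')
    then show ?case using homogeneous_add[of "m + n" "\<lambda>x. p x * q x" "\<lambda>x. p' x * q x"] by (simp add: ring_distribs)
  qed
  then show "homogeneous m p \<Longrightarrow> homogeneous (m + n) (\<lambda>x. p x * q x)" by blast
qed

lemma homogeneous_0_const: "homogeneous 0 q \<Longrightarrow> \<exists>c. q = (\<lambda>x. c)"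
proof -
  have "hom n q G M \<Longrightarrow> n = 0 \<Longrightarrow> \<exists>c. q = (\<lambda>x. c)" for n G M
    by (induction rule: hom.induct) auto
  then show "homogeneous 0 q \<Longrightarrow> \<exists>c. q = (\<lambda>x. c)" by blast
qed

text \<open>In degree one a single linear form is left with a constant factor; this is what makes
  the eigenfunctions for \<open>k = 1\<close> affine in \<open>x\<close> and
  \<open>norm x\<close>.\<close>

lemma homogeneous_1_lin: "homogeneous 1 q \<Longrightarrow> \<exists>\<tau> a. q = lin \<tau> a"
proof -
  have "hom n q G M \<Longrightarrow> n = 1 \<Longrightarrow> \<exists>\<tau> a. q = lin \<tau> a" for n G M
  proof (induction rule: hom.induct)
    case (hom_mult n q G M \<tau> a)
    then obtain c where "q = (\<lambda>x. c)" using homogeneous_0_const[of q] by auto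
    then have "(\<lambda>x. lin \<tau> a x * q x) = lin (c * \<tau>) (c *\<^sub>R a)" by (auto simp: lin_def algebra_simps)
    then show ?case by blast
  next
    case (hom_add n q G M q' G' M')
    then obtain \<tau> a \<tau>' a' where "q = lin \<tau> a" "q' = lin \<tau>' a'" by blast
    then have "(\<lambda>x. q x + q' x) = lin (\<tau> + \<tau>') (a + a')" by (auto simp: lin_def inner_add_left algebra_simps)
    then show ?case by blast
  qed simp
  then show "homogeneous 1 q \<Longrightarrow> \<exists>\<tau> a. q = lin \<tau> a" by blast
qed

text \<open>The algebraic core: the bracket \<open>norm x * (\<nabla>f \<bullet> \<nabla>g)\<close>
  maps two linear forms to a linear form again, since \<open>norm x\<close> cancels the denominator
  in \<open>sgn x\<close> and \<open>sgn x\<close> has length one. Without it the cross terms of the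
  Laplacian would leave the class of polynomials.\<close>

lemma norm_glin_inner:
  "norm x * (glin \<tau> a x \<bullet> glin \<tau>' a' x) = lin (\<tau> * \<tau>' + a \<bullet> a') (\<tau> *\<^sub>R a' + \<tau>' *\<^sub>R a) x"
proof (cases "x = 0")
  case False
  have n: "norm x * (sgn x \<bullet> b) = x \<bullet> b" "norm x * (b \<bullet> sgn x) = x \<bullet> b" for b
    using norm_mult_sgn[of x] by (metis inner_scaleR_left, metis inner_scaleR_right inner_commute)
  have "sgn x \<bullet> sgn x = 1" using False by (simp add: dot_square_norm norm_sgn)
  then have "glin \<tau> a x \<bullet> glin \<tau>' a' x = \<tau> * \<tau>' + \<tau> * (sgn x \<bullet> a') + \<tau>' * (a \<bullet> sgn x) + a \<bullet> a'"
    by (simp add: glin_def inner_add_left inner_add_right algebra_simps)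
  then have "norm x * (glin \<tau> a x \<bullet> glin \<tau>' a' x)
      = \<tau> * \<tau>' * norm x + \<tau> * (norm x * (sgn x \<bullet> a')) + \<tau>' * (norm x * (a \<bullet> sgn x)) + norm x * (a \<bullet> a')"
    by (simp add: algebra_simps)
  then show ?thesis unfolding n by (simp add: lin_def inner_add_left inner_commute algebra_simps)
qed (simp add: lin_def)

text \<open>The bracket with a fixed linear form is a derivation, so its value on linear forms
  determines the degree of its value on products.\<close>

lemma homogeneous_bracket:
  "hom n q G M \<Longrightarrow> homogeneous n (\<lambda>x. norm x * (glin \<tau> a x \<bullet> G x))"
proof (induction rule: hom.induct)
  case (hom_const c) show ?case using homogeneous_0 by simp
next
  case (hom_mult n q G M \<tau>' a')
  have "homogeneous (Suc n) (\<lambda>x. lin \<tau>' a' x * (norm x * (glin \<tau> a x \<bullet> G x))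
      + lin (\<tau> * \<tau>' + a \<bullet> a') (\<tau> *\<^sub>R a' + \<tau>' *\<^sub>R a) x * q x)"
    using hom_mult by (intro homogeneous_add homogeneous_lin_mult) blast+
  also have "(\<lambda>x. lin \<tau>' a' x * (norm x * (glin \<tau> a x \<bullet> G x))
      + lin (\<tau> * \<tau>' + a \<bullet> a') (\<tau> *\<^sub>R a' + \<tau>' *\<^sub>R a) x * q x)
     = (\<lambda>x. norm x * (glin \<tau> a x \<bullet> (lin \<tau>' a' x *\<^sub>R G x + q x *\<^sub>R glin \<tau>' a' x)))"
    by (simp only: norm_glin_inner[symmetric]) (simp add: inner_add_right algebra_simps)
  finally show ?case .
next
  case (hom_add n q G M q' G' M')
  then show ?case
    using homogeneous_add[of n "\<lambda>x. norm x * (glin \<tau> a x \<bullet> G x)" "\<lambda>x. norm x * (glin \<tau> a x \<bullet> G' x)"]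
    by (simp add: inner_add_right ring_distribs)
qed

text \<open>In the product rule all three terms have the degree of the old factor, so
  \<open>norm x\<close> times the Laplacian lowers degree by one. The subtraction
  \<open>n - 1\<close> is truncated at zero; the first conjunct says what happens there, and the
  induction step from degree 0 to 1 relies on it.\<close>

lemma hom_laplacian:
  "hom n q G M \<Longrightarrow> (n = 0 \<longrightarrow> M = (\<lambda>x. 0)) \<and> homogeneous (n - 1) M"
proof (induction rule: hom.induct)
  case (hom_const c) show ?case using homogeneous_0 by simp
next
  case (hom_mult n q G M \<tau> a)
  have "homogeneous n (\<lambda>x. lin \<tau> a x * M x)"
  proof (cases n)
    case 0 then show ?thesis using hom_mult homogeneous_0 by simp
  next
    case (Suc m) then show ?thesis using hom_mult homogeneous_lin_mult[of m M \<tau> a] by simp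
  qed
  moreover have "homogeneous n (\<lambda>x::'a. q x * (\<tau> * (real DIM('a) - 1)))"
    using homogeneous_cmult[of n q "\<tau> * (real DIM('a) - 1)"] hom_mult by (subst mult.commute) blast
  moreover have "homogeneous n (\<lambda>x. 2 * (norm x * (glin \<tau> a x \<bullet> G x)))"
    using homogeneous_cmult homogeneous_bracket hom_mult by blast
  ultimately show ?case by (auto intro!: homogeneous_add)
next
  case (hom_add n q G M q' G' M')
  then have "homogeneous (n - 1) M" "homogeneous (n - 1) M'" by blast+
  then have "homogeneous (n - 1) (\<lambda>x. M x + M' x)" by (rule homogeneous_add)
  then show ?case using hom_add by simp
qed

subsection \<open>Decomposition into eigenfunctions\<close>

text \<open>The eigenvalue equation of the operator with eigenvalue \<open>s * real k\<close>. The
  clauses for \<open>k = 0\<close> and \<open>k = 1\<close> are carried along because the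
  approximating profiles of the two distances are finally read off from them.\<close>

definition eigen :: "real \<Rightarrow> nat \<Rightarrow> ('a::euclidean_space \<Rightarrow> real) \<Rightarrow> ('a \<Rightarrow> 'a) \<Rightarrow> ('a \<Rightarrow> real) \<Rightarrow> bool" where
  "eigen s k q G M \<longleftrightarrow> regular q G M \<and> (\<forall>x. s * (x \<bullet> G x) - M x = s * real k * q x) \<and>
     (k = 0 \<longrightarrow> (\<exists>c. q = (\<lambda>x. c))) \<and> (k = 1 \<longrightarrow> (\<exists>c d a. q = (\<lambda>x. c + d * norm x + a \<bullet> x)))"

abbreviation "eigenfunction s k q \<equiv> (\<exists>G M. eigen s k q G M)"

lemma eigenfunction_tame: "eigenfunction s k q \<Longrightarrow> tame q"
  by (auto simp: eigen_def dest: regularD)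

lemma eigen_add:
  assumes "eigen s k q G M" "eigen s k q' G' M'"
  shows "eigen s k (\<lambda>x. q x + q' x) (\<lambda>x. G x + G' x) (\<lambda>x. M x + M' x)"
  unfolding eigen_def
proof (intro conjI allI impI)
  show "regular (\<lambda>x. q x + q' x) (\<lambda>x. G x + G' x) (\<lambda>x. M x + M' x)"
    using assms by (auto simp: eigen_def intro: regular_add)
  fix x
  have "s * (x \<bullet> G x) - M x = s * real k * q x" "s * (x \<bullet> G' x) - M' x = s * real k * q' x"
    using assms by (auto simp: eigen_def)
  then show "s * (x \<bullet> (G x + G' x)) - (M x + M' x) = s * real k * (q x + q' x)"
    by (simp add: inner_add_right algebra_simps)
next
  assume "k = 0"
  then obtain c c' where "q = (\<lambda>x. c)" "q' = (\<lambda>x. c')" using assms by (auto simp: eigen_def)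
  then show "\<exists>c. (\<lambda>x. q x + q' x) = (\<lambda>x. c)" by auto
next
  assume "k = 1"
  then have "\<exists>c d a. q = (\<lambda>x. c + d * norm x + a \<bullet> x)" "\<exists>c d a. q' = (\<lambda>x. c + d * norm x + a \<bullet> x)"
    using assms by (auto simp: eigen_def)
  then obtain c d a c' d' a' where "q = (\<lambda>x. c + d * norm x + a \<bullet> x)" "q' = (\<lambda>x. c' + d' * norm x + a' \<bullet> x)"
    by blast
  then have "(\<lambda>x. q x + q' x) = (\<lambda>x. (c + c') + (d + d') * norm x + (a + a') \<bullet> x)"
    by (auto simp: inner_add_left algebra_simps)
  then show "\<exists>c d a. (\<lambda>x. q x + q' x) = (\<lambda>x. c + d * norm x + a \<bullet> x)" by blast
qed

lemma eigen_cmult: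
  assumes "eigen s k q G M"
  shows "eigen s k (\<lambda>x. c * q x) (\<lambda>x. c *\<^sub>R G x) (\<lambda>x. c * M x)"
  unfolding eigen_def
proof (intro conjI allI impI)
  show "regular (\<lambda>x. c * q x) (\<lambda>x. c *\<^sub>R G x) (\<lambda>x. c * M x)"
    using assms by (auto simp: eigen_def intro: regular_cmult)
  fix x
  have "s * (x \<bullet> G x) - M x = s * real k * q x" using assms by (auto simp: eigen_def)
  then have "c * (s * (x \<bullet> G x) - M x) = c * (s * real k * q x)" by simp
  then show "s * (x \<bullet> c *\<^sub>R G x) - c * M x = s * real k * (c * q x)" by (simp add: algebra_simps)
next
  assume "k = 0"
  then show "\<exists>d. (\<lambda>x. c * q x) = (\<lambda>x. d)" using assms by (auto simp: eigen_def)
next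
  assume "k = 1"
  then obtain c' d a where "q = (\<lambda>x. c' + d * norm x + a \<bullet> x)" using assms unfolding eigen_def by blast
  then have "(\<lambda>x. c * q x) = (\<lambda>x. (c * c') + (c * d) * norm x + (c *\<^sub>R a) \<bullet> x)"
    by (auto simp: algebra_simps)
  then show "\<exists>c' d a. (\<lambda>x. c * q x) = (\<lambda>x. c' + d * norm x + a \<bullet> x)" by blast
qed

lemma eigen_0: "eigen s k (\<lambda>x. 0) (\<lambda>x. 0) (\<lambda>x. 0)"
proof -
  have "\<exists>c d a. (\<lambda>x::'a. 0::real) = (\<lambda>x. c + d * norm x + a \<bullet> x)"
    by (intro exI[of _ "0::real"] exI[of _ "0::'a"]) auto
  then show ?thesis unfolding eigen_def using regular_const[of 0] by auto
qed

lemma eigenfunction_add: "eigenfunction s k q \<Longrightarrow> eigenfunction s k q' \<Longrightarrow> eigenfunction s k (\<lambda>x. q x + q' x)"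
  using eigen_add by blast

lemma eigenfunction_cmult: "eigenfunction s k q \<Longrightarrow> eigenfunction s k (\<lambda>x. c * q x)"
  using eigen_cmult by blast

text \<open>
  If \<open>f\<close> is homogeneous of degree \<open>n\<close> and \<open>M\<close> is \<open>norm x\<close> times its Laplacian, then \<open>f\<close> is an
  eigenfunction up to \<open>M\<close>, which has lower degree; expanding \<open>M\<close> into eigenfunctions \<open>g k\<close>, the
  error is removed by subtracting \<open>g k / (s (n - k))\<close>.
\<close>
lemma homogeneous_eigen_decomposition:
  assumes s: "s \<noteq> 0"
  shows "homogeneous n f \<Longrightarrow> \<exists>Q. (\<forall>k. eigenfunction s k (Q k)) \<and> f = (\<lambda>x. \<Sum>k\<le>n. Q k x)"
proof (induction n arbitrary: f)
  case 0
  then obtain G M where h: "hom 0 f G M" by blast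
  then have "eigen s 0 f G M"
    using hom_regular[OF h] hom_laplacian[OF h] hom_euler[OF h] homogeneous_0_const[of f] by (auto simp: eigen_def)
  then have "\<forall>k. eigenfunction s k (if k = 0 then f else (\<lambda>x. 0))" using eigen_0 by (metis (full_types))
  then show ?case by (intro exI[of _ "\<lambda>k. if k = 0 then f else (\<lambda>x. 0)"]) auto
next
  case (Suc n f)
  then obtain G M where h: "hom (Suc n) f G M" by blast
  then have "homogeneous n M" using hom_laplacian by force
  then obtain g where g: "\<And>k. eigenfunction s k (g k)" and Mg: "M = (\<lambda>x. \<Sum>k\<le>n. g k x)"
    using Suc.IH by blast
  from g obtain Gg Mg where gg: "\<And>k. eigen s k (g k) (Gg k) (Mg k)" by metis
  define c where "c k = 1 / (s * (real (Suc n) - real k))" for k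
  have c: "c k * (s * (real (Suc n) - real k)) = 1" if "k \<le> n" for k using that s by (simp add: c_def)
  define w where "w x = f x + (\<Sum>k\<le>n. (- c k) * g k x)" for x
  define Gw where "Gw x = G x + (\<Sum>k\<le>n. (- c k) *\<^sub>R Gg k x)" for x
  define Mw where "Mw x = M x + (\<Sum>k\<le>n. (- c k) * Mg k x)" for x
  have "eigen s (Suc n) w Gw Mw" unfolding eigen_def
  proof (intro conjI allI impI)
    show "regular w Gw Mw" unfolding w_def[abs_def] Gw_def[abs_def] Mw_def[abs_def]
      using gg by (intro regular_add regular_sum regular_cmult hom_regular[OF h]) (auto simp: eigen_def)
    fix x
    have e: "s * (x \<bullet> Gg k x) = Mg k x + s * real k * g k x" for k
      using gg[of k] by (simp add: eigen_def algebra_simps)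
    have "s * (x \<bullet> Gw x) - Mw x
        = s * real (Suc n) * f x - M x + (\<Sum>k\<le>n. (- c k) * (s * (x \<bullet> Gg k x) - Mg k x))"
      using hom_euler[OF h, of x]
      by (simp add: Gw_def Mw_def inner_add_right inner_sum_right sum_negf sum_distrib_left sum_subtractf algebra_simps)
    also have "\<dots> = s * real (Suc n) * f x - (\<Sum>k\<le>n. g k x) + (\<Sum>k\<le>n. (- c k) * (s * real k * g k x))"
      by (simp add: e Mg)
    also have "\<dots> = s * real (Suc n) * f x + (\<Sum>k\<le>n. (- c k) * (s * real k * g k x) - g k x)"
      by (simp add: sum_subtractf)
    also have "(\<Sum>k\<le>n. (- c k) * (s * real k * g k x) - g k x) = (\<Sum>k\<le>n. s * real (Suc n) * ((- c k) * g k x))"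
    proof (rule sum.cong)
      fix k assume "k \<in> {..n}"
      then have "1 = c k * (s * (real (Suc n) - real k))" using c[of k] by simp
      then have "g k x = c k * (s * (real (Suc n) - real k)) * g k x" by simp
      then show "(- c k) * (s * real k * g k x) - g k x = s * real (Suc n) * ((- c k) * g k x)"
        by (simp add: algebra_simps)
    qed simp
    also have "s * real (Suc n) * f x + (\<Sum>k\<le>n. s * real (Suc n) * ((- c k) * g k x)) = s * real (Suc n) * w x"
      by (simp only: w_def distrib_left sum_distrib_left)
    finally show "s * (x \<bullet> Gw x) - Mw x = s * real (Suc n) * w x" .
  next
    assume n: "Suc n = 1"
    have "homogeneous 1 f" using Suc.prems unfolding n .
    then obtain \<tau> a where f: "f = lin \<tau> a" using homogeneous_1_lin by blast
    obtain d where "g 0 = (\<lambda>x. d)" using gg[of 0] by (auto simp: eigen_def)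
    \<comment> \<open>In degree one only the constant \<open>g 0\<close> is subtracted from a linear
      form, so the result is affine in \<open>x\<close> and \<open>norm x\<close>.\<close>
    then have "w = (\<lambda>x. (- c 0 * d) + \<tau> * norm x + a \<bullet> x)" using n f by (auto simp: w_def lin_def)
    then show "\<exists>c d a. w = (\<lambda>x. c + d * norm x + a \<bullet> x)" by blast
  qed simp
  then have w: "eigenfunction s (Suc n) w" by blast
  define Q where "Q k = (if k = Suc n then w else (\<lambda>x. c k * g k x))" for k
  have "eigenfunction s k (Q k)" for k
    unfolding Q_def using w eigenfunction_cmult[OF g[of k]] by simp
  moreover have "f = (\<lambda>x. \<Sum>k\<le>Suc n. Q k x)"
    by (auto simp: Q_def w_def sum_negf)
  ultimately show ?case by blast
qed

section \<open>Polynomials of mixed degree\<close>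

inductive pol :: "('a::euclidean_space \<Rightarrow> real) \<Rightarrow> bool" where
  pol_hom: "homogeneous n q \<Longrightarrow> pol q"
| pol_add: "pol p \<Longrightarrow> pol q \<Longrightarrow> pol (\<lambda>x. p x + q x)"

lemma pol_tame: "pol q \<Longrightarrow> tame q"
  by (induction rule: pol.induct) (auto dest!: hom_regular dest: regularD(1) intro: tame_add)

lemma pol_const: "pol (\<lambda>x. c)"
  using hom_const[of c] by (blast intro: pol_hom)

lemma pol_norm: "pol norm"
  using homogeneous_lin[of 1 0] pol_hom by (fastforce simp: lin_def[abs_def])

lemma pol_inner: "pol (\<lambda>x. a \<bullet> x)"
  using homogeneous_lin[of 0 a] pol_hom by (fastforce simp: lin_def[abs_def])

lemma pol_mult: "pol p \<Longrightarrow> pol q \<Longrightarrow> pol (\<lambda>x. p x * q x)"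
proof (induction rule: pol.induct)
  case (pol_hom n p)
  from pol_hom(2) show ?case
  proof (induction rule: pol.induct)
    case (pol_hom m q)
    then show ?case using homogeneous_mult \<open>homogeneous n p\<close> pol.pol_hom by blast
  next
    case (pol_add q q')
    then show ?case using pol.pol_add[of "\<lambda>x. p x * q x" "\<lambda>x. p x * q' x"] by (simp add: ring_distribs)
  qed
next
  case (pol_add p p')
  then show ?case using pol.pol_add[of "\<lambda>x. p x * q x" "\<lambda>x. p' x * q x"] by (simp add: ring_distribs)
qed

lemma pol_power: "pol p \<Longrightarrow> pol (\<lambda>x. p x ^ n)"
  by (induction n) (auto intro: pol_const pol_mult)

lemma pol_sum: "finite I \<Longrightarrow> (\<And>i. i \<in> I \<Longrightarrow> pol (f i)) \<Longrightarrow> pol (\<lambda>x. \<Sum>i\<in>I. f i x)"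
  by (induction I rule: finite_induct) (auto intro: pol_add pol_const)

lemma pol_eigen_decomposition:
  assumes "pol f" "s \<noteq> 0"
  shows "\<exists>n Q. (\<forall>k. eigenfunction s k (Q k)) \<and> f = (\<lambda>x. \<Sum>k<n. Q k x)"
  using assms(1)
proof (induction rule: pol.induct)
  case (pol_hom n q)
  then show ?case using homogeneous_eigen_decomposition[OF assms(2) pol_hom] by (metis lessThan_Suc_atMost)
next
  case (pol_add p q)
  then obtain m P n Q where P: "\<And>k. eigenfunction s k (P k)" "p = (\<lambda>x. \<Sum>k<m. P k x)"
    and Q: "\<And>k. eigenfunction s k (Q k)" "q = (\<lambda>x. \<Sum>k<n. Q k x)" by blast
  \<comment> \<open>The 0-1 factors pad both expansions to the common length \<open>m + n\<close>; a
    zero multiple of an eigenfunction is again one.\<close>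
  define R where "R k x = (if k < m then 1 else 0) * P k x + (if k < n then 1 else 0) * Q k x" for k x
  have "eigenfunction s k (R k)" for k
    unfolding R_def[abs_def] by (intro eigenfunction_add eigenfunction_cmult P Q)
  moreover have "(\<lambda>x. p x + q x) = (\<lambda>x. \<Sum>k<m + n. R k x)"
  proof
    fix x
    have "(\<Sum>k<m + n. (if k < m then 1 else 0) * P k x) = (\<Sum>k<m. P k x)"
      by (rule sum.mono_neutral_cong_right) auto
    moreover have "(\<Sum>k<m + n. (if k < n then 1 else 0) * Q k x) = (\<Sum>k<n. Q k x)"
      by (rule sum.mono_neutral_cong_right) auto
    ultimately show "p x + q x = (\<Sum>k<m + n. R k x)" by (simp add: R_def sum.distrib P Q)
  qed
  ultimately show ?case by blast
qed

text \<open>Agreement at every point but one, rather than almost everywhere, also yields the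
  measurability of \<open>g\<close>: it differs from \<open>f\<close> only in its value at the
  origin.\<close>

lemma integral_cong_off_0:
  fixes f g :: "'a::euclidean_space \<Rightarrow> real"
  assumes f: "integrable lborel f" and eq: "\<And>x. x \<noteq> 0 \<Longrightarrow> f x = g x"
  shows "integrable lborel g" "(\<integral>x. g x \<partial>lborel) = (\<integral>x. f x \<partial>lborel)"
proof -
  have [measurable]: "f \<in> borel_measurable lborel" using f by auto
  have "(\<lambda>x. if x = 0 then g 0 else f x) \<in> borel_measurable lborel" by measurable
  also have "(\<lambda>x. if x = 0 then g 0 else f x) = g" using eq by auto
  finally have g: "g \<in> borel_measurable lborel" .
  have ae: "AE x in lborel. f x = g x" using AE_lborel_nonzero by eventually_elim (rule eq)
  show "integrable lborel g" using integrable_cong_AE[OF _ g ae] f by auto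
  show "(\<integral>x. g x \<partial>lborel) = (\<integral>x. f x \<partial>lborel)" using integral_cong_AE[OF _ g ae] f by auto
qed

subsection \<open>Spectral gaps\<close>

text \<open>For an eigenfunction \<open>v\<close>, the function
  \<open>v * exp (- s / 2 * norm x)\<close> solves a Schroedinger equation with Coulomb potential at
  fixed energy \<open>- s^2 / 4\<close> and quantised charge: these are the Coulomb Sturmian
  functions.\<close>

locale coulomb = dim_ge2 T for T :: "'a::euclidean_space itself" +
  fixes s :: real
  assumes s: "0 < s"
begin

definition weight :: "'a \<Rightarrow> real" where
  "weight x = exp (- s * norm x) / norm x"

definition ip :: "('a \<Rightarrow> real) \<Rightarrow> ('a \<Rightarrow> real) \<Rightarrow> real" where
  "ip f g = (\<integral>x. f x * g x * weight x \<partial>lborel)"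

abbreviation sqdist :: "('a \<Rightarrow> real) \<Rightarrow> ('a \<Rightarrow> real) \<Rightarrow> real" where
  "sqdist f g \<equiv> ip (\<lambda>x. f x - g x) (\<lambda>x. f x - g x)"

lemma tame_integrable:
  assumes "tame f" shows "integrable lborel (\<lambda>x::'a. f x * exp (- s * norm x))"
  using decaying_integrable[OF decaying_mult_tame[OF decaying_exp[OF s] assms]] by (simp add: mult.commute)

lemma tame_integrable_weight:
  assumes "tame f" shows "integrable lborel (\<lambda>x::'a. f x * weight x)"
  unfolding weight_def using decaying_integrable_over_norm[OF decaying_mult_tame[OF decaying_exp[OF s] assms]] by (simp add: mult.commute)

lemma ip_integrable:
  "tame f \<Longrightarrow> tame g \<Longrightarrow> integrable lborel (\<lambda>x::'a. f x * g x * weight x)"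
  by (rule tame_integrable_weight[OF tame_mult])

lemma ip_commute: "ip f g = ip g f"
  unfolding ip_def by (rule Bochner_Integration.integral_cong) auto

lemma ip_nonneg: "0 \<le> ip f f"
  unfolding ip_def weight_def by (rule integral_nonneg_AE) auto

lemma ip_sum_right:
  assumes "tame f" "finite I" "\<And>i. i \<in> I \<Longrightarrow> tame (g i)"
  shows "ip f (\<lambda>x. \<Sum>i\<in>I. c i * g i x) = (\<Sum>i\<in>I. c i * ip f (g i))"
proof -
  have "ip f (\<lambda>x. \<Sum>i\<in>I. c i * g i x)
      = (\<integral>x. (\<Sum>i\<in>I. c i * (f x * g i x * weight x)) \<partial>lborel)"
    unfolding ip_def by (simp add: sum_distrib_left sum_distrib_right sum_divide_distrib mult_ac)
  also have "\<dots> = (\<Sum>i\<in>I. \<integral>x. c i * (f x * g i x * weight x) \<partial>lborel)"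
    by (rule Bochner_Integration.integral_sum) (intro integrable_mult_right ip_integrable assms)
  finally show ?thesis by (simp add: ip_def)
qed

lemma ip_cmult_right:
  assumes "tame f" "tame g" shows "ip f (\<lambda>x. c * g x) = c * ip f g"
  using ip_sum_right[where I = "{0::nat}" and g = "\<lambda>_. g" and c = "\<lambda>_. c", OF assms(1)] assms(2) by simp

lemma ip_diff_self:
  assumes "tame f" "tame g"
  shows "sqdist f g = ip f f - 2 * ip f g + ip g g"
proof -
  have "sqdist f g = (\<integral>x. f x * f x * weight x
      - 2 * (f x * g x * weight x) + g x * g x * weight x \<partial>lborel)"
    unfolding ip_def by (rule Bochner_Integration.integral_cong) (auto simp: algebra_simps add_divide_distrib diff_divide_distrib)
  also have "\<dots> = ip f f - 2 * ip f g + ip g g"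
  proof -
    note i = ip_integrable[OF assms(1) assms(1)] ip_integrable[OF assms] ip_integrable[OF assms(2) assms(2)]
    note d = Bochner_Integration.integrable_diff[OF i(1) integrable_mult_right[OF i(2), of 2]]
    show ?thesis unfolding ip_def using Bochner_Integration.integral_add[OF d i(3)]
      Bochner_Integration.integral_diff[OF i(1) integrable_mult_right[OF i(2), of 2]] by simp
  qed
  finally show ?thesis .
qed

text \<open>The divergence of \<open>exp (- s * norm x) * v * G\<close> integrates to zero. Second
  derivatives fall on \<open>q\<close> only, and integrability of \<open>Gv \<bullet> G\<close>
  against the exponential is a conclusion: it is that divergence plus a tame function against the
  weight.\<close>

lemma integration_by_parts:
  fixes v :: "'a \<Rightarrow> real"
  assumes v: "tame v" and dv: "\<And>x. x \<noteq> 0 \<Longrightarrow> (v has_derivative (\<lambda>h. h \<bullet> Gv x)) (at x)"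
    and q: "regular q G M"
  shows "integrable lborel (\<lambda>x. (Gv x \<bullet> G x) * exp (- s * norm x))"
    and "(\<integral>x. (Gv x \<bullet> G x) * exp (- s * norm x) \<partial>lborel) = ip v (\<lambda>x. s * (x \<bullet> G x) - M x)"
proof -
  let ?e = "\<lambda>x::'a. exp (- s * norm x)"
  have "\<exists>D. \<forall>x. x \<noteq> 0 \<longrightarrow> ((\<forall>b. ((\<lambda>y. G y \<bullet> b) has_derivative D x b) (at x)) \<and> M x = norm x * (\<Sum>b\<in>Basis. D x b b))"
    using q unfolding regular_def by (intro choice) blast
  then obtain D where D: "\<And>x b. x \<noteq> 0 \<Longrightarrow> ((\<lambda>y. G y \<bullet> b) has_derivative D x b) (at x)"
    and M: "\<And>x. x \<noteq> 0 \<Longrightarrow> M x = norm x * (\<Sum>b\<in>Basis. D x b b)" by blast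
  define F' where "F' b x h = ?e x * (v x * D x b h + (h \<bullet> Gv x) * (G x \<bullet> b)) + (?e x * (- s * (h \<bullet> sgn x))) * (v x * (G x \<bullet> b))" for b x h
  have F: "decaying (\<lambda>x. ?e x * (v x * (G x \<bullet> b)))" for b
    by (intro decaying_mult_tame decaying_exp s tame_mult v regularD[OF q])
  have dF: "((\<lambda>x. ?e x * (v x * (G x \<bullet> b))) has_derivative F' b x) (at x)" if x: "x \<noteq> 0" for b x
  proof -
    have "((\<lambda>x. ?e x) has_derivative (\<lambda>h. ?e x * (- s * (h \<bullet> sgn x)))) (at x)"
      using x by (auto intro!: derivative_eq_intros has_derivative_norm_sgn)
    then show ?thesis unfolding F'_def[abs_def]
      by (intro has_derivative_mult dv D x)
  qed
  have F'0: "integrable lborel (\<lambda>x. F' b x b)" "(\<integral>x. F' b x b \<partial>lborel) = 0" if "b \<in> Basis" for b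
    using integral_derivative_eq_0[OF F dF that] by auto
  let ?P = "\<lambda>x. v x * (s * (x \<bullet> G x) - M x) * weight x"
  have tG: "tame (\<lambda>x. x \<bullet> G x)" by (rule tame_inner_fields[OF tame_inner_right regularD(3)[OF q]])
  have P: "integrable lborel ?P"
    by (rule ip_integrable[OF v tame_diff[OF tame_cmult[OF tG] regularD(2)[OF q]]])
  have S: "integrable lborel (\<lambda>x. \<Sum>b\<in>Basis. F' b x b)" using F'0 by (intro Bochner_Integration.integrable_sum) auto
  have S0: "(\<integral>x. (\<Sum>b\<in>Basis. F' b x b) \<partial>lborel) = 0"
    using F'0 by (subst Bochner_Integration.integral_sum) auto
  have eq: "(\<Sum>b\<in>Basis. F' b x b) + ?P x = (Gv x \<bullet> G x) * ?e x" if x: "x \<noteq> 0" for x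
  proof -
    have "(\<Sum>b\<in>Basis. F' b x b) = ?e x * v x * (\<Sum>b\<in>Basis. D x b b) + ?e x * (\<Sum>b\<in>Basis. (Gv x \<bullet> b) * (G x \<bullet> b))
        - s * ?e x * v x * (\<Sum>b\<in>Basis. (sgn x \<bullet> b) * (G x \<bullet> b))"
      by (simp add: F'_def sum.distrib sum_subtractf sum_negf sum_distrib_left inner_commute algebra_simps)
    also have "\<dots> = ?e x * v x * (M x / norm x) + ?e x * (Gv x \<bullet> G x) - s * ?e x * v x * ((x \<bullet> G x) / norm x)"
      unfolding euclidean_inner[symmetric] using x M[OF x] by (simp add: sgn_div_norm divide_inverse mult_ac)
    finally show ?thesis by (simp add: weight_def divide_inverse algebra_simps)
  qed
  have "integrable lborel (\<lambda>x. (\<Sum>b\<in>Basis. F' b x b) + ?P x)" using S P by (rule Bochner_Integration.integrable_add)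
  note * = integral_cong_off_0[OF this eq]
  show "integrable lborel (\<lambda>x. (Gv x \<bullet> G x) * ?e x)" using *(1) by simp
  show "(\<integral>x. (Gv x \<bullet> G x) * ?e x \<partial>lborel) = ip v (\<lambda>x. s * (x \<bullet> G x) - M x)"
    using *(2) S0 Bochner_Integration.integral_add[OF S P] by (simp add: ip_def)
qed

text \<open>Expand the nonnegative integral of \<open>(norm (Gv x - G x))\<^sup>2\<close> against
  the exponential; the cross term and the energy of \<open>q\<close> become values of
  \<open>ip\<close>. This plays the role of a Bessel inequality, so the energy of \<open>v\<close>
  never has to be expanded in eigenfunctions.\<close>

lemma energy_ge:
  fixes v :: "'a \<Rightarrow> real"
  assumes v: "tame v" and dv: "\<And>x. x \<noteq> 0 \<Longrightarrow> (v has_derivative (\<lambda>h. h \<bullet> Gv x)) (at x)"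
    and fin: "integrable lborel (\<lambda>x. (norm (Gv x))\<^sup>2 * exp (- s * norm x))"
    and q: "regular q G M"
  shows "2 * ip v (\<lambda>x. s * (x \<bullet> G x) - M x) - ip q (\<lambda>x. s * (x \<bullet> G x) - M x)
    \<le> (\<integral>x. (norm (Gv x))\<^sup>2 * exp (- s * norm x) \<partial>lborel)"
proof -
  let ?e = "\<lambda>x::'a. exp (- s * norm x)"
  note c = integration_by_parts[OF v dv q]
  note d = integration_by_parts[OF regularD(1)[OF q] regularD(4)[OF q] q]
  have "0 \<le> (\<integral>x. (norm (Gv x - G x))\<^sup>2 * ?e x \<partial>lborel)"
    by (rule integral_nonneg_AE) auto
  also have "\<dots> = (\<integral>x. ((norm (Gv x))\<^sup>2 * ?e x - 2 * ((Gv x \<bullet> G x) * ?e x)) + (G x \<bullet> G x) * ?e x \<partial>lborel)"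
    by (rule Bochner_Integration.integral_cong)
       (auto simp: power2_norm_eq_inner inner_diff_left inner_diff_right inner_commute algebra_simps)
  also have "\<dots> = (\<integral>x. (norm (Gv x))\<^sup>2 * ?e x \<partial>lborel) - 2 * (\<integral>x. (Gv x \<bullet> G x) * ?e x \<partial>lborel) + (\<integral>x. (G x \<bullet> G x) * ?e x \<partial>lborel)"
  proof -
    note i = Bochner_Integration.integrable_diff[OF fin integrable_mult_right[OF c(1), of 2]]
    show ?thesis using Bochner_Integration.integral_add[OF i d(1)]
      Bochner_Integration.integral_diff[OF fin integrable_mult_right[OF c(1), of 2]] by simp
  qed
  finally show ?thesis using c(2) d(2) by simp
qed

lemma eigenfunctions_orthogonal:
  assumes "eigenfunction s j p" "eigenfunction s k q" "j \<noteq> k"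
  shows "ip p q = 0"
proof -
  obtain G M G' M' where p: "eigen s j p G M" and q: "eigen s k q G' M'" using assms by blast
  have rp: "regular p G M" and rq: "regular q G' M'" using p q by (auto simp: eigen_def)
  have "(\<integral>x. (G x \<bullet> G' x) * exp (- s * norm x) \<partial>lborel) = ip p (\<lambda>x. s * real k * q x)"
    using integration_by_parts(2)[OF regularD(1)[OF rp] regularD(4)[OF rp] rq] q by (simp add: eigen_def)
  moreover have "(\<integral>x. (G' x \<bullet> G x) * exp (- s * norm x) \<partial>lborel) = ip q (\<lambda>x. s * real j * p x)"
    using integration_by_parts(2)[OF regularD(1)[OF rq] regularD(4)[OF rq] rp] p by (simp add: eigen_def)
  ultimately have "ip p (\<lambda>x. s * real k * q x) = ip q (\<lambda>x. s * real j * p x)" by (simp add: inner_commute)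
  then have "s * real k * ip p q = s * real j * ip q p"
    using regularD(1)[OF rp] regularD(1)[OF rq] by (simp only: ip_cmult_right)
  then show ?thesis using s assms(3) by (simp add: ip_commute)
qed

lemma ip_eigen_sum:
  assumes v: "tame v" and Q: "\<And>k. eigenfunction s k (Q k)" and A: "finite A"
  shows "ip v (\<lambda>x. \<Sum>k\<in>A. c k * Q k x) = (\<Sum>k\<in>A. c k * ip v (Q k))"
    "ip (\<lambda>x. \<Sum>k\<in>A. c k * Q k x) (\<lambda>x. \<Sum>k\<in>A. d k * Q k x) = (\<Sum>k\<in>A. c k * d k * ip (Q k) (Q k))"
proof -
  have t: "tame (Q k)" for k using eigenfunction_tame[OF Q] .
  have *: "ip v (\<lambda>x. \<Sum>k\<in>A. c k * Q k x) = (\<Sum>k\<in>A. c k * ip v (Q k))" if "tame v" for v c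
    by (rule ip_sum_right[OF that A t])
  show "ip v (\<lambda>x. \<Sum>k\<in>A. c k * Q k x) = (\<Sum>k\<in>A. c k * ip v (Q k))" by (rule *[OF v])
  have "ip (\<lambda>x. \<Sum>k\<in>A. c k * Q k x) (\<lambda>x. \<Sum>k\<in>A. d k * Q k x)
      = (\<Sum>k\<in>A. d k * ip (\<lambda>x. \<Sum>k\<in>A. c k * Q k x) (Q k))"
    by (rule *) (intro tame_sum tame_cmult t)
  also have "\<dots> = (\<Sum>k\<in>A. d k * ip (Q k) (\<lambda>x. \<Sum>k\<in>A. c k * Q k x))"
    by (intro sum.cong refl arg_cong2[where f = "(*)"] ip_commute)
  also have "\<dots> = (\<Sum>k\<in>A. d k * (\<Sum>j\<in>A. c j * ip (Q k) (Q j)))" by (simp add: * t)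
  also have "\<dots> = (\<Sum>k\<in>A. d k * (c k * ip (Q k) (Q k)))"
  proof (rule sum.cong)
    fix k assume "k \<in> A"
    have "(\<Sum>j\<in>A. c j * ip (Q k) (Q j)) = (\<Sum>j\<in>A. if j = k then c k * ip (Q k) (Q k) else 0)"
      using eigenfunctions_orthogonal[OF Q Q] by (intro sum.cong) auto
    also have "\<dots> = c k * ip (Q k) (Q k)" using \<open>k \<in> A\<close> A by simp
    finally show "d k * (\<Sum>j\<in>A. c j * ip (Q k) (Q j)) = d k * (c k * ip (Q k) (Q k))" by simp
  qed simp
  finally show "ip (\<lambda>x. \<Sum>k\<in>A. c k * Q k x) (\<lambda>x. \<Sum>k\<in>A. d k * Q k x) = (\<Sum>k\<in>A. c k * d k * ip (Q k) (Q k))"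
    by (simp add: mult_ac)
qed

text \<open>The Cauchy-Schwarz inequality at a null vector. It covers eigencomponents that vanish,
  where the Fourier coefficient would be a quotient by zero.\<close>

lemma ip_eq_0:
  assumes "tame v" "tame q" "ip q q = 0" shows "ip v q = 0"
proof (rule ccontr)
  assume n: "ip v q \<noteq> 0"
  \<comment> \<open>This multiple makes the linear term \<open>2 * t * ip v q\<close> exceed
    \<open>ip v v\<close> by one, so the squared distance from \<open>v\<close> to
    \<open>t * q\<close> would be negative.\<close>
  define t where "t = (ip v v + 1) / (2 * ip v q)"
  have "ip (\<lambda>x. v x - t * q x) (\<lambda>x. v x - t * q x) = ip v v - 2 * ip v (\<lambda>x. t * q x) + ip (\<lambda>x. t * q x) (\<lambda>x. t * q x)"
    by (intro ip_diff_self tame_cmult assms)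
  also have "ip v (\<lambda>x. t * q x) = t * ip v q"
    by (rule ip_cmult_right[OF assms(1,2)])
  also have "ip (\<lambda>x. t * q x) (\<lambda>x. t * q x) = t * ip (\<lambda>x. t * q x) q"
    by (rule ip_cmult_right[OF tame_cmult[OF assms(2)] assms(2)])
  also have "ip (\<lambda>x. t * q x) q = t * ip q q"
    using ip_cmult_right[OF assms(2,2)] by (simp add: ip_commute)
  finally have "0 \<le> ip v v - 2 * (t * ip v q)"
    using ip_nonneg[of "\<lambda>x. v x - t * q x"] assms by simp
  moreover have "2 * (t * ip v q) = ip v v + 1" using n by (simp add: t_def)
  ultimately show False by simp
qed

text \<open>
  On the span of the \<open>k\<close>-th eigenfunctions the energy is at least \<open>s k\<close> times the squared norm,
  and \<open>k \<ge> [k \<ge> 1] + [k \<ge> 2]\<close>.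
\<close>
lemma spectral_gaps:
  fixes v :: "'a \<Rightarrow> real"
  assumes v: "tame v" and dv: "\<And>x. x \<noteq> 0 \<Longrightarrow> (v has_derivative (\<lambda>h. h \<bullet> Gv x)) (at x)"
    and fin: "integrable lborel (\<lambda>x. (norm (Gv x))\<^sup>2 * exp (- s * norm x))"
    and q: "pol q" and approx: "sqdist v q \<le> \<epsilon>"
  shows "\<exists>c\<^sub>0 c d a. sqdist v (\<lambda>x. c\<^sub>0)
      + sqdist v (\<lambda>x. c + d * norm x + a \<bullet> x)
    \<le> (\<integral>x. (norm (Gv x))\<^sup>2 * exp (- s * norm x) \<partial>lborel) / s + 2 * \<epsilon>"
proof -
  obtain n Q where Q: "\<And>k. eigenfunction s k (Q k)" and qQ: "q = (\<lambda>x. \<Sum>k<n. Q k x)"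
    using pol_eigen_decomposition[OF q, of s] s by (metis less_irrefl)
  obtain G M where E: "\<And>k. eigen s k (Q k) (G k) (M k)" using Q by metis
  \<comment> \<open>Two extra indices guarantee that 0 and 1 are among the summation indices even if
    \<open>q\<close> has fewer components.\<close>
  define N where "N = n + 2"
  have tQ: "tame (Q k)" for k using eigenfunction_tame[OF Q] .
  define b where "b k = ip v (Q k)" for k
  define m where "m k = ip (Q k) (Q k)" for k
  \<comment> \<open>The Fourier coefficient. For \<open>m k = 0\<close> the quotient is 0 by
    convention, which is consistent because \<open>b k\<close> vanishes as well.\<close>
  define t where "t k = b k / m k" for k
  define \<sigma> where "\<sigma> k = t k * b k" for k
  have m: "0 \<le> m k" for k by (simp add: m_def ip_nonneg)
  have b0: "b k = 0" if "m k = 0" for k using ip_eq_0[OF v tQ] that by (simp add: b_def m_def)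
  have "t k * m k = b k" for k using b0[of k] by (simp add: t_def)
  then have tm: "t k * t k * m k = \<sigma> k" for k by (simp add: \<sigma>_def mult.assoc)
  have \<sigma>0: "0 \<le> \<sigma> k" for k using m[of k] by (simp add: tm[symmetric])
  \<comment> \<open>Completing the square: among all coefficients \<open>t k\<close> lowers the
    squared distance most, namely by \<open>\<sigma> k\<close>.\<close>
  have \<sigma>: "2 * c * b k - c * c * m k \<le> \<sigma> k" for c k
  proof (cases "m k = 0")
    case True then show ?thesis using b0 \<sigma>0 by simp
  next
    case False
    have "\<sigma> k - (2 * c * b k - c * c * m k) = m k * (t k - c)\<^sup>2"
      using False by (simp add: \<sigma>_def t_def power2_eq_square field_simps)
    also have "\<dots> \<ge> 0" using m by simp
    finally show ?thesis by simp
  qed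
  have dist: "sqdist v (\<lambda>x. \<Sum>k\<in>A. c k * Q k x)
      = ip v v - (\<Sum>k\<in>A. 2 * c k * b k - c k * c k * m k)" if "finite A" for A c
  proof -
    have "sqdist v (\<lambda>x. \<Sum>k\<in>A. c k * Q k x)
      = ip v v - 2 * ip v (\<lambda>x. \<Sum>k\<in>A. c k * Q k x) + ip (\<lambda>x. \<Sum>k\<in>A. c k * Q k x) (\<lambda>x. \<Sum>k\<in>A. c k * Q k x)"
      by (intro ip_diff_self v tame_sum tame_cmult tQ)
    then show ?thesis using ip_eigen_sum[OF v Q that, of c] ip_eigen_sum(2)[OF v Q that, of c c]
      by (simp add: b_def m_def sum_subtractf sum_distrib_left mult_ac)
  qed
  have distt: "sqdist v (\<lambda>x. \<Sum>k\<in>A. t k * Q k x)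
      = ip v v - (\<Sum>k\<in>A. \<sigma> k)" if "finite A" for A
  proof -
    have "2 * t k * b k - t k * t k * m k = \<sigma> k" for k unfolding tm by (simp add: \<sigma>_def)
    then show ?thesis using dist[OF that, of t] by simp
  qed
  \<comment> \<open>\<open>q\<close> is the combination with all coefficients equal to 1, so the
    projection onto the same eigenfunctions is at least as close to \<open>v\<close>; passing from
    \<open>n\<close> to \<open>N\<close> can only improve it.\<close>
  have "ip v v - (\<Sum>k<N. \<sigma> k) \<le> ip v v - (\<Sum>k<n. \<sigma> k)"
    using \<sigma>0 by (intro diff_left_mono sum_mono2) (auto simp: N_def)
  also have "\<dots> \<le> ip v v - (\<Sum>k<n. 2 * 1 * b k - 1 * 1 * m k)"
    by (intro diff_left_mono sum_mono) (rule \<sigma>)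
  also have "\<dots> \<le> \<epsilon>" using dist[of "{..<n}" "\<lambda>_. 1"] approx qQ by simp
  finally have tail: "ip v v - (\<Sum>k<N. \<sigma> k) \<le> \<epsilon>" .
  \<comment> \<open>The projection of \<open>v\<close> serves as comparison function in
    \<open>energy_ge\<close>; the operator multiplies its coefficients \<open>t k\<close> by
    \<open>s * real k\<close>.\<close>
  let ?W = "\<lambda>x. \<Sum>k<N. t k * Q k x" and ?GW = "\<lambda>x. \<Sum>k<N. t k *\<^sub>R G k x" and ?MW = "\<lambda>x. \<Sum>k<N. t k * M k x"
  have rW: "regular ?W ?GW ?MW" using E by (intro regular_sum regular_cmult) (auto simp: eigen_def)
  have LW: "s * (x \<bullet> ?GW x) - ?MW x = (\<Sum>k<N. (s * real k * t k) * Q k x)" for x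
  proof -
    have "s * (x \<bullet> ?GW x) - ?MW x = (\<Sum>k<N. t k * (s * (x \<bullet> G k x) - M k x))"
      by (simp add: inner_sum_right sum_distrib_left sum_subtractf algebra_simps)
    also have "\<dots> = (\<Sum>k<N. (s * real k * t k) * Q k x)"
      using E by (intro sum.cong) (auto simp: eigen_def)
    finally show ?thesis .
  qed
  have "2 * ip v (\<lambda>x. s * (x \<bullet> ?GW x) - ?MW x) - ip ?W (\<lambda>x. s * (x \<bullet> ?GW x) - ?MW x)
      \<le> (\<integral>x. (norm (Gv x))\<^sup>2 * exp (- s * norm x) \<partial>lborel)"
    by (rule energy_ge[OF v dv fin rW])
  then have "2 * ip v (\<lambda>x. \<Sum>k<N. (s * real k * t k) * Q k x) - ip ?W (\<lambda>x. \<Sum>k<N. (s * real k * t k) * Q k x)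
      \<le> (\<integral>x. (norm (Gv x))\<^sup>2 * exp (- s * norm x) \<partial>lborel)"
    unfolding LW .
  also have "2 * ip v (\<lambda>x. \<Sum>k<N. (s * real k * t k) * Q k x) - ip ?W (\<lambda>x. \<Sum>k<N. (s * real k * t k) * Q k x)
      = (\<Sum>k<N. 2 * (s * real k * t k) * b k - t k * (s * real k * t k) * m k)"
    using ip_eigen_sum(1)[OF v Q, of "{..<N}" "\<lambda>k. s * real k * t k"]
      ip_eigen_sum(2)[OF v Q, of "{..<N}" t "\<lambda>k. s * real k * t k"]
    by (simp add: b_def m_def sum_subtractf sum_distrib_left mult_ac)
  also have "\<dots> = (\<Sum>k<N. s * (real k * \<sigma> k))"
  proof (rule sum.cong)
    fix k
    have "2 * (s * real k * t k) * b k - t k * (s * real k * t k) * m k = s * real k * (2 * \<sigma> k - t k * t k * m k)"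
      by (simp add: \<sigma>_def algebra_simps)
    then show "2 * (s * real k * t k) * b k - t k * (s * real k * t k) * m k = s * (real k * \<sigma> k)" by (simp add: tm)
  qed simp
  also have "\<dots> = s * (\<Sum>k<N. real k * \<sigma> k)" by (simp add: sum_distrib_left)
  finally have energy: "(\<Sum>k<N. real k * \<sigma> k) \<le> (\<integral>x. (norm (Gv x))\<^sup>2 * exp (- s * norm x) \<partial>lborel) / s"
    using s by (simp add: field_simps)
  have split: "(\<Sum>k<N. f k) = (\<Sum>k\<in>{0,1}. f k) + (\<Sum>k\<in>{2..<N}. f k)" for f :: "nat \<Rightarrow> real"
  proof -
    have "{..<N} = {0,1} \<union> {2..<N}" by (auto simp: N_def)
    then show ?thesis by (subst sum.union_disjoint[symmetric]) auto
  qed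
  have "(\<Sum>k\<in>{2..<N}. 2 * \<sigma> k) \<le> (\<Sum>k\<in>{2..<N}. real k * \<sigma> k)"
    using \<sigma>0 by (intro sum_mono mult_right_mono) auto
  then have "\<sigma> 1 + 2 * (\<Sum>k\<in>{2..<N}. \<sigma> k) \<le> (\<Sum>k<N. real k * \<sigma> k)"
    by (subst split) (simp add: sum_distrib_left)
  moreover have "ip v v - (\<sigma> 0 + \<sigma> 1) - (\<Sum>k\<in>{2..<N}. \<sigma> k) \<le> \<epsilon>" using tail by (simp add: split)
  \<comment> \<open>The left side is twice the tail \<open>ip v v - (\<Sum>k<N. \<sigma> k)\<close>,
    plus \<open>\<sigma> 1\<close>, plus twice the sum of \<open>\<sigma> k\<close> over
    \<open>k\<close> from 2 on. The tail accounts for \<open>2 * \<epsilon>\<close>.\<close>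
  ultimately have main: "(ip v v - (\<Sum>k\<in>{0}. \<sigma> k)) + (ip v v - (\<Sum>k\<in>{0,1}. \<sigma> k))
      \<le> (\<integral>x. (norm (Gv x))\<^sup>2 * exp (- s * norm x) \<partial>lborel) / s + 2 * \<epsilon>"
    using energy by simp
  obtain c0 where c0: "Q 0 = (\<lambda>x. c0)" using E[of 0] by (auto simp: eigen_def)
  obtain c d a where c1: "Q 1 = (\<lambda>x. c + d * norm x + a \<bullet> x)" using E[of 1] unfolding eigen_def by auto
  have eq0: "(\<lambda>x::'a. v x - (\<Sum>k\<in>{0}. t k * Q k x)) = (\<lambda>x. v x - t 0 * c0)" using c0 by simp
  have eq1: "(\<lambda>x. v x - (\<Sum>k\<in>{0,1}. t k * Q k x))
      = (\<lambda>x. v x - ((t 0 * c0 + t 1 * c) + (t 1 * d) * norm x + (t 1 *\<^sub>R a) \<bullet> x))"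
    using c0 c1 by (auto simp: algebra_simps)
  show ?thesis
    by (rule exI[of _ "t 0 * c0"], rule exI[of _ "t 0 * c0 + t 1 * c"], rule exI[of _ "t 1 * d"], rule exI[of _ "t 1 *\<^sub>R a"])
       (use main distt[of "{0}"] distt[of "{0,1}"] in \<open>simp only: eq0 eq1 finite.intros simp_thms\<close>)
qed

end

subsection \<open>Density of polynomials\<close>

lemma linear_functional_inner:
  fixes g :: "'a::euclidean_space \<Rightarrow> real"
  assumes "linear g" shows "\<exists>a. \<forall>x. g x = a \<bullet> x"
proof (intro exI allI)
  show "g x = adjoint g 1 \<bullet> x" for x
    using adjoint_works[OF assms, of x 1] by (simp add: inner_commute)
qed

context coulomb begin

lemma ip_mono:
  assumes "tame f" "tame g" "\<And>x. \<bar>f x\<bar> \<le> \<bar>g x\<bar>" shows "ip f f \<le> ip g g"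
  unfolding ip_def
proof (rule integral_mono)
  show "integrable lborel (\<lambda>x. f x * f x * weight x)" "integrable lborel (\<lambda>x. g x * g x * weight x)"
    by (intro ip_integrable assms)+
  fix x
  have "f x * f x \<le> g x * g x" using assms(3)[of x] by (metis abs_le_square_iff power2_eq_square)
  then show "f x * f x * weight x \<le> g x * g x * weight x"
    by (intro mult_right_mono) (auto simp: weight_def)
qed

text \<open>The parallelogram law gives a triangle inequality for squared distances with factor 2,
  which avoids square roots.\<close>

lemma ip_triangle:
  assumes f: "tame f" and g: "tame g" and h: "tame h"
  shows "sqdist f h
    \<le> 2 * sqdist f g + 2 * sqdist g h"
proof -
  define a where "a x = f x - g x" for x
  define b where "b x = h x - g x" for x
  define b' where "b' x = (-1) * b x" for x
  have t: "tame a" "tame b" "tame b'" unfolding a_def[abs_def] b_def[abs_def] b'_def[abs_def]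
    by (intro tame_diff tame_cmult assms)+
  have "ip a b' = - ip a b" unfolding b'_def[abs_def] by (subst ip_cmult_right[OF t(1,2)]) simp
  moreover have "ip b' b' = ip b b" unfolding ip_def b'_def by simp
  ultimately have "sqdist a b' = ip a a + 2 * ip a b + ip b b"
    using ip_diff_self[OF t(1,3)] by simp
  moreover have "sqdist a b = ip a a - 2 * ip a b + ip b b" by (rule ip_diff_self[OF t(1,2)])
  moreover have "0 \<le> sqdist a b'" by (rule ip_nonneg)
  ultimately have "sqdist a b \<le> 2 * ip a a + 2 * ip b b" by linarith
  moreover have "(\<lambda>x. a x - b x) = (\<lambda>x. f x - h x)" by (auto simp: a_def b_def)
  moreover have "ip b b = sqdist g h"
    unfolding ip_def b_def by (rule Bochner_Integration.integral_cong) (auto simp: algebra_simps)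
  ultimately show ?thesis by (simp add: a_def[abs_def])
qed

definition approximable :: "('a \<Rightarrow> real) \<Rightarrow> bool" where
  "approximable f \<longleftrightarrow> tame f \<and> (\<forall>\<epsilon>>0. \<exists>q. pol q \<and> sqdist f q < \<epsilon>)"

lemma approximable_pol: "pol q \<Longrightarrow> approximable q"
  unfolding approximable_def using pol_tame[of q] by (auto simp: ip_def intro!: exI[of _ q])

lemma approximable_closure:
  assumes f: "tame f" and cl: "\<And>\<epsilon>. 0 < \<epsilon> \<Longrightarrow> \<exists>g. approximable g \<and> sqdist f g < \<epsilon>"
  shows "approximable f"
  unfolding approximable_def
proof (intro conjI f allI impI)
  fix \<epsilon> :: real assume "0 < \<epsilon>"
  then obtain g where g: "approximable g" "sqdist f g < \<epsilon> / 4"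
    using cl[of "\<epsilon> / 4"] by auto
  then obtain q where q: "pol q" "sqdist g q < \<epsilon> / 4"
    using \<open>0 < \<epsilon>\<close> unfolding approximable_def by (meson zero_less_divide_iff zero_less_numeral)
  have "sqdist f q < \<epsilon>"
    using ip_triangle[of f g q] f g q pol_tame[OF q(1)] by (simp add: approximable_def)
  then show "\<exists>q. pol q \<and> sqdist f q < \<epsilon>" using q by blast
qed

lemma approximable_add:
  assumes f: "approximable f" and g: "approximable g" shows "approximable (\<lambda>x. f x + g x)"
  unfolding approximable_def
proof (intro conjI allI impI)
  have t: "tame f" "tame g" using assms by (auto simp: approximable_def)
  show tfg: "tame (\<lambda>x. f x + g x)" by (intro tame_add t)
  fix \<epsilon> :: real assume "0 < \<epsilon>"
  then obtain p q where p: "pol p" "sqdist f p < \<epsilon> / 4"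
    and q: "pol q" "sqdist g q < \<epsilon> / 4"
    using assms unfolding approximable_def by (meson zero_less_divide_iff zero_less_numeral)
  have "ip (\<lambda>x. (f x + g x) - (p x + q x)) (\<lambda>x. (f x + g x) - (p x + q x))
    \<le> 2 * ip (\<lambda>x. (f x + g x) - (p x + g x)) (\<lambda>x. (f x + g x) - (p x + g x))
     + 2 * ip (\<lambda>x. (p x + g x) - (p x + q x)) (\<lambda>x. (p x + g x) - (p x + q x))"
    by (intro ip_triangle tame_add t pol_tame p q)
  also have "\<dots> < \<epsilon>" using p q by simp
  finally show "\<exists>q. pol q \<and> ip (\<lambda>x. (f x + g x) - q x) (\<lambda>x. (f x + g x) - q x) < \<epsilon>"
    using pol.pol_add[OF p(1) q(1)] by blast
qed

lemma exp_sums: "(\<lambda>i. y ^ i / fact i) sums exp y" for y :: real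
  using exp_converges[of y] by (simp add: divide_inverse mult.commute)

lemma exp_taylor_bound:
  fixes y :: real assumes y: "0 \<le> y"
  shows "\<bar>exp (- y) - (\<Sum>i<n. (- y) ^ i / fact i)\<bar> \<le> 2 * exp y"
proof -
  have "\<bar>\<Sum>i<n. (- y) ^ i / fact i\<bar> \<le> (\<Sum>i<n. \<bar>(- y) ^ i / fact i\<bar>)" by (rule sum_abs)
  also have "\<dots> = (\<Sum>i<n. y ^ i / fact i)" using y by (simp add: power_abs)
  also have "\<dots> \<le> (\<Sum>i. y ^ i / fact i)" using y exp_sums[of y] by (intro sum_le_suminf) (auto simp: sums_iff)
  also have "\<dots> = exp y" using exp_sums[of y] by (simp add: sums_iff)
  finally have "\<bar>\<Sum>i<n. (- y) ^ i / fact i\<bar> \<le> exp y" .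
  moreover have "exp (- y) \<le> exp y" using y by simp
  ultimately show ?thesis using exp_gt_zero[of "- y"] by linarith
qed

text \<open>The exponential is replaced by its Taylor polynomials one factor
  \<open>exp (- s / 4 * norm x)\<close> at a time. The squared remainder is at most
  \<open>4 * exp (s / 2 * norm x)\<close>, which the weight \<open>exp (- s * norm x)\<close>
  absorbs with decay to spare. This fails for large rates at once, hence the small rate
  \<open>s / 4\<close> and the induction on the number of factors.\<close>

lemma approximable_pol_exp:
  "pol q \<Longrightarrow> approximable (\<lambda>x. q x * exp (- (real k * (s / 4)) * norm x))"
proof (induction k arbitrary: q)
  case 0 then show ?case by (simp add: approximable_pol)
next
  case (Suc k)
  define E where "E x = exp (- (real k * (s / 4)) * norm x)" for x :: 'a
  define f where "f x = q x * exp (- (real (Suc k) * (s / 4)) * norm x)" for x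
  define P where "P n x = (\<Sum>i<n. (- (s / 4 * norm x)) ^ i / fact i)" for n and x :: 'a
  have tq: "tame q" using Suc.prems by (rule pol_tame)
  have tE: "tame E" unfolding E_def[abs_def] by (rule tame_exp) (use s in simp)
  have tf: "tame f" unfolding f_def[abs_def] by (intro tame_mult tq tame_exp) (use s in simp)
  have f: "f x = q x * E x * exp (- (s / 4 * norm x))" for x
    by (simp add: f_def E_def mult.assoc exp_add[symmetric]) (simp add: algebra_simps)
  have pP: "pol (P n)" for n
  proof -
    have eq: "P n = (\<lambda>x. \<Sum>i<n. ((- (s / 4)) ^ i / fact i) * norm x ^ i)"
    proof
      fix x :: 'a
      have "(- (s / 4 * norm x)) ^ i = (- (s / 4)) ^ i * norm x ^ i" for i
        by (simp only: power_mult_distrib[symmetric] mult_minus_left)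
      then show "P n x = (\<Sum>i<n. ((- (s / 4)) ^ i / fact i) * norm x ^ i)" by (simp add: P_def)
    qed
    show ?thesis
      unfolding eq by (rule pol_sum[OF finite_lessThan pol_mult[OF pol_const pol_power[OF pol_norm]]])
  qed
  define g where "g n x = q x * P n x * E x" for n x
  have ag: "approximable (g n)" for n
    unfolding g_def[abs_def] E_def by (rule Suc.IH) (intro pol_mult Suc.prems pP)
  have tg: "tame (g n)" for n using ag by (simp add: approximable_def)
  have "(\<lambda>n. \<integral>x. (f x - g n x) * (f x - g n x) * weight x \<partial>lborel) \<longlonglongrightarrow> (\<integral>x. 0 \<partial>(lborel::'a measure))"
  proof (rule integral_dominated_convergence)
    let ?w = "\<lambda>x. 4 * (exp (- (s / 2) * norm x) * ((q x * q x) * (E x * E x)) / norm x)"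
    show "integrable lborel ?w"
      by (intro integrable_mult_right decaying_integrable_over_norm decaying_mult_tame decaying_exp tame_mult tq tE)
         (use s in simp)
    show "(\<lambda>x. (f x - g n x) * (f x - g n x) * weight x) \<in> borel_measurable lborel" for n
      by (rule borel_measurable_integrable) (intro ip_integrable tame_diff tf tg)
    show "AE x in lborel. (\<lambda>n. (f x - g n x) * (f x - g n x) * weight x) \<longlonglongrightarrow> 0"
    proof (rule AE_I2)
      fix x
      let ?r = "\<lambda>n. exp (- (s / 4 * norm x)) - P n x"
      have "(\<lambda>n. P n x) \<longlonglongrightarrow> exp (- (s / 4 * norm x))"
        using exp_sums[of "- (s / 4 * norm x)"] by (simp only: P_def sums_def)
      from tendsto_diff[OF tendsto_const[of "exp (- (s / 4 * norm x))"] this] have r: "?r \<longlonglongrightarrow> 0" by (simp only: diff_self)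
      have "(\<lambda>n. (q x * q x) * (E x * E x) * weight x * (?r n * ?r n)) \<longlonglongrightarrow> (q x * q x) * (E x * E x) * weight x * (0 * 0)"
        by (rule tendsto_mult[OF tendsto_const tendsto_mult[OF r r]])
      moreover have "(f x - g n x) * (f x - g n x) * weight x = (q x * q x) * (E x * E x) * weight x * (?r n * ?r n)" for n
      proof -
        have "f x - g n x = q x * E x * ?r n" by (simp add: f g_def right_diff_distrib)
        then show ?thesis by (simp only: mult_ac)
      qed
      ultimately show "(\<lambda>n. (f x - g n x) * (f x - g n x) * weight x) \<longlonglongrightarrow> 0"
        by (simp only: mult_zero_right)
    qed
    fix n
    show "AE x in lborel. norm ((f x - g n x) * (f x - g n x) * weight x) \<le> ?w x"
    proof (rule AE_I2)
      fix x
      let ?r = "exp (- (s / 4 * norm x)) - P n x"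
      have "\<bar>?r\<bar> \<le> 2 * exp (s / 4 * norm x)" unfolding P_def using s by (intro exp_taylor_bound) simp
      then have "\<bar>?r\<bar>\<^sup>2 \<le> (2 * exp (s / 4 * norm x))\<^sup>2" by (intro power_mono) auto
      also have "\<dots> = 4 * (exp (s / 4 * norm x) * exp (s / 4 * norm x))" by (simp add: power2_eq_square)
      also have "\<dots> = 4 * exp (s / 2 * norm x)" by (simp only: exp_add[symmetric]) simp
      finally have r: "?r * ?r \<le> 4 * exp (s / 2 * norm x)" by (simp add: power2_eq_square)
      have "f x - g n x = q x * E x * ?r" by (simp add: f g_def right_diff_distrib)
      then have "(f x - g n x) * (f x - g n x) * weight x = (q x * q x) * (E x * E x) * weight x * (?r * ?r)"
        by (simp only: mult_ac)
      also have "\<dots> \<le> (q x * q x) * (E x * E x) * weight x * (4 * exp (s / 2 * norm x))"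
        using r by (rule mult_left_mono) (simp add: weight_def)
      also have "\<dots> = ?w x"
      proof -
        have "exp (s / 2 * norm x) * exp (- s * norm x) = exp (- (s / 2) * norm x)"
          by (simp add: exp_add[symmetric])
        then have "(q x * q x) * (E x * E x) * (4 * (exp (s / 2 * norm x) * exp (- s * norm x))) / norm x = ?w x"
          by (simp only: times_divide_eq_right mult_ac)
        then show ?thesis by (simp only: weight_def times_divide_eq_right times_divide_eq_left mult_ac)
      qed
      finally show "norm ((f x - g n x) * (f x - g n x) * weight x) \<le> ?w x"
        by (simp add: weight_def)
    qed
  qed simp
  then have lim: "(\<lambda>n. sqdist f (g n)) \<longlonglongrightarrow> 0" by (simp add: ip_def)
  have "approximable f"
  proof (rule approximable_closure[OF tf])
    fix \<epsilon> :: real assume "0 < \<epsilon>"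
    then obtain n where "sqdist f (g n) < \<epsilon>"
      using order_tendstoD(2)[OF lim] by (auto simp: eventually_sequentially)
    then show "\<exists>g. approximable g \<and> sqdist f g < \<epsilon>" using ag by blast
  qed
  then show ?case by (simp add: f_def[abs_def])
qed

text \<open>Sums over different \<open>k\<close> are included to obtain an algebra, as the pullback
  of polynomials in several variables requires.\<close>

inductive exp_pol :: "('a \<Rightarrow> real) \<Rightarrow> bool" where
  exp_pol_base: "pol q \<Longrightarrow> exp_pol (\<lambda>x. q x * exp (- (real k * (s / 4)) * norm x))"
| exp_pol_add: "exp_pol f \<Longrightarrow> exp_pol g \<Longrightarrow> exp_pol (\<lambda>x. f x + g x)"

lemma exp_pol_approximable: "exp_pol f \<Longrightarrow> approximable f"
proof (induction rule: exp_pol.induct)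
  case (exp_pol_base q k) then show ?case by (rule approximable_pol_exp)
next
  case (exp_pol_add f g)
  from exp_pol_add(3,4) show ?case by (rule approximable_add)
qed

lemma exp_pol_mult: "exp_pol f \<Longrightarrow> exp_pol g \<Longrightarrow> exp_pol (\<lambda>x. f x * g x)"
proof (induction rule: exp_pol.induct)
  case (exp_pol_base p j)
  from exp_pol_base(2) show ?case
  proof (induction rule: exp_pol.induct)
    case (exp_pol_base q k)
    have "exp_pol (\<lambda>x. (p x * q x) * exp (- (real (j + k) * (s / 4)) * norm x))"
      by (intro exp_pol.exp_pol_base pol_mult \<open>pol p\<close> exp_pol_base)
    also have "(\<lambda>x. (p x * q x) * exp (- (real (j + k) * (s / 4)) * norm x))
       = (\<lambda>x. p x * exp (- (real j * (s / 4)) * norm x) * (q x * exp (- (real k * (s / 4)) * norm x)))"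
    proof
      fix x :: 'a
      have "- (real (j + k) * (s / 4)) * norm x = - (real j * (s / 4)) * norm x + - (real k * (s / 4)) * norm x"
        by (simp add: algebra_simps)
      then have "exp (- (real (j + k) * (s / 4)) * norm x)
          = exp (- (real j * (s / 4)) * norm x) * exp (- (real k * (s / 4)) * norm x)" by (simp only: exp_add)
      then show "(p x * q x) * exp (- (real (j + k) * (s / 4)) * norm x)
         = p x * exp (- (real j * (s / 4)) * norm x) * (q x * exp (- (real k * (s / 4)) * norm x))"
        by (simp only: mult_ac)
    qed
    finally show ?case .
  next
    case (exp_pol_add f g)
    then show ?case
      using exp_pol.exp_pol_add[OF exp_pol_add(3,4)] by (simp only: distrib_left)
  qed
next
  case (exp_pol_add f f')
  then show ?case using exp_pol.exp_pol_add[of "\<lambda>x. f x * g x" "\<lambda>x. f' x * g x"] by (simp only: distrib_right)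
qed

text \<open>The quotient of the two components recovers \<open>x\<close>, and points at infinity
  tend to \<open>(0, 0)\<close>. Both components carry the same factor, so a linear form of them is
  an affine function times a single exponential.\<close>

definition cone_map :: "'a \<Rightarrow> 'a \<times> real" where
  "cone_map x = (exp (- (s / 4) * norm x) *\<^sub>R x, exp (- (s / 4) * norm x))"

lemma exp_pol_cone_map: "real_polynomial_function P \<Longrightarrow> exp_pol (\<lambda>x. P (cone_map x))"
proof (induction rule: real_polynomial_function.induct)
  case (linear f)
  interpret bounded_linear f by (rule linear)
  have "linear (\<lambda>x::'a. f (x, 0))"
  proof (rule linearI)
    show "f (x + y, 0) = f (x, 0) + f (y, 0)" for x y :: 'a using add[of "(x, 0)" "(y, 0)"] by simp
    show "f (r *\<^sub>R x, 0) = r *\<^sub>R f (x, 0)" for r and x :: 'a using scaleR[of r "(x, 0)"] by simp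
  qed
  from linear_functional_inner[OF this] obtain a where a: "\<forall>x::'a. f (x, 0) = a \<bullet> x" ..
  have "f (cone_map x) = (a \<bullet> x + f (0, 1)) * exp (- (real 1 * (s / 4)) * norm x)" for x
  proof -
    let ?e = "exp (- (s / 4) * norm x)"
    have "cone_map x = ?e *\<^sub>R ((x, 0) + (0, 1))" by (simp add: cone_map_def)
    then have "f (cone_map x) = ?e * (f (x, 0) + f (0, 1))" by (simp only: scaleR add real_scaleR_def)
    then show ?thesis by (simp add: a mult.commute)
  qed
  moreover have "exp_pol (\<lambda>x. (a \<bullet> x + f (0, 1)) * exp (- (real 1 * (s / 4)) * norm x))"
    by (intro exp_pol_base pol.pol_add pol_inner pol_const)
  ultimately show ?case by presburger
next
  case (const c)
  show ?case using exp_pol_base[OF pol_const[of c], of 0] by simp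
qed (auto intro: exp_pol_add exp_pol_mult)

text \<open>
  A function with bounded support factors continuously through \<open>cone_map\<close>, which maps the whole
  space into a compact set, so Stone--Weierstrass yields an approximation uniform on the whole space.
\<close>
lemma approximable_compact_support:
  fixes v :: "'a \<Rightarrow> real"
  assumes tv: "tame v" and cont: "continuous_on UNIV v" and supp: "\<And>x. R \<le> norm x \<Longrightarrow> v x = 0"
  shows "approximable v"
proof (rule approximable_closure[OF tv])
  fix \<epsilon> :: real assume \<epsilon>: "0 < \<epsilon>"
  define I where "I = ip (\<lambda>_. 1) (\<lambda>_. 1)"
  have I: "0 \<le> I" by (simp add: I_def ip_nonneg)
  \<comment> \<open>A uniform error \<open>\<delta>\<close> costs
    \<open>\<delta> * \<delta> * I\<close> in squared distance; \<open>I + 1\<close> keeps the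
    denominator positive.\<close>
  define \<delta> where "\<delta> = sqrt (\<epsilon> / (2 * (I + 1)))"
  have \<delta>: "0 < \<delta>" "\<delta> * \<delta> * I < \<epsilon>"
  proof -
    show "0 < \<delta>" using \<epsilon> I by (simp add: \<delta>_def)
    have "\<delta> * \<delta> = \<epsilon> / (2 * (I + 1))" using \<epsilon> I by (simp add: \<delta>_def)
    then have "\<delta> * \<delta> * I = \<epsilon> * (I / (2 * (I + 1)))" by simp
    also have "\<dots> < \<epsilon> * 1" using \<epsilon> I by (intro mult_strict_left_mono) (auto simp: divide_less_eq)
    finally show "\<delta> * \<delta> * I < \<epsilon>" by simp
  qed
  define t0 where "t0 = exp (- (s / 4) * R)"
  have t0: "0 < t0" by (simp add: t0_def)
  \<comment> \<open>\<open>t0\<close> is the second component on the sphere of radius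
    \<open>R\<close>. The maximum keeps the division that recovers \<open>x\<close> away from zero,
    and the last factor rises from 0 at \<open>t0 / 2\<close> to 1 at \<open>t0\<close>. In between,
    \<open>v\<close> already vanishes on the image of \<open>cone_map\<close>, so the cutoff does
    not alter \<open>v\<close>.\<close>
  define F where "F z = v (fst z /\<^sub>R max (snd z) (t0 / 2)) * max 0 (min 1 ((snd z - t0 / 2) / (t0 / 2)))" for z :: "'a \<times> real"
  have vF: "F (cone_map x) = v x" for x
  proof -
    let ?e = "exp (- (s / 4) * norm x)"
    show ?thesis
    proof (cases "norm x \<le> R")
      case True
      then have "t0 \<le> ?e" using s by (simp add: t0_def)
      then have "max ?e (t0 / 2) = ?e" "1 \<le> (?e - t0 / 2) / (t0 / 2)" using t0 by (auto simp: field_simps)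
      then show ?thesis by (simp add: F_def cone_map_def)
    next
      case False
      then have v0: "v x = 0" using supp by simp
      show ?thesis
      proof (cases "t0 / 2 \<le> ?e")
        case True
        then have "max ?e (t0 / 2) = ?e" by simp
        then show ?thesis using v0 by (simp add: F_def cone_map_def)
      next
        case False
        then have "(?e - t0 / 2) / (t0 / 2) \<le> 0" using t0 by (simp add: divide_le_0_iff)
        then show ?thesis using v0 by (simp add: F_def cone_map_def)
      qed
    qed
  qed
  have bnd: "cone_map x \<in> cball 0 (4 / s + 1)" for x
  proof -
    let ?e = "exp (- (s / 4) * norm x)"
    have "norm x \<le> 1 / (s / 4) * exp (s / 4 * norm x)" using s by (intro norm_le_exp) simp
    then have "?e * norm x \<le> ?e * (1 / (s / 4) * exp (s / 4 * norm x))" by (intro mult_left_mono) auto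
    also have "\<dots> = 4 / s" by (simp add: exp_minus field_simps)
    finally have "?e * norm x \<le> 4 / s" .
    moreover have "?e \<le> 1" using s by simp
    moreover have "norm (?e *\<^sub>R x) + norm ?e = ?e * norm x + ?e" by simp
    ultimately have "norm (?e *\<^sub>R x) + norm ?e \<le> 4 / s + 1" by linarith
    then show ?thesis using norm_Pair_le[of "?e *\<^sub>R x" ?e] by (simp add: cone_map_def)
  qed
  have "continuous_on UNIV F" unfolding F_def
    using t0 by (intro continuous_intros continuous_on_compose2[OF cont]) (auto simp: max_def)
  then have "continuous_on (cball 0 (4 / s + 1)) F" by (rule continuous_on_subset) simp
  then obtain P where P: "real_polynomial_function P" "\<And>z. z \<in> cball 0 (4 / s + 1) \<Longrightarrow> \<bar>F z - P z\<bar> < \<delta>"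
    using Stone_Weierstrass_real_polynomial_function[OF compact_cball _ \<delta>(1)] by metis
  let ?g = "\<lambda>x. P (cone_map x)"
  have g: "approximable ?g" by (intro exp_pol_approximable exp_pol_cone_map P)
  have "sqdist v ?g \<le> ip (\<lambda>_. \<delta>) (\<lambda>_. \<delta>)"
  proof (rule ip_mono)
    show "tame (\<lambda>x. v x - ?g x)" using g tv by (intro tame_diff) (auto simp: approximable_def)
    show "tame (\<lambda>_::'a. \<delta>)" by (rule tame_const)
    show "\<bar>v x - ?g x\<bar> \<le> \<bar>\<delta>\<bar>" for x using P(2)[OF bnd, of x] \<delta>(1) by (simp add: vF)
  qed
  also have "\<dots> = \<delta> * \<delta> * I" by (simp add: ip_def I_def)
  finally show "\<exists>g. approximable g \<and> sqdist v g < \<epsilon>" using g \<delta>(2) by (intro exI[of _ ?g]) simp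
qed

section \<open>Factoring out the exponential ground state\<close>

text \<open>Expanding the square leaves the cross term
  \<open>s * u x * (g x \<bullet> sgn x)\<close>, a multiple of the radial derivative of
  \<open>u\<close> squared. Integrating by parts against the radial field, whose divergence is
  \<open>DIM('a) - 1\<close> over \<open>norm x\<close>, produces the Coulomb term with the
  dimensional constant of the deficit.\<close>

lemma energy_exp_factor:
  fixes u :: "'a \<Rightarrow> real" and g :: "'a \<Rightarrow> 'a"
  defines "v \<equiv> \<lambda>x. u x * exp (s / 2 * norm x)"
    and "Gv \<equiv> \<lambda>x. exp (s / 2 * norm x) *\<^sub>R (g x + (s / 2 * u x) *\<^sub>R sgn x)"
  assumes tv: "tame v" and du: "\<And>x. (u has_derivative (\<lambda>h. h \<bullet> g x)) (at x)"
    and g: "integrable lborel (\<lambda>x. (norm (g x))\<^sup>2)"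
  shows "x \<noteq> 0 \<Longrightarrow> (v has_derivative (\<lambda>h. h \<bullet> Gv x)) (at x)"
    and "integrable lborel (\<lambda>x. (u x)\<^sup>2)" and "integrable lborel (\<lambda>x. (u x)\<^sup>2 / norm x)"
    and "integrable lborel (\<lambda>x. (norm (Gv x))\<^sup>2 * exp (- s * norm x))"
    and "(\<integral>x. (norm (Gv x))\<^sup>2 * exp (- s * norm x) \<partial>lborel)
      = (\<integral>x. (norm (g x))\<^sup>2 \<partial>lborel) + s\<^sup>2 / 4 * (\<integral>x. (u x)\<^sup>2 \<partial>lborel)
        - s / 2 * (real DIM('a) - 1) * (\<integral>x. (u x)\<^sup>2 / norm x \<partial>lborel)"
proof -
  let ?F = "\<lambda>x. 2 * u x * (g x \<bullet> sgn x) + s * (u x)\<^sup>2"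
  have dexp: "((\<lambda>x. exp (c * norm x)) has_derivative (\<lambda>h. h \<bullet> (exp (c * norm x) * c) *\<^sub>R sgn x)) (at x)"
    if "x \<noteq> 0" for x :: 'a and c
    using that by (auto intro!: derivative_eq_intros has_derivative_norm_sgn)
  show dv: "(v has_derivative (\<lambda>h. h \<bullet> Gv x)) (at x)" if x: "x \<noteq> 0" for x
    using has_derivative_mult[OF du dexp[OF x, of "s/2"]]
    by (simp add: v_def Gv_def inner_add_right algebra_simps)
  have v2: "v x * v x * exp (- s * norm x) = (u x)\<^sup>2" for x
  proof -
    have "exp (s / 2 * norm x) * exp (s / 2 * norm x) * exp (- s * norm x) = 1"
      by (simp add: exp_add[symmetric])
    then have "u x * u x * (exp (s / 2 * norm x) * exp (s / 2 * norm x) * exp (- s * norm x)) = u x * u x" by simp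
    then show ?thesis by (simp only: v_def power2_eq_square mult_ac)
  qed
  show iu: "integrable lborel (\<lambda>x. (u x)\<^sup>2)"
    using tame_integrable[OF tame_mult[OF tv tv]] by (simp only: v2)
  have "v x * v x * weight x = (u x)\<^sup>2 / norm x" for x using v2[of x] by (simp add: weight_def)
  then show iuw: "integrable lborel (\<lambda>x. (u x)\<^sup>2 / norm x)"
    using tame_integrable_weight[OF tame_mult[OF tv tv]] by simp
  \<comment> \<open>The radial field is the gradient \<open>glin 1 0\<close> of the norm, so the
    weighted integration by parts applies with \<open>v\<close> squared as the function and the norm
    as the regular partner. It also supplies the integrability of the cross term.\<close>
  define q where "q x = v x * v x" for x
  let ?H = "\<lambda>x. q x * (s * (x \<bullet> glin 1 0 x) - 1 * (real DIM('a) - 1)) * weight x"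
  define Gq where "Gq x = (2 * v x) *\<^sub>R Gv x" for x
  have tq: "tame q" unfolding q_def[abs_def] by (intro tame_mult tv)
  have dq: "(q has_derivative (\<lambda>h. h \<bullet> Gq x)) (at x)" if "x \<noteq> 0" for x
    unfolding q_def[abs_def] Gq_def using has_derivative_mult[OF dv[OF that] dv[OF that]] by (simp add: algebra_simps)
  have ss: "sgn x \<bullet> sgn x = 1" if "x \<noteq> 0" for x :: 'a using that by (simp add: dot_square_norm norm_sgn)
  have e1: "(Gq x \<bullet> glin 1 0 x) * exp (- s * norm x) = ?F x" if "x \<noteq> 0" for x
  proof -
    have ee: "exp (s / 2 * norm x) * (exp (s / 2 * norm x) * exp (- s * norm x)) = 1"
      by (simp add: exp_add[symmetric])
    have "(Gq x \<bullet> glin 1 0 x) * exp (- s * norm x)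
        = (2 * u x * (g x \<bullet> sgn x) + s * u x * u x) * (exp (s / 2 * norm x) * (exp (s / 2 * norm x) * exp (- s * norm x)))"
      using ss[OF that] by (simp add: Gq_def glin_def v_def Gv_def inner_add_left algebra_simps)
    then show ?thesis by (simp only: ee power2_eq_square) simp
  qed
  have e2: "?H x
      = s * (u x)\<^sup>2 - (real DIM('a) - 1) * ((u x)\<^sup>2 / norm x)" if "x \<noteq> 0" for x
    using v2[of x, symmetric] that by (simp add: q_def glin_def inner_sgn_self weight_def field_simps)
  note b = integration_by_parts[OF tq dq regular_lin[of 1 0]]
  have f1: "integrable lborel (\<lambda>x. (Gq x \<bullet> glin 1 0 x) * exp (- s * norm x))" by (rule b(1))
  have f2: "(\<integral>x. (Gq x \<bullet> glin 1 0 x) * exp (- s * norm x) \<partial>lborel)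
      = (\<integral>x. ?H x \<partial>lborel)"
    using b(2) by (simp add: ip_def)
  have i1: "integrable lborel ?F"
    by (rule integral_cong_off_0(1)[OF f1 e1])
  have i2: "(\<integral>x. ?F x \<partial>lborel)
     = (\<integral>x. (Gq x \<bullet> glin 1 0 x) * exp (- s * norm x) \<partial>lborel)"
    by (rule integral_cong_off_0(2)[OF f1 e1])
  have i3: "integrable lborel (\<lambda>x. s * (u x)\<^sup>2 - (real DIM('a) - 1) * ((u x)\<^sup>2 / norm x))"
    by (intro Bochner_Integration.integrable_diff integrable_mult_right iu iuw)
  have i4: "(\<integral>x. ?H x \<partial>lborel)
     = (\<integral>x. s * (u x)\<^sup>2 - (real DIM('a) - 1) * ((u x)\<^sup>2 / norm x) \<partial>lborel)"
    by (rule integral_cong_off_0(2)[OF i3]) (rule e2[symmetric])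
  have i5: "(\<integral>x. s * (u x)\<^sup>2 - (real DIM('a) - 1) * ((u x)\<^sup>2 / norm x) \<partial>lborel)
     = s * (\<integral>x. (u x)\<^sup>2 \<partial>lborel) - (real DIM('a) - 1) * (\<integral>x. (u x)\<^sup>2 / norm x \<partial>lborel)"
    using Bochner_Integration.integral_diff[OF integrable_mult_right[OF iu, of s] integrable_mult_right[OF iuw, of "real DIM('a) - 1"]]
    by (simp only: integral_mult_right_zero)
  have e3: "(norm (g x))\<^sup>2 + s / 2 * ?F x - s\<^sup>2 / 4 * (u x)\<^sup>2
      = (norm (Gv x))\<^sup>2 * exp (- s * norm x)" if "x \<noteq> 0" for x
  proof -
    have ee: "exp (s / 2 * norm x) * exp (s / 2 * norm x) * exp (- s * norm x) = 1"
      by (simp add: exp_add[symmetric])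
    have "(norm (Gv x))\<^sup>2 * exp (- s * norm x) = (norm (g x + (s / 2 * u x) *\<^sub>R sgn x))\<^sup>2 * (exp (s / 2 * norm x) * exp (s / 2 * norm x) * exp (- s * norm x))"
      by (simp only: Gv_def norm_scaleR abs_exp_cancel power_mult_distrib power2_eq_square mult_ac)
    also have "\<dots> = (g x + (s / 2 * u x) *\<^sub>R sgn x) \<bullet> (g x + (s / 2 * u x) *\<^sub>R sgn x)"
      by (simp only: ee power2_norm_eq_inner mult_1_right)
    also have "\<dots> = g x \<bullet> g x + s * u x * (g x \<bullet> sgn x) + (s / 2 * u x)\<^sup>2"
      using ss[OF that] by (simp add: inner_add_left inner_add_right inner_commute power2_eq_square)
    finally show ?thesis unfolding power2_norm_eq_inner[of "g x"] by (simp add: power2_eq_square algebra_simps)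
  qed
  have i6: "integrable lborel (\<lambda>x. (norm (g x))\<^sup>2 + s / 2 * ?F x)"
    by (intro Bochner_Integration.integrable_add integrable_mult_right g i1)
  have i7: "integrable lborel (\<lambda>x. (norm (g x))\<^sup>2 + s / 2 * ?F x - s\<^sup>2 / 4 * (u x)\<^sup>2)"
    by (intro Bochner_Integration.integrable_diff i6 integrable_mult_right iu)
  show "integrable lborel (\<lambda>x. (norm (Gv x))\<^sup>2 * exp (- s * norm x))"
    by (rule integral_cong_off_0(1)[OF i7 e3])
  have "(\<integral>x. (norm (Gv x))\<^sup>2 * exp (- s * norm x) \<partial>lborel)
     = (\<integral>x. (norm (g x))\<^sup>2 + s / 2 * ?F x - s\<^sup>2 / 4 * (u x)\<^sup>2 \<partial>lborel)"
    by (rule integral_cong_off_0(2)[OF i7 e3])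
  also have "\<dots> = (\<integral>x. (norm (g x))\<^sup>2 \<partial>lborel) + s / 2 * (\<integral>x. ?F x \<partial>lborel)
       - s\<^sup>2 / 4 * (\<integral>x. (u x)\<^sup>2 \<partial>lborel)"
    using Bochner_Integration.integral_diff[OF i6 integrable_mult_right[OF iu, of "s\<^sup>2 / 4"]]
      Bochner_Integration.integral_add[OF g integrable_mult_right[OF i1, of "s / 2"]]
    by (simp only: integral_mult_right_zero)
  also have "\<dots> = (\<integral>x. (norm (g x))\<^sup>2 \<partial>lborel) + s\<^sup>2 / 4 * (\<integral>x. (u x)\<^sup>2 \<partial>lborel)
        - s / 2 * (real DIM('a) - 1) * (\<integral>x. (u x)\<^sup>2 / norm x \<partial>lborel)"
    unfolding i2 f2 i4 i5 by (simp add: power2_eq_square[of s] field_simps)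
  finally show "(\<integral>x. (norm (Gv x))\<^sup>2 * exp (- s * norm x) \<partial>lborel)
      = (\<integral>x. (norm (g x))\<^sup>2 \<partial>lborel) + s\<^sup>2 / 4 * (\<integral>x. (u x)\<^sup>2 \<partial>lborel)
        - s / 2 * (real DIM('a) - 1) * (\<integral>x. (u x)\<^sup>2 / norm x \<partial>lborel)" .
qed

end

subsection \<open>Test functions\<close>

lemma gradient_eqI:
  assumes "GDERIV u x :> D" shows "gradient u x = D"
  unfolding gradient_def
proof (rule the_equality[where P = "gderiv u x", OF assms])
  fix D' assume "GDERIV u x :> D'"
  then have "(\<lambda>h. h \<bullet> D') = (\<lambda>h. h \<bullet> D)"
    using assms unfolding gderiv_def by (rule has_derivative_unique)
  then have "\<forall>h. h \<bullet> D' = h \<bullet> D" by (simp add: fun_eq_iff)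
  then show "D' = D" by (simp add: vector_eq_ldot)
qed

lemma C_k_1_D:
  assumes "C_k 1 u"
  shows "GDERIV u x :> gradient u x" "continuous_on UNIV (gradient u)"
proof -
  have C: "\<forall>x. \<exists>D. GDERIV u x :> D" "\<forall>i. continuous_on UNIV (\<lambda>x. gradient u x $ i)"
    using assms by (simp_all add: One_nat_def)
  then obtain D where D: "GDERIV u x :> D" by blast
  then show "GDERIV u x :> gradient u x" by (simp add: gradient_eqI)
  have "continuous_on UNIV (\<lambda>x. \<chi> i. gradient u x $ i)"
    using C(2) by (intro continuous_on_vec_lambda) simp
  then show "continuous_on UNIV (gradient u)" by (simp only: vec_lambda_eta)
qed

lemma test_function_C1:
  assumes u: "u \<in> test_functions"
  obtains R B where "\<And>x. (u has_derivative (\<lambda>h. h \<bullet> gradient u x)) (at x)" "continuous_on UNIV (gradient u)"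
    "0 < R" "\<And>x. R \<le> norm x \<Longrightarrow> u x = 0" "\<And>x. R \<le> norm x \<Longrightarrow> gradient u x = 0"
    "0 \<le> B" "\<And>x. \<bar>u x\<bar> \<le> B" "\<And>x y. \<bar>u x - u y\<bar> \<le> B * norm (x - y)"
proof -
  have "C_k 1 u" and cpt: "compact (closure {x. u x \<noteq> 0})" using u by (auto simp: test_functions_def)
  note C = C_k_1_D[OF this(1)]
  have der: "(u has_derivative (\<lambda>h. h \<bullet> gradient u x)) (at x)" for x using C(1) by (simp add: gderiv_def)
  obtain r where r: "\<And>x. x \<in> closure {x. u x \<noteq> 0} \<Longrightarrow> norm x \<le> r"
    using compact_imp_bounded[OF cpt] unfolding bounded_iff by blast
  \<comment> \<open>One more than a radius of the support: every point with
    \<open>norm x \<ge> R\<close> then has a neighbourhood on which \<open>u\<close> vanishes, so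
    the gradient vanishes there too.\<close>
  define R where "R = \<bar>r\<bar> + 1"
  have R0: "u x = 0" if "r < norm x" for x
    using r[of x] that closure_subset[of "{x. u x \<noteq> 0}"] by force
  have g0: "gradient u x = 0" if "R \<le> norm x" for x
  proof (rule gradient_eqI)
    have "GDERIV (\<lambda>x. 0) x :> 0" by (rule GDERIV_const)
    moreover have "open {x::real^'a. r < norm x}" by (intro open_Collect_less continuous_intros)
    ultimately show "GDERIV u x :> 0"
      unfolding gderiv_def using that R0
      by (elim has_derivative_transform_within_open) (auto simp: R_def)
  qed
  have "compact (gradient u ` cball 0 R)" by (intro compact_continuous_image continuous_on_subset[OF C(2)]) auto
  from compact_imp_bounded[OF this] obtain b where "\<forall>y\<in>gradient u ` cball 0 R. norm y \<le> b"
    unfolding bounded_iff by blast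
  then have b: "norm (gradient u x) \<le> b" if "norm x \<le> R" for x using that by simp
  have "continuous_on UNIV u"
    using der by (intro continuous_at_imp_continuous_on ballI has_derivative_continuous) 
  then have "compact (u ` cball 0 R)" by (intro compact_continuous_image) (auto intro: continuous_on_subset)
  from compact_imp_bounded[OF this] obtain c where "\<forall>y\<in>u ` cball 0 R. norm y \<le> c"
    unfolding bounded_iff by blast
  then have c: "\<bar>u x\<bar> \<le> c" if "norm x \<le> R" for x using that by simp
  define B where "B = \<bar>b\<bar> + \<bar>c\<bar>"
  have gB: "norm (gradient u x) \<le> B" for x using b[of x] g0[of x] by (cases "norm x \<le> R") (auto simp: B_def)
  have uB: "\<bar>u x\<bar> \<le> B" for x using c[of x] R0[of x] by (cases "norm x \<le> R") (auto simp: B_def R_def)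
  have "norm (u x - u y) \<le> B * norm (x - y)" for x y
  proof (rule differentiable_bound[of UNIV])
    show "(u has_derivative (\<lambda>h. h \<bullet> gradient u x)) (at x within UNIV)" for x using der by simp
    show "onorm (\<lambda>h. h \<bullet> gradient u x) \<le> B" for x
    proof (rule onorm_le)
      fix h
      have "norm (h \<bullet> gradient u x) \<le> norm h * norm (gradient u x)" using Cauchy_Schwarz_ineq2 by simp
      also have "\<dots> \<le> norm h * B" using gB by (intro mult_left_mono) auto
      finally show "norm (h \<bullet> gradient u x) \<le> B * norm h" by (simp add: mult.commute)
    qed
  qed auto
  then show ?thesis using der C(2) R0 g0 uB by (intro that[of R B]) (auto simp: R_def B_def)
qed

text \<open>A growing exponential is not tame. Replacing \<open>norm x\<close> by
  \<open>min (norm x) R\<close> changes nothing where \<open>u\<close> is nonzero and makes the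
  exponential bounded and Lipschitz.\<close>

lemma tame_exp_on_support:
  fixes u :: "'a::euclidean_space \<Rightarrow> real"
  assumes R: "0 < R" and supp: "\<And>x. R \<le> norm x \<Longrightarrow> u x = 0" and B: "0 \<le> B" "\<And>x. \<bar>u x\<bar> \<le> B"
    and lip: "\<And>x y. \<bar>u x - u y\<bar> \<le> B * norm (x - y)" and c: "0 \<le> c"
  shows "tame (\<lambda>x. u x * exp (c * norm x))"
proof -
  have "tame (\<lambda>x::'a. exp (c * min (norm x) R))"
  proof (rule tame_lipschitz[where B = "exp (c * R)"])
    fix x y :: 'a
    have "exp (c * min (norm x) R) \<le> exp (c * R)" using c by (simp add: mult_left_mono)
    then show "\<bar>exp (c * min (norm x) R)\<bar> \<le> exp (c * R) + exp (c * R) * norm x"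
      by (simp add: add_increasing2)
    have m: "\<bar>min (norm x) R - min (norm y) R\<bar> \<le> norm (x - y)"
      using norm_triangle_ineq3[of x y] by (auto simp: min_def)
    have m2: "\<bar>min (norm x) R - min (norm y) R\<bar> \<le> R"
    proof -
      have "0 \<le> min (norm x) R" "0 \<le> min (norm y) R" "min (norm x) R \<le> R" "min (norm y) R \<le> R"
        using R by auto
      then show ?thesis by linarith
    qed
    have eq: "\<bar>c * min (norm x) R - c * min (norm y) R\<bar> = c * \<bar>min (norm x) R - min (norm y) R\<bar>"
      using c by (simp add: abs_mult right_diff_distrib[symmetric])
    have "\<bar>exp (c * min (norm x) R) - exp (c * min (norm y) R)\<bar>
      \<le> exp (c * R) * exp (c * min (norm x) R) * \<bar>c * min (norm x) R - c * min (norm y) R\<bar>"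
      by (rule exp_diff_le) (use eq m2 c in \<open>simp add: mult_left_mono\<close>)
    also have "\<dots> \<le> exp (c * R) * exp (c * R) * (c * norm (x - y))"
      unfolding eq using m c by (intro mult_mono) (auto simp: mult_left_mono)
    finally show "\<bar>exp (c * min (norm x) R) - exp (c * min (norm y) R)\<bar> \<le> (exp (c * R) * exp (c * R) * c) * norm (x - y)"
      by (simp add: mult_ac)
  qed
  moreover have "tame u"
    by (rule tame_lipschitz[where B = B, OF _ lip]) (use B in \<open>simp add: add_increasing2\<close>)
  ultimately have "tame (\<lambda>x. u x * exp (c * min (norm x) R))" by (intro tame_mult)
  also have "(\<lambda>x. u x * exp (c * min (norm x) R)) = (\<lambda>x. u x * exp (c * norm x))"
    using supp by (auto simp: min_def)
  finally show ?thesis .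
qed

section \<open>Upper bounds for the distances and the optimal scale\<close>

lemma exp_dist_le:
  assumes "0 < l"
  shows "exp_dist u \<le> (\<integral>x. \<bar>u x - c * exp (- l * norm x)\<bar>\<^sup>2 / norm x \<partial>lborel)"
  unfolding exp_dist_def
  by (rule cInf_lower) (use assms in \<open>auto intro!: bdd_belowI[of _ 0] integral_nonneg_AE\<close>)

lemma affine_exp_dist_le:
  assumes "0 < l"
  shows "affine_exp_dist u \<le> (\<integral>x. \<bar>u x - (c + d * norm x + a \<bullet> x) * exp (- l * norm x)\<bar>\<^sup>2 / norm x \<partial>lborel)"
  unfolding affine_exp_dist_def
  by (rule cInf_lower) (use assms in \<open>auto intro!: bdd_belowI[of _ 0] integral_nonneg_AE\<close>)

lemma affine_exp_dist_nonneg: "0 \<le> affine_exp_dist u"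
  unfolding affine_exp_dist_def
  by (rule cInf_greatest) (auto intro!: integral_nonneg_AE exI[of _ "1::real"])

text \<open>The equality case of the inequality between arithmetic and geometric means:
  \<open>A / (2 * \<mu>)\<close> and \<open>\<mu> * B / 2\<close> are equal at this
  \<open>\<mu>\<close> and add up to \<open>sqrt A * sqrt B\<close>.\<close>

lemma scaled_energy_eq_deficit:
  fixes A B C \<mu> N :: real
  assumes "0 < A" "0 < B" "\<mu> = sqrt A / sqrt B"
  shows "(A + (2 * \<mu>)\<^sup>2 / 4 * B - (2 * \<mu>) / 2 * N * C) / (2 * \<mu>) = sqrt A * sqrt B - N / 2 * C"
proof -
  have ab: "A = sqrt A * sqrt A" "B = sqrt B * sqrt B" "0 < sqrt A" "0 < sqrt B" using assms by auto
  define a b where "a = sqrt A" and "b = sqrt B"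
  have eqs: "A = a * a" "B = b * b" "\<mu> = a / b" and pos: "0 < a" "0 < b"
    using ab assms by (auto simp: a_def b_def)
  show ?thesis unfolding a_def[symmetric] b_def[symmetric] eqs
    using pos by (simp add: field_simps power2_eq_square)
qed

theorem deficit_ge_dists:
  fixes u :: "real^'n \<Rightarrow> real"
  assumes dim: "2 \<le> CARD('n)" and u: "u \<in> test_functions"
  shows "exp_dist u + affine_exp_dist u \<le> deficit u (gradient u)"
proof -
  obtain R L where du: "\<And>x. (u has_derivative (\<lambda>h. h \<bullet> gradient u x)) (at x)"
    and cg: "continuous_on UNIV (gradient u)"
    and R: "0 < R" "\<And>x. R \<le> norm x \<Longrightarrow> u x = 0" "\<And>x. R \<le> norm x \<Longrightarrow> gradient u x = 0"
    and L: "0 \<le> L" "\<And>x. \<bar>u x\<bar> \<le> L" "\<And>x y. \<bar>u x - u y\<bar> \<le> L * norm (x - y)"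
    by (rule test_function_C1[OF u]) (rule that)
  define A where "A = (\<integral>x. (norm (gradient u x))\<^sup>2 \<partial>lborel)"
  define B where "B = (\<integral>x. (u x)\<^sup>2 \<partial>lborel)"
  define C where "C = (\<integral>x. (u x)\<^sup>2 / norm x \<partial>lborel)"
  define N where "N = real CARD('n) - 1"
  have N: "0 < N" using dim by (simp add: N_def)
  have ABC: "0 \<le> A" "0 \<le> B" "0 \<le> C" unfolding A_def B_def C_def by (auto intro!: integral_nonneg_AE)
  have deficit: "deficit u (gradient u) = sqrt A * sqrt B - N / 2 * C"
    by (simp add: deficit_def A_def B_def C_def N_def)
  have ig: "integrable lborel (\<lambda>x. (norm (gradient u x))\<^sup>2)"
  proof -
    have "continuous_on (cball 0 R) (\<lambda>x. (norm (gradient u x))\<^sup>2)"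
      by (intro continuous_intros continuous_on_subset[OF cg]) auto
    from borel_integrable_compact[OF compact_cball this]
    have "integrable lborel (\<lambda>x. indicator (cball 0 R) x *\<^sub>R (norm (gradient u x))\<^sup>2)" by simp
    also have "(\<lambda>x. indicator (cball 0 R) x *\<^sub>R (norm (gradient u x))\<^sup>2) = (\<lambda>x. (norm (gradient u x))\<^sup>2)"
      using R(3) by (auto simp: indicator_def fun_eq_iff)
    finally show ?thesis .
  qed
  have coulomb: "coulomb TYPE(real^'n) (2 * \<mu>)" if "0 < \<mu>" for \<mu>
    by unfold_locales (use dim that in auto)
  \<comment> \<open>The unreduced \<open>2 * \<mu> / 2\<close> is the \<open>s / 2\<close> of the
    general setting at \<open>s = 2 * \<mu>\<close>.\<close>
  have tv: "tame (\<lambda>x. u x * exp (2 * \<mu> / 2 * norm x))" if "0 < \<mu>" for \<mu>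
    using that by (intro tame_exp_on_support[OF R(1,2) L]) auto
  define Gv where "Gv \<mu> x = exp (2 * \<mu> / 2 * norm x) *\<^sub>R (gradient u x + (2 * \<mu> / 2 * u x) *\<^sub>R sgn x)" for \<mu> x
  have en1: "((\<lambda>x. u x * exp (2 * \<mu> / 2 * norm x)) has_derivative (\<lambda>h. h \<bullet> Gv \<mu> x)) (at x)"
    if "0 < \<mu>" "x \<noteq> 0" for \<mu> x
    unfolding Gv_def by (rule coulomb.energy_exp_factor(1)[OF coulomb[OF that(1)] tv[OF that(1)] du ig that(2)])
  have en2: "integrable lborel (\<lambda>x. (u x)\<^sup>2)"
    by (rule coulomb.energy_exp_factor(2)[OF coulomb[OF zero_less_one] tv[OF zero_less_one] du ig])
  have en4: "integrable lborel (\<lambda>x. (norm (Gv \<mu> x))\<^sup>2 * exp (- (2 * \<mu>) * norm x))" if "0 < \<mu>" for \<mu>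
    unfolding Gv_def by (rule coulomb.energy_exp_factor(4)[OF coulomb[OF that] tv[OF that] du ig])
  have E: "(\<integral>x. (norm (Gv \<mu> x))\<^sup>2 * exp (- (2 * \<mu>) * norm x) \<partial>lborel) = A + (2 * \<mu>)\<^sup>2 / 4 * B - (2 * \<mu>) / 2 * N * C"
    if "0 < \<mu>" for \<mu>
    using coulomb.energy_exp_factor(5)[OF coulomb[OF that] tv[OF that] du ig]
    unfolding Gv_def A_def B_def C_def N_def by (simp only: DIM_cart DIM_real mult_1_right)
  show ?thesis
  proof (cases "A = 0 \<or> B = 0")
    case True
    have "C = 0"
    proof (cases "B = 0")
      case True
      then have "AE x in lborel. (u x)\<^sup>2 = 0"
        unfolding B_def by (subst (asm) integral_nonneg_eq_0_iff_AE) (use en2 in auto)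
      then have "AE x in lborel. (u x)\<^sup>2 / norm x = 0" by (rule AE_mp) simp
      then show ?thesis unfolding C_def by (rule integral_eq_zero_AE)
    next
      case False
      then have "A = 0" using True by simp
      have "C \<le> 0 + e" if "0 < e" for e
      proof -
        \<comment> \<open>For \<open>A = 0\<close> the energy is
          \<open>\<mu> * (\<mu> * B - N * C)\<close> and is nonnegative at every positive rate, so
          \<open>C\<close> is bounded by \<open>\<mu> * B / N\<close>. The rate is chosen to make
          this bound equal to \<open>e\<close>.\<close>
        define \<mu> where "\<mu> = N * e / B"
        have B: "0 < B" using False ABC by simp
        have \<mu>: "0 < \<mu>" using N B that by (simp add: \<mu>_def)
        have "0 \<le> (\<integral>x. (norm (Gv \<mu> x))\<^sup>2 * exp (- (2 * \<mu>) * norm x) \<partial>lborel)" by (intro integral_nonneg_AE) auto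
        then have "0 \<le> \<mu> * (\<mu> * B - N * C)" unfolding E[OF \<mu>] \<open>A = 0\<close> by (simp add: power2_eq_square algebra_simps)
        then have "N * C \<le> \<mu> * B" using \<mu> by (simp add: zero_le_mult_iff)
        also have "\<dots> = N * e" using B by (simp add: \<mu>_def)
        finally show ?thesis using N by simp
      qed
      then have "C \<le> 0" by (rule field_le_epsilon)
      then show ?thesis using ABC by simp
    qed
    moreover have "exp_dist u \<le> C" using exp_dist_le[of 1 u 0] by (simp add: C_def)
    moreover have "affine_exp_dist u \<le> C" using affine_exp_dist_le[of 1 u 0 0 0] by (simp add: C_def)
    moreover have "0 \<le> sqrt A * sqrt B" using ABC by simp
    ultimately show ?thesis unfolding deficit by simp
  next
    case False
    then have pos: "0 < A" "0 < B" using ABC by auto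
    define \<mu> where "\<mu> = sqrt A / sqrt B"
    have \<mu>: "0 < \<mu>" using pos by (simp add: \<mu>_def)
    interpret coulomb "TYPE(real^'n)" "2 * \<mu>" by (rule coulomb[OF \<mu>])
    define v where "v x = u x * exp (2 * \<mu> / 2 * norm x)" for x
    have D: "(\<integral>x. (norm (Gv \<mu> x))\<^sup>2 * exp (- (2 * \<mu>) * norm x) \<partial>lborel) / (2 * \<mu>) = deficit u (gradient u)"
      unfolding E[OF \<mu>] deficit by (rule scaled_energy_eq_deficit[OF pos \<mu>_def])
    have tv': "tame v" unfolding v_def[abs_def] by (rule tv[OF \<mu>])
    have dv: "(v has_derivative (\<lambda>h. h \<bullet> Gv \<mu> x)) (at x)" if "x \<noteq> 0" for x
      unfolding v_def[abs_def] by (rule en1[OF \<mu> that])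
    have fin: "integrable lborel (\<lambda>x. (norm (Gv \<mu> x))\<^sup>2 * exp (- (2 * \<mu>) * norm x))"
      by (rule en4[OF \<mu>])
    have "continuous_on UNIV u"
      using du by (intro continuous_at_imp_continuous_on ballI has_derivative_continuous)
    then have cv: "continuous_on UNIV v" unfolding v_def[abs_def] by (intro continuous_intros)
    have app: "approximable v"
      by (rule approximable_compact_support[OF tv' cv, of R]) (simp add: v_def R(2))
    \<comment> \<open>At \<open>s = 2 * \<mu>\<close> the weight is the square of
      \<open>exp (- \<mu> * norm x)\<close> over \<open>norm x\<close>. Hence approximating
      \<open>v\<close> by \<open>p\<close> is approximating \<open>u\<close> by the profile with
      prefactor \<open>p\<close>.\<close>
    have dist: "sqdist v p = (\<integral>x. \<bar>u x - p x * exp (- \<mu> * norm x)\<bar>\<^sup>2 / norm x \<partial>lborel)" for p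
      unfolding ip_def
    proof (rule Bochner_Integration.integral_cong)
      fix x :: "real^'n"
      have e: "exp (- (2 * \<mu>) * norm x) = exp (- \<mu> * norm x) * exp (- \<mu> * norm x)"
        by (simp add: exp_add[symmetric])
      have "v x * exp (- \<mu> * norm x) = u x" by (simp add: v_def mult.assoc exp_add[symmetric])
      then have "u x - p x * exp (- \<mu> * norm x) = (v x - p x) * exp (- \<mu> * norm x)" by (simp add: left_diff_distrib)
      then have "\<bar>u x - p x * exp (- \<mu> * norm x)\<bar>\<^sup>2 = ((v x - p x) * exp (- \<mu> * norm x))\<^sup>2"
        by (simp only: power2_abs)
      also have "\<dots> = (v x - p x) * (v x - p x) * exp (- (2 * \<mu>) * norm x)"
        unfolding e power2_eq_square by (simp only: mult_ac)
      finally show "(v x - p x) * (v x - p x) * weight x = \<bar>u x - p x * exp (- \<mu> * norm x)\<bar>\<^sup>2 / norm x"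
        by (simp only: weight_def times_divide_eq_right)
    qed simp
    show ?thesis
    proof (rule field_le_epsilon)
      fix e :: real assume "0 < e"
      then have "0 < e / 2" by simp
      with app obtain q where q: "pol q" "sqdist v q < e / 2"
        unfolding approximable_def by blast
      from spectral_gaps[OF tv' dv fin q(1) less_imp_le[OF q(2)]]
      obtain c0 c d a where "sqdist v (\<lambda>x. c0)
        + sqdist v (\<lambda>x. c + d * norm x + a \<bullet> x)
        \<le> deficit u (gradient u) + e" unfolding D by auto
      then show "exp_dist u + affine_exp_dist u \<le> deficit u (gradient u) + e"
        unfolding dist using exp_dist_le[OF \<mu>, of u c0] affine_exp_dist_le[OF \<mu>, of u c d a] by linarith
    qed
  qed
qed

subsection \<open>Smooth functions\<close>

lemma GDERIV_inner_self: "GDERIV (\<lambda>x. x \<bullet> x) x :> 2 *\<^sub>R x"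
  unfolding gderiv_def by (auto intro!: derivative_eq_intros simp: inner_commute)

lemma GDERIV_nth: "GDERIV (\<lambda>x::real^'n. x $ i) x :> axis i 1"
  unfolding gderiv_def by (simp add: inner_axis bounded_linear_imp_has_derivative[OF bounded_linear_vec_nth])

lemma C_k_SucI:
  assumes "\<And>x. GDERIV u x :> D x" "\<And>i. C_k k (\<lambda>x. D x $ i)"
  shows "C_k (Suc k) u"
proof -
  have "gradient u x = D x" for x by (rule gradient_eqI[OF assms(1)])
  then show ?thesis using assms by auto
qed

lemma C_k_SucD:
  assumes "C_k (Suc k) u"
  shows "GDERIV u x :> gradient u x" "C_k k (\<lambda>x. gradient u x $ i)"
proof -
  obtain D where "GDERIV u x :> D" using assms by auto
  then show "GDERIV u x :> gradient u x" by (simp add: gradient_eqI)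
  show "C_k k (\<lambda>x. gradient u x $ i)" using assms by simp
qed

lemma GDERIV_continuous: "(\<And>x. GDERIV u x :> D x) \<Longrightarrow> continuous_on UNIV u"
  unfolding gderiv_def by (intro continuous_at_imp_continuous_on ballI has_derivative_continuous)

lemma C_k_Suc_imp: "C_k (Suc k) u \<Longrightarrow> C_k k u"
proof (induction k arbitrary: u)
  case 0
  show ?case using GDERIV_continuous[OF C_k_SucD(1)[OF 0]] by simp
next
  case (Suc k)
  show ?case
    by (rule C_k_SucI[OF C_k_SucD(1)[OF Suc.prems]]) (rule Suc.IH[OF C_k_SucD(2)[OF Suc.prems]])
qed

lemma C_k_const: "C_k k (\<lambda>x. c)"
proof (induction k arbitrary: c)
  case (Suc k)
  show ?case by (rule C_k_SucI[OF GDERIV_const]) (simp add: Suc)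
qed simp

lemma C_k_nth: "C_k k (\<lambda>x. x $ i)"
proof (cases k)
  case 0 then show ?thesis by (simp add: continuous_intros)
next
  case (Suc k)
  show ?thesis unfolding Suc by (rule C_k_SucI[OF GDERIV_nth]) (rule C_k_const)
qed

lemma C_k_add: "C_k k u \<Longrightarrow> C_k k v \<Longrightarrow> C_k k (\<lambda>x. u x + v x)"
proof (induction k arbitrary: u v)
  case 0 then show ?case by (simp add: continuous_intros)
next
  case (Suc k)
  show ?case
    by (rule C_k_SucI[OF GDERIV_add[OF C_k_SucD(1)[OF Suc.prems(1)] C_k_SucD(1)[OF Suc.prems(2)]]])
       (simp only: vector_add_component Suc.IH[OF C_k_SucD(2)[OF Suc.prems(1)] C_k_SucD(2)[OF Suc.prems(2)]])
qed

lemma C_k_mult: "C_k k u \<Longrightarrow> C_k k v \<Longrightarrow> C_k k (\<lambda>x. u x * v x)"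
proof (induction k arbitrary: u v)
  case 0 then show ?case by (simp add: continuous_intros)
next
  case (Suc k)
  show ?case
  proof (rule C_k_SucI[OF GDERIV_mult[OF C_k_SucD(1)[OF Suc.prems(1)] C_k_SucD(1)[OF Suc.prems(2)]]])
    fix i
    have "C_k k (\<lambda>x. u x * gradient v x $ i + v x * gradient u x $ i)"
      by (rule C_k_add[OF Suc.IH[OF C_k_Suc_imp[OF Suc.prems(1)] C_k_SucD(2)[OF Suc.prems(2)]]
            Suc.IH[OF C_k_Suc_imp[OF Suc.prems(2)] C_k_SucD(2)[OF Suc.prems(1)]]])
    then show "C_k k (\<lambda>x. (u x *\<^sub>R gradient v x + v x *\<^sub>R gradient u x) $ i)" by simp
  qed
qed

lemma C_k_inner_self: "C_k k (\<lambda>x. x \<bullet> x)"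
proof (cases k)
  case 0 then show ?thesis by (simp add: continuous_intros)
next
  case (Suc k)
  show ?thesis unfolding Suc
  proof (rule C_k_SucI[OF GDERIV_inner_self])
    show "C_k k (\<lambda>x::real^'a. (2 *\<^sub>R x) $ i)" for i
      using C_k_mult[OF C_k_const[of k 2] C_k_nth] by simp
  qed
qed

text \<open>\<open>h\<close> is a whole sequence of successive derivatives, so the chain rule stays
  within the family and the induction runs over all \<open>j\<close>. Differentiability is asked
  only at values of \<open>u\<close>, which admits functions such as the square root on positive
  values.\<close>

lemma C_k_compose:
  assumes h: "\<And>j x. (h j has_real_derivative h (Suc j) (u x)) (at (u x))"
  shows "C_k k u \<Longrightarrow> C_k k (\<lambda>x. h j (u x))"
proof (induction k arbitrary: j)
  case 0
  have "continuous_on UNIV (\<lambda>x. h j (u x))"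
  proof (intro continuous_at_imp_continuous_on ballI)
    fix x
    have "isCont u x" using 0 by (simp add: continuous_on_eq_continuous_at)
    then show "isCont (\<lambda>x. h j (u x)) x" using DERIV_isCont[OF h] by (rule isCont_o2)
  qed
  then show ?case by simp
next
  case (Suc k)
  show ?case
  proof (rule C_k_SucI[OF GDERIV_DERIV_compose[OF C_k_SucD(1)[OF Suc.prems] h]])
    fix i
    have "C_k k (\<lambda>x. h (Suc j) (u x) * gradient u x $ i)"
      by (rule C_k_mult[OF Suc.IH[OF C_k_Suc_imp[OF Suc.prems]] C_k_SucD(2)[OF Suc.prems]])
    then show "C_k k (\<lambda>x. (h (Suc j) (u x) *\<^sub>R gradient u x) $ i)" by simp
  qed
qed

lemma C_k_sqrt:
  assumes u: "C_k k u" and pos: "\<And>x. 0 < u x"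
  shows "C_k k (\<lambda>x. sqrt (u x))"
proof -
  define h where "h j t = (\<Prod>i<j. 1 / 2 - real i) * t powr (1 / 2 - real j)" for j and t :: real
  have "(h j has_real_derivative h (Suc j) (u x)) (at (u x))" for j x
    unfolding h_def by (rule derivative_eq_intros refl pos)+ (simp add: diff_diff_eq add.commute)
  from C_k_compose[of h, OF this u, of 0] show ?thesis
    using pos by (simp add: h_def powr_half_sqrt less_imp_le)
qed

lemma C_k_exp_minus:
  assumes u: "C_k k u" shows "C_k k (\<lambda>x. exp (- u x))"
proof -
  define h where "h j t = (- 1) ^ j * exp (- t)" for j :: nat and t :: real
  have "(h j has_real_derivative h (Suc j) t) (at t)" for j t
    unfolding h_def by (auto intro!: derivative_eq_intros)
  from C_k_compose[of h, OF this u, of 0] show ?thesis by (simp add: h_def)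
qed

section \<open>Smooth cutoffs from exp (- 1 / t)\<close>

text \<open>The polynomial parameter closes the classical flat function under differentiation: for
  positive \<open>t\<close> the derivative has the same form, with \<open>p\<close> replaced by
  \<open>X^2 * (p - p')\<close> in the variable \<open>X = 1 / t\<close>.\<close>

definition flat :: "real poly \<Rightarrow> real \<Rightarrow> real" where
  "flat p t = (if 0 < t then poly p (1 / t) * exp (- (1 / t)) else 0)"

lemma poly_exp_tendsto_0: "((\<lambda>y::real. poly p y * exp (- y)) \<longlongrightarrow> 0) at_top"
proof -
  have "((\<lambda>y. \<Sum>i\<le>degree p. coeff p i * (y ^ i / exp y)) \<longlongrightarrow> (\<Sum>i\<le>degree p. coeff p i * 0)) at_top"
    by (intro tendsto_sum tendsto_mult tendsto_const tendsto_power_div_exp_0)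
  moreover have "(\<Sum>i\<le>degree p. coeff p i * (y ^ i / exp y)) = poly p y * exp (- y)" for y
    by (simp add: poly_altdef sum_distrib_right exp_minus divide_inverse mult.assoc)
  ultimately show ?thesis by simp
qed

lemma flat_has_derivative:
  "(flat p has_real_derivative flat ([:0, 0, 1:] * (p - pderiv p)) t) (at t)"
proof -
  consider "t < 0" | "t = 0" | "0 < t" by linarith
  then show ?thesis
  proof cases
    case 1
    have "((\<lambda>_. 0) has_real_derivative 0) (at t)" by simp
    then have "(flat p has_real_derivative 0) (at t)"
      by (rule has_field_derivative_transform_within_open[where S = "{..<0}"]) (use 1 in \<open>auto simp: flat_def\<close>)
    then show ?thesis using 1 by (simp add: flat_def)
  next
    case 3
    have "((\<lambda>t. poly p (1 / t) * exp (- (1 / t))) has_real_derivative flat ([:0, 0, 1:] * (p - pderiv p)) t) (at t)"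
      using 3 by (auto intro!: derivative_eq_intros DERIV_chain2[OF poly_DERIV] simp: flat_def field_simps power2_eq_square)
    then show ?thesis
      by (rule has_field_derivative_transform_within_open[where S = "{0<..}"]) (use 3 in \<open>auto simp: flat_def\<close>)
  next
    case 2
    have "((\<lambda>h. flat p h / h) \<longlongrightarrow> 0) (at 0)"
    proof (rule filterlim_split_at)
      show "((\<lambda>h. flat p h / h) \<longlongrightarrow> 0) (at_left 0)"
        by (rule tendsto_eventually) (auto simp: eventually_at_filter flat_def)
      \<comment> \<open>\<open>pCons 0 p\<close> is \<open>p\<close> times its variable; the extra
        factor \<open>inverse h\<close> is the denominator of the difference quotient.\<close>
      have "((\<lambda>h. poly (pCons 0 p) (inverse h) * exp (- inverse h)) \<longlongrightarrow> 0) (at_right 0)"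
        by (rule filterlim_compose[OF poly_exp_tendsto_0 filterlim_inverse_at_top_right])
      then show "((\<lambda>h. flat p h / h) \<longlongrightarrow> 0) (at_right 0)"
        by (rule Lim_transform_eventually) (auto simp: eventually_at_filter flat_def divide_inverse)
    qed
    then show ?thesis using 2 by (simp add: DERIV_def flat_def)
  qed
qed

lemma C_k_flat:
  assumes u: "C_k k u" shows "C_k k (\<lambda>x. flat p (u x))"
proof -
  define q where "q j = ((\<lambda>p. [:0, 0, 1:] * (p - pderiv p)) ^^ j) p" for j
  have "(flat (q j) has_real_derivative flat (q (Suc j)) t) (at t)" for j t
    using flat_has_derivative[of "q j"] by (simp add: q_def)
  from C_k_compose[of "\<lambda>j. flat (q j)", OF this u, of 0] show ?thesis by (simp add: q_def)
qed

subsection \<open>The extremal function\<close>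

lemma integral_lborel_uminus:
  fixes f :: "'a::euclidean_space \<Rightarrow> real"
  assumes "f \<in> borel_measurable borel"
  shows "(\<integral>x. f (- x) \<partial>lborel) = (\<integral>x. f x \<partial>lborel)"
proof -
  have "lborel = density (distr lborel borel (\<lambda>x::'a. 0 + (- 1) *\<^sub>R x)) (\<lambda>_. ennreal (\<bar>- 1\<bar> ^ DIM('a)))"
    by (rule lborel_affine) simp
  then have d: "lborel = distr lborel borel (\<lambda>x::'a. - x)" by (simp add: density_1)
  have "(\<integral>x. f x \<partial>lborel) = (\<integral>x. f x \<partial>distr lborel borel (\<lambda>x::'a. - x))" using d by simp
  also have "\<dots> = (\<integral>x. f (- x) \<partial>lborel)" by (rule integral_distr) (use assms in auto)
  finally show ?thesis by simp
qed

text \<open>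
  For odd \<open>u\<close> the profiles \<open>c exp (- l |x|)\<close> and \<open>- c exp (- l |x|)\<close> are equally far from \<open>u\<close>, so by
  the parallelogram law neither is closer than zero.
\<close>
lemma exp_dist_odd:
  fixes u :: "real^'n \<Rightarrow> real"
  assumes dim: "2 \<le> CARD('n)" and u[measurable]: "u \<in> borel_measurable borel"
    and odd: "\<And>x. u (- x) = - u x" and int: "integrable lborel (\<lambda>x. \<bar>u x\<bar>\<^sup>2 / norm x)"
  shows "exp_dist u = (\<integral>x. \<bar>u x\<bar>\<^sup>2 / norm x \<partial>lborel)"
proof (rule antisym)
  show "exp_dist u \<le> (\<integral>x. \<bar>u x\<bar>\<^sup>2 / norm x \<partial>lborel)" using exp_dist_le[of 1 u 0] by simp
  interpret dim_ge2 "TYPE(real^'n)" by unfold_locales (use dim in simp)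
  have lower: "(\<integral>x. \<bar>u x\<bar>\<^sup>2 / norm x \<partial>lborel) \<le> (\<integral>x. \<bar>u x - c * exp (- l * norm x)\<bar>\<^sup>2 / norm x \<partial>lborel)"
    if l: "0 < l" for c l
  proof -
    let ?E = "\<lambda>x. c * exp (- l * norm x)"
    let ?d = "\<lambda>x. 2 * (\<bar>u x\<bar>\<^sup>2 / norm x) + 2 * c\<^sup>2 * ((exp (- l * norm x) * exp (- l * norm x)) / norm x)"
    let ?m = "\<lambda>x. \<bar>u x - ?E x\<bar>\<^sup>2 / norm x" and ?p = "\<lambda>x. \<bar>u x + ?E x\<bar>\<^sup>2 / norm x"
    have "integrable lborel (\<lambda>x::real^'n. (exp (- l * norm x) * exp (- l * norm x)) / norm x)"
      by (rule decaying_integrable_over_norm[OF decaying_mult_tame[OF decaying_exp[OF l] tame_exp]]) (use l in simp)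
    from integrable_mult_right[OF this, of "2 * c\<^sup>2"]
    have iE: "integrable lborel (\<lambda>x::real^'n. 2 * c\<^sup>2 * ((exp (- l * norm x) * exp (- l * norm x)) / norm x))" .
    have id: "integrable lborel ?d"
      by (rule Bochner_Integration.integrable_add[OF integrable_mult_right[OF int] iE])
    have par: "?m x + ?p x = ?d x" for x
      by (simp add: power2_eq_square algebra_simps add_divide_distrib diff_divide_distrib)
    have nn: "0 \<le> ?m x" "0 \<le> ?p x" for x by auto
    have im: "integrable lborel ?m"
    proof (rule Bochner_Integration.integrable_bound[OF id])
      show "AE x in lborel. norm (?m x) \<le> norm (?d x)"
        unfolding par[symmetric] using nn by (intro AE_I2) (simp only: real_norm_def abs_of_nonneg add_nonneg_nonneg le_add_same_cancel1)
    qed measurable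
    have ip: "integrable lborel ?p"
    proof (rule Bochner_Integration.integrable_bound[OF id])
      show "AE x in lborel. norm (?p x) \<le> norm (?d x)"
        unfolding par[symmetric] using nn by (intro AE_I2) (simp only: real_norm_def abs_of_nonneg add_nonneg_nonneg le_add_same_cancel2)
    qed measurable
    have mp: "?m (- x) = ?p x" for x
    proof -
      have "u (- x) - c * exp (- l * norm (- x)) = - (u x + ?E x)" by (simp add: odd)
      then show ?thesis by (simp only: abs_minus_cancel norm_minus_cancel)
    qed
    have "?m \<in> borel_measurable borel" by measurable
    then have eq: "(\<integral>x. ?p x \<partial>lborel) = (\<integral>x. ?m x \<partial>lborel)"
      using integral_lborel_uminus[of ?m] by (simp only: mp)
    have "2 * (\<integral>x. \<bar>u x\<bar>\<^sup>2 / norm x \<partial>lborel) = (\<integral>x. 2 * (\<bar>u x\<bar>\<^sup>2 / norm x) \<partial>lborel)"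
      by (rule integral_mult_right_zero[symmetric])
    also have "\<dots> \<le> (\<integral>x. ?m x + ?p x \<partial>lborel)"
    proof (rule integral_mono[OF integrable_mult_right[OF int] Bochner_Integration.integrable_add[OF im ip]])
      show "2 * (\<bar>u x\<bar>\<^sup>2 / norm x) \<le> ?m x + ?p x" for x unfolding par by simp
    qed
    also have "\<dots> = 2 * (\<integral>x. ?m x \<partial>lborel)" using Bochner_Integration.integral_add[OF im ip] eq by simp
    finally show ?thesis by simp
  qed
  show "(\<integral>x. \<bar>u x\<bar>\<^sup>2 / norm x \<partial>lborel) \<le> exp_dist u"
    unfolding exp_dist_def by (rule cInf_greatest) (use lower in \<open>auto intro: exI[of _ "1::real"]\<close>)
qed

text \<open>The exponential rate is normalised to 1. This is consistent with the optimal scale,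
  because the squared norms of this function and of its gradient turn out to be equal.\<close>

definition extremal :: "'a::euclidean_space \<Rightarrow> 'a \<Rightarrow> real" where
  "extremal b x = (x \<bullet> b) * exp (- norm x)"

definition extremal_grad :: "'a::euclidean_space \<Rightarrow> 'a \<Rightarrow> 'a" where
  "extremal_grad b x = exp (- norm x) *\<^sub>R (b - (x \<bullet> b) *\<^sub>R sgn x)"

lemma exp_minus_norm_square: "exp (- norm x) * exp (- norm x) = exp (- 2 * norm x)"
  by (simp add: exp_add[symmetric])

text \<open>By symmetry of the operator, its image is orthogonal to constants, which it annihilates.
  Each choice of \<open>q\<close> gives a linear relation between moments of the weight.\<close>

lemma (in coulomb) moment_identity:
  assumes "regular q G M" shows "ip (\<lambda>_. 1) (\<lambda>x. s * (x \<bullet> G x) - M x) = 0"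
  using integration_by_parts(2)[of "\<lambda>_. 1" "\<lambda>_. 0", OF tame_const _ assms] by simp

context dim_ge2 begin

text \<open>No polar coordinates are needed: with \<open>p x = (x \<bullet> b)\<^sup>2\<close>, the
  moment identity for \<open>p\<close>, for \<open>norm x\<close> squared and for
  \<open>norm x * p x\<close> expresses all required integrals through the single moment
  \<open>m\<close>.\<close>

lemma extremal_integrals:
  fixes b :: 'a
  assumes b: "b \<in> Basis"
  defines "m \<equiv> \<integral>x. exp (- 2 * norm x) \<partial>(lborel :: 'a measure)"
  shows "0 < m"
    and "integrable lborel (\<lambda>x. \<bar>extremal b x\<bar>\<^sup>2)"
    and "integrable lborel (\<lambda>x. \<bar>extremal b x\<bar>\<^sup>2 / norm x)"
    and "integrable lborel (\<lambda>x. (norm (extremal_grad b x))\<^sup>2)"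
    and "(\<integral>x. \<bar>extremal b x\<bar>\<^sup>2 / norm x \<partial>lborel) = m / 2"
    and "(\<integral>x. \<bar>extremal b x\<bar>\<^sup>2 \<partial>lborel) = (real DIM('a) + 1) / 4 * m"
    and "(\<integral>x. (norm (extremal_grad b x))\<^sup>2 \<partial>lborel) = (real DIM('a) + 1) / 4 * m"
proof -
  interpret coulomb T 2 by unfold_locales simp
  have bb: "b \<bullet> b = 1" using b by simp
  define J where "J f = ip (\<lambda>_. 1) f" for f
  have J_lin: "J (\<lambda>x. c * f x + d * g x) = c * J f + d * J g" if "tame f" "tame g" for c d f g
  proof -
    have "J (\<lambda>x. c * f x + d * g x) = (\<integral>x. c * (1 * f x * weight x) + d * (1 * g x * weight x) \<partial>lborel)"
      unfolding J_def ip_def by (rule Bochner_Integration.integral_cong) (simp_all add: algebra_simps)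
    also have "\<dots> = c * J f + d * J g" unfolding J_def ip_def
      using Bochner_Integration.integral_add[OF integrable_mult_right[OF ip_integrable[OF tame_const[of 1] that(1)], of c]
        integrable_mult_right[OF ip_integrable[OF tame_const[of 1] that(2)], of d]]
      by (simp only: integral_mult_right_zero)
    finally show ?thesis .
  qed
  \<comment> \<open>Converts a plain integral into a weighted moment: multiplying the integrand by
    \<open>norm x * exp (2 * norm x)\<close> compensates the weight off the origin.\<close>
  have J_off_0: "integrable lborel g" "(\<integral>x. g x \<partial>lborel) = J f"
    if "tame f" "\<And>x. x \<noteq> 0 \<Longrightarrow> f x * exp (- 2 * norm x) = g x * norm x" for f g
  proof -
    have e: "1 * f x * weight x = g x" if "x \<noteq> 0" for x
      using \<open>\<And>x. x \<noteq> 0 \<Longrightarrow> _\<close>[OF that] that by (simp add: weight_def field_simps)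
    show "integrable lborel g" "(\<integral>x. g x \<partial>lborel) = J f"
      using integral_cong_off_0[OF ip_integrable[OF tame_const[of 1] that(1)] e] by (auto simp: J_def ip_def)
  qed
  define p where "p x = (x \<bullet> b) * (x \<bullet> b)" for x
  have t: "tame norm" "tame p" "tame (\<lambda>x::'a. norm x * p x)" "tame (\<lambda>x::'a. norm x * norm x)"
    unfolding p_def[abs_def] by (intro tame_mult tame_norm tame_inner_right)+
  have lin0: "lin 0 b x = x \<bullet> b" and lin1: "lin 1 0 x = norm x" for x :: 'a by (simp_all add: lin_def inner_commute)
  have glin0: "glin 0 b x = b" and glin1: "glin 1 0 x = sgn x" for x :: 'a by (simp_all add: glin_def)
  have ns: "norm x * (sgn x \<bullet> y) = x \<bullet> y" for x y :: 'a using norm_mult_sgn[of x] by (metis inner_scaleR_left)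
  have rp: "regular p (\<lambda>x. (2 * (x \<bullet> b)) *\<^sub>R b) (\<lambda>x. 2 * norm x)"
    using regular_mult[OF regular_lin[of 0 b] regular_lin[of 0 b]]
    by (simp add: lin0 glin0 bb p_def[abs_def] scaleR_left_distrib[symmetric])
  have "J (\<lambda>x. 2 * (x \<bullet> (2 * (x \<bullet> b)) *\<^sub>R b) - 2 * norm x) = 0" (is "J ?f = 0")
    unfolding J_def by (rule moment_identity[OF rp])
  also have "?f = (\<lambda>x. 4 * p x + (- 2) * norm x)"
    by (auto simp: p_def)
  finally have 1: "4 * J p + (- 2) * J norm = 0" by (simp only: J_lin[OF t(2,1)])
  have "J (\<lambda>x. 2 * (x \<bullet> (norm x *\<^sub>R sgn x + norm x *\<^sub>R sgn x))
      - (norm x * (real DIM('a) - 1) + norm x * (real DIM('a) - 1) + 2 * (norm x * (sgn x \<bullet> sgn x)))) = 0" (is "J ?f = 0")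
    using moment_identity[OF regular_mult[OF regular_lin[of 1 0] regular_lin[of 1 0]]]
    by (simp only: J_def lin1 glin1 mult_1_left)
  also have "?f
     = (\<lambda>x::'a. 4 * (norm x * norm x) + (- 2 * real DIM('a)) * norm x)"
    by (simp add: ns inner_sgn_self inner_add_right fun_eq_iff algebra_simps)
  finally have 2: "4 * J (\<lambda>x. norm x * norm x) + (- 2 * real DIM('a)) * J norm = 0" by (simp only: J_lin[OF t(4,1)])
  have "J (\<lambda>x. 2 * (x \<bullet> (norm x *\<^sub>R ((2 * (x \<bullet> b)) *\<^sub>R b) + p x *\<^sub>R sgn x))
      - (norm x * (2 * norm x) + p x * (real DIM('a) - 1) + 2 * (norm x * (sgn x \<bullet> (2 * (x \<bullet> b)) *\<^sub>R b)))) = 0" (is "J ?f = 0")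
    using moment_identity[OF regular_mult[OF regular_lin[of 1 0] rp]]
    by (simp only: J_def lin1 glin1 mult_1_left)
  also have "?f
     = (\<lambda>x. 6 * (norm x * p x) + (- 1) * (2 * (norm x * norm x) + (real DIM('a) + 3) * p x))"
  proof
    fix x
    have "norm x * (sgn x \<bullet> (2 * (x \<bullet> b)) *\<^sub>R b) = 2 * p x" unfolding ns by (simp add: p_def)
    then show "2 * (x \<bullet> (norm x *\<^sub>R ((2 * (x \<bullet> b)) *\<^sub>R b) + p x *\<^sub>R sgn x))
      - (norm x * (2 * norm x) + p x * (real DIM('a) - 1) + 2 * (norm x * (sgn x \<bullet> (2 * (x \<bullet> b)) *\<^sub>R b)))
     = 6 * (norm x * p x) + (- 1) * (2 * (norm x * norm x) + (real DIM('a) + 3) * p x)"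
      by (simp only:) (simp add: inner_sgn_self inner_add_right p_def algebra_simps)
  qed
  finally have "6 * J (\<lambda>x. norm x * p x) + (- 1) * J (\<lambda>x. 2 * (norm x * norm x) + (real DIM('a) + 3) * p x) = 0"
    by (simp only: J_lin[OF t(3) tame_add[OF tame_cmult[OF t(4)] tame_cmult[OF t(2)]]])
  then have 3: "6 * J (\<lambda>x. norm x * p x) + (- 1) * (2 * J (\<lambda>x. norm x * norm x) + (real DIM('a) + 3) * J p) = 0"
    by (simp only: J_lin[OF t(4,2)])
  have m: "J norm = m" unfolding m_def by (rule J_off_0(2)[OF t(1), symmetric]) simp
  have c: "J p = m / 2" using 1 m by simp
  have "2 * J (\<lambda>x. norm x * norm x) = real DIM('a) * m" using 2 m by simp
  moreover have "6 * J (\<lambda>x. norm x * p x) = 2 * J (\<lambda>x. norm x * norm x) + (real DIM('a) + 3) * J p"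
    using 3 by (simp only: mult_minus1 add_uminus_conv_diff right_minus_eq)
  ultimately have "6 * J (\<lambda>x. norm x * p x) = real DIM('a) * m + (real DIM('a) + 3) * (m / 2)"
    by (simp only: c)
  then have B: "J (\<lambda>x. norm x * p x) = (real DIM('a) + 1) / 4 * m" by (simp add: field_simps)
  have sq: "\<bar>extremal b x\<bar>\<^sup>2 = p x * exp (- 2 * norm x)" for x
    unfolding power2_abs extremal_def p_def exp_minus_norm_square[symmetric] by (simp only: power2_eq_square mult_ac)
  note u1 = J_off_0[OF t(3), of "\<lambda>x. \<bar>extremal b x\<bar>\<^sup>2", unfolded sq]
  show "integrable lborel (\<lambda>x. \<bar>extremal b x\<bar>\<^sup>2)" unfolding sq by (rule u1) simp
  show "(\<integral>x. \<bar>extremal b x\<bar>\<^sup>2 \<partial>lborel) = (real DIM('a) + 1) / 4 * m"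
    unfolding sq B[symmetric] by (rule u1) simp
  note u2 = J_off_0[OF t(2), of "\<lambda>x. \<bar>extremal b x\<bar>\<^sup>2 / norm x", unfolded sq]
  show "integrable lborel (\<lambda>x. \<bar>extremal b x\<bar>\<^sup>2 / norm x)" unfolding sq by (rule u2) simp
  show "(\<integral>x. \<bar>extremal b x\<bar>\<^sup>2 / norm x \<partial>lborel) = m / 2"
    unfolding sq c[symmetric] by (rule u2) simp
  have gsq: "(1 * (1 * norm x + (- 2) * p x) + 1 * (norm x * p x)) * exp (- 2 * norm x) = (norm (extremal_grad b x))\<^sup>2 * norm x"
    if x: "x \<noteq> 0" for x
  proof -
    have "sgn x \<bullet> sgn x = 1" using x by (simp add: dot_square_norm norm_sgn)
    then have e: "(b - (x \<bullet> b) *\<^sub>R sgn x) \<bullet> (b - (x \<bullet> b) *\<^sub>R sgn x) = 1 - 2 * ((x \<bullet> b) * (sgn x \<bullet> b)) + p x"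
      using bb by (simp add: inner_diff_left inner_diff_right inner_commute p_def algebra_simps)
    have np: "norm x * ((x \<bullet> b) * (sgn x \<bullet> b)) = p x" using ns[of x b] by (simp add: p_def mult.left_commute)
    have "norm x * (1 - 2 * ((x \<bullet> b) * (sgn x \<bullet> b)) + p x) = norm x - 2 * (norm x * ((x \<bullet> b) * (sgn x \<bullet> b))) + norm x * p x"
      by (simp add: algebra_simps)
    then have *: "norm x * ((b - (x \<bullet> b) *\<^sub>R sgn x) \<bullet> (b - (x \<bullet> b) *\<^sub>R sgn x)) = norm x - 2 * p x + norm x * p x"
      unfolding e np .
    have "(norm (extremal_grad b x))\<^sup>2 = exp (- 2 * norm x) * ((b - (x \<bullet> b) *\<^sub>R sgn x) \<bullet> (b - (x \<bullet> b) *\<^sub>R sgn x))"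
      unfolding extremal_grad_def power2_norm_eq_inner inner_scaleR_left inner_scaleR_right exp_minus_norm_square[symmetric]
      by (simp only: mult_ac)
    then have "(norm (extremal_grad b x))\<^sup>2 * norm x = exp (- 2 * norm x) * (norm x - 2 * p x + norm x * p x)"
      unfolding *[symmetric] by (simp only: mult_ac)
    then show ?thesis by (simp add: mult.commute)
  qed
  have tg: "tame (\<lambda>x. 1 * (1 * norm x + (- 2) * p x) + 1 * (norm x * p x))"
    by (rule tame_add[OF tame_cmult[OF tame_add[OF tame_cmult[OF t(1)] tame_cmult[OF t(2)]]] tame_cmult[OF t(3)]])
  show "integrable lborel (\<lambda>x. (norm (extremal_grad b x))\<^sup>2)" by (rule J_off_0(1)[OF tg gsq])
  have "(\<integral>x. (norm (extremal_grad b x))\<^sup>2 \<partial>lborel) = J (\<lambda>x. 1 * (1 * norm x + (- 2) * p x) + 1 * (norm x * p x))"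
    by (rule J_off_0(2)[OF tg gsq])
  also have "\<dots> = 1 * (1 * J norm + (- 2) * J p) + 1 * J (\<lambda>x. norm x * p x)"
    by (simp only: J_lin[OF tame_add[OF tame_cmult[OF t(1)] tame_cmult[OF t(2)]] t(3)] J_lin[OF t(1,2)])
  finally show "(\<integral>x. (norm (extremal_grad b x))\<^sup>2 \<partial>lborel) = (real DIM('a) + 1) / 4 * m"
    by (simp add: m c B)
  have "0 < exp (- 2) * measure lborel (cball (0::'a) 1)" by simp
  also have "\<dots> = (\<integral>x. exp (- 2) * indicator (cball 0 1) x \<partial>(lborel::'a measure))" by simp
  also have "\<dots> \<le> m" unfolding m_def
  proof (rule integral_mono)
    show "integrable lborel (\<lambda>x::'a. exp (- 2) * indicator (cball 0 1) x :: real)"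
      by (intro integrable_mult_right integrable_real_indicator) (use emeasure_bounded_finite[OF bounded_cball, of "0::'a" 1] in auto)
    show "integrable lborel (\<lambda>x::'a. exp (- 2 * norm x))" by (rule decaying_integrable[OF decaying_exp]) simp
    show "exp (- 2) * indicator (cball 0 1) x \<le> exp (- 2 * norm x)" for x :: 'a
      by (auto simp: indicator_def)
  qed
  finally show "0 < m" .
qed

end

section \<open>Weak differentiability of the extremal function\<close>

lemma has_derivative_extremal:
  assumes "x \<noteq> 0"
  shows "(extremal b has_derivative (\<lambda>h. h \<bullet> extremal_grad b x)) (at x)"
proof -
  have "((\<lambda>x. (x \<bullet> b) * exp (- norm x)) has_derivative (\<lambda>h. h \<bullet> extremal_grad b x)) (at x)"
    using assms unfolding extremal_grad_def
    by (auto intro!: derivative_eq_intros has_derivative_norm_sgn simp: inner_diff_right algebra_simps)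
  then show ?thesis by (simp add: extremal_def[abs_def])
qed

lemma decaying_extremal: "decaying (extremal b)"
  using decaying_mult_tame[OF decaying_exp[of 1] tame_inner_right[of b]]
  by (simp add: extremal_def[abs_def] mult.commute)

lemma decaying_extremal_grad: "decaying (\<lambda>x. extremal_grad b x \<bullet> a)"
proof -
  have "decaying (\<lambda>x. exp (- 1 * norm x) * (b \<bullet> a - (x \<bullet> b) * (sgn x \<bullet> a)))"
    by (rule decaying_mult_tame[OF decaying_exp tame_diff[OF tame_const tame_mult[OF tame_inner_right tame_sgn_inner]]]) simp
  then show ?thesis by (simp add: extremal_grad_def inner_diff_left)
qed

lemma extremal_grad_measurable: "extremal_grad b \<in> borel_measurable borel"
  unfolding borel_measurable_euclidean_space[of "extremal_grad b"]
  using tame_measurable[OF decaying_imp_tame[OF decaying_extremal_grad]] by blast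

context dim_ge2 begin

lemma extremal_integrable: "integrable lborel (extremal (b::'a))"
  by (rule decaying_integrable[OF decaying_extremal])

lemma extremal_grad_integrable: "integrable lborel (extremal_grad (b::'a))"
proof -
  have "integrable lborel (\<lambda>x. \<Sum>a\<in>Basis. (extremal_grad b x \<bullet> a) *\<^sub>R a)"
    by (intro Bochner_Integration.integrable_sum integrable_scaleR_left decaying_integrable decaying_extremal_grad)
  then show ?thesis by (simp add: euclidean_representation)
qed

end

text \<open>The gradient off the origin is the weak gradient, because the vanishing integral of a
  derivative was obtained without differentiability at the origin. Decay of
  \<open>extremal b\<close> replaces compact support.\<close>

lemma (in dim_ge2) integration_by_parts_extremal:
  fixes \<phi> :: "'a \<Rightarrow> real"
  assumes t: "tame \<phi>" and d: "\<And>x. (\<phi> has_derivative (\<lambda>h. h \<bullet> g x)) (at x)"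
    and i: "integrable lborel (\<lambda>x. extremal b x * (g x \<bullet> a))" and a: "a \<in> Basis"
  shows "(\<integral>x. extremal b x * (g x \<bullet> a) \<partial>lborel) = - (\<integral>x. \<phi> x * (extremal_grad b x \<bullet> a) \<partial>lborel)"
proof -
  have F: "decaying (\<lambda>x. extremal b x * \<phi> x)" by (rule decaying_mult_tame[OF decaying_extremal t])
  have dF: "((\<lambda>x. extremal b x * \<phi> x) has_derivative (\<lambda>h. extremal b x * (h \<bullet> g x) + (h \<bullet> extremal_grad b x) * \<phi> x)) (at x)"
    if "x \<noteq> 0" for x by (rule has_derivative_mult[OF has_derivative_extremal[OF that] d])
  have j: "integrable lborel (\<lambda>x. \<phi> x * (extremal_grad b x \<bullet> a))"
    using decaying_integrable[OF decaying_mult_tame[OF decaying_extremal_grad t]] by (simp add: mult.commute)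
  have "0 = (\<integral>x. extremal b x * (a \<bullet> g x) + (a \<bullet> extremal_grad b x) * \<phi> x \<partial>lborel)"
    by (rule integral_derivative_eq_0(2)[OF F dF a, symmetric])
  also have "\<dots> = (\<integral>x. extremal b x * (g x \<bullet> a) + \<phi> x * (extremal_grad b x \<bullet> a) \<partial>lborel)"
    by (simp add: inner_commute mult.commute)
  also have "\<dots> = (\<integral>x. extremal b x * (g x \<bullet> a) \<partial>lborel) + (\<integral>x. \<phi> x * (extremal_grad b x \<bullet> a) \<partial>lborel)"
    by (rule Bochner_Integration.integral_add[OF i j])
  finally show ?thesis by simp
qed

lemma weak_gradient_extremal:
  fixes b :: "real^'n"
  assumes dim: "2 \<le> CARD('n)"
  shows "weak_gradient (extremal b) (extremal_grad b)"
proof -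
  interpret dim_ge2 "TYPE(real^'n)" by unfold_locales (use dim in simp)
  have m: "extremal b \<in> borel_measurable lborel" "extremal_grad b \<in> borel_measurable lborel"
    using extremal_integrable[of b] extremal_grad_integrable[of b] by (simp_all add: borel_measurable_integrable)
  have si: "set_integrable lborel K (extremal b)" "set_integrable lborel K (extremal_grad b)" if "compact K" for K
  proof -
    have "K \<in> sets lborel" using borel_compact[OF that] by simp
    then show "set_integrable lborel K (extremal b)" "set_integrable lborel K (extremal_grad b)"
      unfolding set_integrable_def
      by (auto intro: integrable_mult_indicator[OF _ extremal_integrable, unfolded real_scaleR_def]
          integrable_mult_indicator[OF _ extremal_grad_integrable])
  qed
  have weak: "(\<integral>x. extremal b x *\<^sub>R gradient \<phi> x \<partial>lborel) = - (\<integral>x. \<phi> x *\<^sub>R extremal_grad b x \<partial>lborel)"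
    if \<phi>: "\<phi> \<in> test_functions" for \<phi>
  proof -
    obtain R B where d: "\<And>x. (\<phi> has_derivative (\<lambda>h. h \<bullet> gradient \<phi> x)) (at x)"
      and cg: "continuous_on UNIV (gradient \<phi>)" and R: "\<And>x. R \<le> norm x \<Longrightarrow> gradient \<phi> x = 0"
      and B: "0 \<le> B" "\<And>x. \<bar>\<phi> x\<bar> \<le> B" "\<And>x y. \<bar>\<phi> x - \<phi> y\<bar> \<le> B * norm (x - y)"
      by (rule test_function_C1[OF \<phi>]) (rule that)
    have t: "tame \<phi>" by (rule tame_lipschitz[where B = B, OF _ B(3)]) (use B in \<open>simp add: add_increasing2\<close>)
    have mg: "gradient \<phi> \<in> borel_measurable borel" using cg by (rule borel_measurable_continuous_onI)
    have "compact (gradient \<phi> ` cball 0 R)" by (intro compact_continuous_image continuous_on_subset[OF cg]) auto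
    from compact_imp_bounded[OF this] obtain c where "\<forall>y\<in>gradient \<phi> ` cball 0 R. norm y \<le> c"
      unfolding bounded_iff by blast
    then have c: "norm (gradient \<phi> x) \<le> \<bar>c\<bar>" for x using R[of x] by (cases "norm x \<le> R") force+
    have i1: "integrable lborel (\<lambda>x. extremal b x *\<^sub>R gradient \<phi> x)"
    proof (rule Bochner_Integration.integrable_bound[OF integrable_mult_right[OF extremal_integrable[of b], of "\<bar>c\<bar>"]])
      show "(\<lambda>x. extremal b x *\<^sub>R gradient \<phi> x) \<in> borel_measurable lborel" using m mg by simp
      have "norm (extremal b x *\<^sub>R gradient \<phi> x) \<le> norm (\<bar>c\<bar> * extremal b x)" for x
        using mult_right_mono[OF c[of x], of "\<bar>extremal b x\<bar>"] by (simp add: abs_mult mult.commute)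
      then show "AE x in lborel. norm (extremal b x *\<^sub>R gradient \<phi> x) \<le> norm (\<bar>c\<bar> * extremal b x)" by simp
    qed
    have i2: "integrable lborel (\<lambda>x. \<phi> x *\<^sub>R extremal_grad b x)"
    proof (rule Bochner_Integration.integrable_bound[OF integrable_scaleR_right[OF extremal_grad_integrable[of b], of B]])
      show "(\<lambda>x. \<phi> x *\<^sub>R extremal_grad b x) \<in> borel_measurable lborel" using m tame_measurable[OF t] by simp
      have "norm (\<phi> x *\<^sub>R extremal_grad b x) \<le> norm (B *\<^sub>R extremal_grad b x)" for x
        using mult_right_mono[OF B(2)[of x], of "norm (extremal_grad b x)"] B(1) by simp
      then show "AE x in lborel. norm (\<phi> x *\<^sub>R extremal_grad b x) \<le> norm (B *\<^sub>R extremal_grad b x)" by simp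
    qed
    show ?thesis
    proof (rule euclidean_eqI)
      fix a :: "real^'n" assume a: "a \<in> Basis"
      have "integrable lborel (\<lambda>x. (extremal b x *\<^sub>R gradient \<phi> x) \<bullet> a)" by (rule integrable_inner_left[OF i1])
      then have i: "integrable lborel (\<lambda>x. extremal b x * (gradient \<phi> x \<bullet> a))" by simp
      have "(\<integral>x. extremal b x *\<^sub>R gradient \<phi> x \<partial>lborel) \<bullet> a = (\<integral>x. extremal b x * (gradient \<phi> x \<bullet> a) \<partial>lborel)"
        using integral_inner_left[OF i1, of a] by simp
      also have "\<dots> = - (\<integral>x. \<phi> x * (extremal_grad b x \<bullet> a) \<partial>lborel)"
        by (rule integration_by_parts_extremal[OF t d i a])
      also have "\<dots> = (- (\<integral>x. \<phi> x *\<^sub>R extremal_grad b x \<partial>lborel)) \<bullet> a"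
        using integral_inner_left[OF i2, of a] by simp
      finally show "(\<integral>x. extremal b x *\<^sub>R gradient \<phi> x \<partial>lborel) \<bullet> a = (- (\<integral>x. \<phi> x *\<^sub>R extremal_grad b x \<partial>lborel)) \<bullet> a" .
    qed
  qed
  show ?thesis unfolding weak_gradient_def using m si weak by blast
qed

theorem extremal_attains:
  fixes b :: "real^'n"
  assumes dim: "2 \<le> CARD('n)" and b: "b \<in> Basis"
  shows "natural_space (extremal b) (extremal_grad b)"
    and "\<not> (\<exists>c l. l > 0 \<and> (AE x in lborel. extremal b x = c * exp (- l * norm x)))"
    and "deficit (extremal b) (extremal_grad b) = exp_dist (extremal b)"
proof -
  interpret dim_ge2 "TYPE(real^'n)" by unfold_locales (use dim in simp)
  note I = extremal_integrals[OF b]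
  define m where "m = (\<integral>x. exp (- 2 * norm x) \<partial>(lborel :: (real^'n) measure))"
  have mu: "extremal b \<in> borel_measurable borel"
    by (rule tame_measurable[OF decaying_imp_tame[OF decaying_extremal]])
  have odd: "extremal b (- x) = - extremal b x" for x by (simp add: extremal_def)
  show "natural_space (extremal b) (extremal_grad b)"
    unfolding natural_space_def using I(2,3,4) weak_gradient_extremal[OF assms(1)] by blast
  have "exp_dist (extremal b) = m / 2"
    using exp_dist_odd[OF assms(1) mu odd I(3)] I(5) by (simp only: m_def)
  \<comment> \<open>Both norms are equal, so the value is
    \<open>(N + 1) / 4 * m - (N - 1) / 2 * (m / 2) = m / 2\<close> with \<open>N\<close> the
    dimension.\<close>
  moreover have "deficit (extremal b) (extremal_grad b) = m / 2"
  proof -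
    have "0 \<le> (real CARD('n) + 1) / 4 * m" using I(1) by (simp add: m_def)
    moreover have "DIM(real^'n) = CARD('n)" by simp
    ultimately show ?thesis
      unfolding deficit_def I(5,6,7) m_def[symmetric] by (simp add: field_simps)
  qed
  ultimately show "deficit (extremal b) (extremal_grad b) = exp_dist (extremal b)" by simp
  show "\<not> (\<exists>c l. l > 0 \<and> (AE x in lborel. extremal b x = c * exp (- l * norm x)))"
  proof
    assume "\<exists>c l. l > 0 \<and> (AE x in lborel. extremal b x = c * exp (- l * norm x))"
    then obtain c l where l: "0 < l" and ae: "AE x in lborel. extremal b x = c * exp (- l * norm x)" by blast
    let ?E = "\<lambda>x::real^'n. exp (- l * norm x)"
    \<comment> \<open>If the function were such a profile, its square would be almost everywhere the
      product of an even and an odd function, so its integral would vanish although it is a positive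
      multiple of \<open>m\<close>.\<close>
    have "AE x in lborel. \<bar>extremal b x\<bar>\<^sup>2 = (c * ?E x) * extremal b x"
      using ae by eventually_elim (simp add: power2_eq_square)
    then have "(\<integral>x. \<bar>extremal b x\<bar>\<^sup>2 \<partial>lborel) = (\<integral>x. (c * ?E x) * extremal b x \<partial>lborel)"
      using mu by (intro integral_cong_AE) auto
    also have "\<dots> = 0"
    proof -
      let ?f = "\<lambda>x. (c * ?E x) * extremal b x"
      have "?f \<in> borel_measurable borel" using mu by simp
      from integral_lborel_uminus[OF this] have "(\<integral>x. - ?f x \<partial>lborel) = (\<integral>x. ?f x \<partial>lborel)" by (simp add: odd)
      then show ?thesis by simp
    qed
    finally have "(real DIM(real^'n) + 1) / 4 * m = 0" using I(6) by (simp only: m_def)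
    then show False using I(1) by (simp add: m_def)
  qed
qed

subsection \<open>Sharpness\<close>

text \<open>The factor \<open>exp 1\<close> normalises the cutoff to the value 1 at
  \<open>t = 1\<close>. The second pair concerns the derivative of the cutoff; its bound comes from
  \<open>y ^ 2 * exp (- y) \<le> 2\<close>.\<close>

lemma flat_bounds:
  assumes "t \<le> 1"
  shows "0 \<le> exp 1 * flat [:1:] t" "exp 1 * flat [:1:] t \<le> 1"
    "0 \<le> exp 1 * flat [:0, 0, 1:] t" "exp 1 * flat [:0, 0, 1:] t \<le> 2 * exp 1"
proof -
  show "0 \<le> exp 1 * flat [:1:] t" "0 \<le> exp 1 * flat [:0, 0, 1:] t" by (simp_all add: flat_def)
  show "exp 1 * flat [:1:] t \<le> 1"
  proof (cases "0 < t")
    case True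
    then have "exp 1 * exp (- (1 / t)) \<le> exp (1 + - (1 / t))" by (simp only: exp_add)
    also have "\<dots> \<le> 1" using True assms by simp
    finally show ?thesis using True by (simp add: flat_def)
  qed (simp add: flat_def)
  show "exp 1 * flat [:0, 0, 1:] t \<le> 2 * exp 1"
  proof (cases "0 < t")
    case True
    have "(1 / t) ^ 2 \<le> fact 2 * exp (1 / t)" using True by (intro power_le_fact_exp) simp
    then have "(1 / t) ^ 2 * exp (- (1 / t)) \<le> 2 * exp (1 / t) * exp (- (1 / t))" by (intro mult_right_mono) simp_all
    also have "\<dots> = 2" by (simp add: exp_minus)
    finally have "exp 1 * ((1 / t) ^ 2 * exp (- (1 / t))) \<le> exp 1 * 2" by (intro mult_left_mono) simp_all
    then show ?thesis using True by (simp add: flat_def power2_eq_square)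
  qed (simp add: flat_def)
qed

text \<open>One parameter does both jobs: \<open>sqrt (e + x \<bullet> x)\<close> smooths the norm
  at the origin, and the cutoff vanishes once \<open>norm x\<close> reaches
  \<open>1 / sqrt e\<close>. Both modifications depend only on \<open>x \<bullet> x\<close>, so the
  function remains odd.\<close>

definition mollified :: "'a::euclidean_space \<Rightarrow> real \<Rightarrow> 'a \<Rightarrow> real" where
  "mollified b e x = (x \<bullet> b) * (exp (- sqrt (e + x \<bullet> x)) * (exp 1 * flat [:1:] (1 - e * (x \<bullet> x))))"

text \<open>\<open>flat [:0, 0, 1:]\<close> is the derivative of \<open>flat [:1:]\<close>, as given
  by \<open>X^2 * (p - p')\<close> for \<open>p = 1\<close>.\<close>

definition mollified_grad :: "'a::euclidean_space \<Rightarrow> real \<Rightarrow> 'a \<Rightarrow> 'a" where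
  "mollified_grad b e x = (exp (- sqrt (e + x \<bullet> x)) * (exp 1 * flat [:1:] (1 - e * (x \<bullet> x)))) *\<^sub>R b
     - ((x \<bullet> b) * exp (- sqrt (e + x \<bullet> x)) *
         (exp 1 * flat [:1:] (1 - e * (x \<bullet> x)) / sqrt (e + x \<bullet> x) + 2 * e * (exp 1 * flat [:0, 0, 1:] (1 - e * (x \<bullet> x))))) *\<^sub>R x"

lemma GDERIV_mollified:
  assumes e: "0 < e" shows "GDERIV (mollified b e) x :> mollified_grad b e x"
proof -
  have pos: "0 < e + x \<bullet> x" using e by (simp add: add_pos_nonneg)
  let ?r = "sqrt (e + x \<bullet> x)"
  have lin: "GDERIV (\<lambda>x. x \<bullet> b) x :> b"
    unfolding gderiv_def by (auto intro!: derivative_eq_intros)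
  have sq: "GDERIV (\<lambda>x. c + d * (x \<bullet> x)) x :> (2 * d) *\<^sub>R x" for c d
    using GDERIV_add[OF GDERIV_const[of c] GDERIV_mult[OF GDERIV_const[of d] GDERIV_inner_self]]
    by (simp add: mult.commute)
  have "((\<lambda>t. exp (- sqrt t)) has_real_derivative - exp (- ?r) * (inverse ?r / 2)) (at (e + x \<bullet> x))"
    using DERIV_real_sqrt[OF pos] pos by (auto intro!: derivative_eq_intros)
  from GDERIV_DERIV_compose[OF sq[of e 1, unfolded mult_1_left] this]
  have E: "GDERIV (\<lambda>x. exp (- sqrt (e + x \<bullet> x))) x :> (- exp (- ?r) * (inverse ?r / 2)) *\<^sub>R (2 * 1) *\<^sub>R x" .
  have "flat ([:0, 0, 1:] * ([:1:] - pderiv [:1:])) = flat [:0, 0, 1:]" by (simp add: pderiv_pCons)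
  then have "((\<lambda>t. exp 1 * flat [:1:] t) has_real_derivative exp 1 * flat [:0, 0, 1:] (1 + (- e) * (x \<bullet> x))) (at (1 + (- e) * (x \<bullet> x)))"
    using flat_has_derivative[of "[:1:]" "1 + (- e) * (x \<bullet> x)"] by (intro DERIV_cmult) simp
  from GDERIV_DERIV_compose[OF sq[of 1 "- e"] this]
  have F: "GDERIV (\<lambda>x. exp 1 * flat [:1:] (1 - e * (x \<bullet> x))) x :>
      (exp 1 * flat [:0, 0, 1:] (1 - e * (x \<bullet> x))) *\<^sub>R (2 * (- e)) *\<^sub>R x" by simp
  show ?thesis
    using GDERIV_mult[OF lin GDERIV_mult[OF E F]] unfolding mollified_def[abs_def]
    by (rule GDERIV_subst) (simp add: mollified_grad_def inverse_eq_divide algebra_simps)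
qed

lemma mollified_test_function:
  fixes i :: "'n::finite"
  assumes e: "0 < e" shows "mollified (axis i 1) e \<in> test_functions"
proof -
  have "C_k k (mollified (axis i 1 :: real^'n) e)" for k
  proof -
    have "C_k k (\<lambda>x::real^'n. e + x \<bullet> x)" by (rule C_k_add[OF C_k_const C_k_inner_self])
    then have 1: "C_k k (\<lambda>x::real^'n. exp (- sqrt (e + x \<bullet> x)))"
      using e by (intro C_k_exp_minus C_k_sqrt) (auto intro: add_pos_nonneg)
    have "C_k k (\<lambda>x::real^'n. 1 + (- e) * (x \<bullet> x))"
      by (rule C_k_add[OF C_k_const C_k_mult[OF C_k_const C_k_inner_self]])
    then have "C_k k (\<lambda>x::real^'n. flat [:1:] (1 - e * (x \<bullet> x)))" by (intro C_k_flat) simp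
    then have "C_k k (\<lambda>x::real^'n. x $ i * (exp (- sqrt (e + x \<bullet> x)) * (exp 1 * flat [:1:] (1 - e * (x \<bullet> x)))))"
      by (rule C_k_mult[OF C_k_nth C_k_mult[OF 1 C_k_mult[OF C_k_const]]])
    then show ?thesis by (simp add: mollified_def[abs_def] inner_axis)
  qed
  moreover have "{x::real^'n. mollified (axis i 1) e x \<noteq> 0} \<subseteq> cball 0 (1 / sqrt e)"
  proof
    fix x :: "real^'n" assume "x \<in> {x::real^'n. mollified (axis i 1) e x \<noteq> 0}"
    then have "flat [:1:] (1 - e * (x \<bullet> x)) \<noteq> 0" by (auto simp: mollified_def)
    then have "e * (x \<bullet> x) < 1" by (auto simp: flat_def split: if_splits)
    then have "(norm x)\<^sup>2 < 1 / e" using e by (simp add: power2_norm_eq_inner field_simps)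
    then have "norm x < sqrt (1 / e)" by (rule real_less_rsqrt)
    then show "x \<in> cball 0 (1 / sqrt e)" by (simp add: real_sqrt_divide)
  qed
  then have "compact (closure {x::real^'n. mollified (axis i 1) e x \<noteq> 0})"
    unfolding compact_closure by (rule bounded_subset[OF bounded_cball])
  ultimately show ?thesis by (simp add: test_functions_def)
qed

text \<open>The bounds do not depend on \<open>e\<close>: the smoothed norm is at least
  \<open>norm x\<close>, so its exponential is at most \<open>exp (- norm x)\<close>. They supply
  the majorants for letting \<open>e\<close> tend to zero; \<open>4 * exp 1\<close> is twice the
  bound for the derivative of the cutoff.\<close>

lemma mollified_bounds:
  fixes b :: "'a::euclidean_space"
  assumes e: "0 < e" "e \<le> 1" and b: "norm b = 1"
  shows "\<bar>mollified b e x\<bar> \<le> exp (- norm x) * norm x"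
    and "norm (mollified_grad b e x) \<le> exp (- norm x) * (1 + norm x + 4 * exp 1 * (norm x)\<^sup>2)"
proof -
  let ?r = "sqrt (e + x \<bullet> x)"
  define E where "E = exp (- ?r)"
  define \<eta> where "\<eta> = exp 1 * flat [:1:] (1 - e * (x \<bullet> x))"
  define \<theta> where "\<theta> = exp 1 * flat [:0, 0, 1:] (1 - e * (x \<bullet> x))"
  have \<eta>: "0 \<le> \<eta>" "\<eta> \<le> 1" "0 \<le> \<theta>" "\<theta> \<le> 2 * exp 1"
    unfolding \<eta>_def \<theta>_def using e by (intro flat_bounds; simp)+
  have r: "norm x \<le> ?r" using e by (intro real_le_rsqrt) (simp add: power2_norm_eq_inner)
  have r0: "0 < ?r" using e by (simp add: add_pos_nonneg)
  have E: "0 < E" "E \<le> exp (- norm x)" using r by (auto simp: E_def)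
  have xb: "\<bar>x \<bullet> b\<bar> \<le> norm x" using Cauchy_Schwarz_ineq2[of x b] b by simp
  have E\<eta>: "E * \<eta> \<le> exp (- norm x) * 1" using E \<eta> by (intro mult_mono) auto
  have "\<bar>mollified b e x\<bar> = (E * \<eta>) * \<bar>x \<bullet> b\<bar>"
    using E \<eta> by (simp add: mollified_def E_def[symmetric] \<eta>_def[symmetric] abs_mult)
  also have "\<dots> \<le> (exp (- norm x) * 1) * norm x" using E\<eta> xb by (rule mult_mono) auto
  finally show "\<bar>mollified b e x\<bar> \<le> exp (- norm x) * norm x" by simp
  have c: "norm x * (\<eta> / ?r + 2 * e * \<theta>) \<le> 1 + 4 * exp 1 * norm x"
  proof -
    have "norm x / ?r \<le> 1" using r r0 by simp
    then have "norm x / ?r * \<eta> \<le> 1 * 1" using \<eta> r0 by (intro mult_mono) auto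
    moreover have "e * \<theta> \<le> 1 * (2 * exp 1)" using e \<eta> by (intro mult_mono) auto
    then have "norm x * (2 * (e * \<theta>)) \<le> norm x * (2 * (2 * exp 1))" by (intro mult_left_mono) auto
    ultimately show ?thesis by (simp add: algebra_simps)
  qed
  have nn: "0 \<le> \<eta> / ?r + 2 * e * \<theta>" using \<eta> e r0 by (simp add: less_imp_le)
  have "norm (mollified_grad b e x) \<le> norm ((E * \<eta>) *\<^sub>R b) + norm (((x \<bullet> b) * E * (\<eta> / ?r + 2 * e * \<theta>)) *\<^sub>R x)"
    unfolding mollified_grad_def E_def[symmetric] \<eta>_def[symmetric] \<theta>_def[symmetric] by (rule norm_triangle_ineq4)
  also have "\<dots> = E * \<eta> + E * (\<bar>x \<bullet> b\<bar> * (norm x * (\<eta> / ?r + 2 * e * \<theta>)))"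
    using E \<eta> nn b by (simp only: norm_scaleR abs_mult abs_of_nonneg less_imp_le mult_1_right mult_ac)
  also have "\<dots> \<le> exp (- norm x) * 1 + exp (- norm x) * (norm x * (1 + 4 * exp 1 * norm x))"
    using E nn by (intro add_mono E\<eta> mult_mono xb c) auto
  also have "\<dots> = exp (- norm x) * (1 + norm x + 4 * exp 1 * (norm x)\<^sup>2)"
    by (simp add: power2_eq_square algebra_simps)
  finally show "norm (mollified_grad b e x) \<le> exp (- norm x) * (1 + norm x + 4 * exp 1 * (norm x)\<^sup>2)" .
qed

lemma mollified_tendsto:
  fixes b :: "'a::euclidean_space"
  assumes e: "e \<longlonglongrightarrow> 0" and x: "x \<noteq> 0"
  shows "(\<lambda>n. mollified b (e n) x) \<longlonglongrightarrow> extremal b x"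
    and "(\<lambda>n. mollified_grad b (e n) x) \<longlonglongrightarrow> extremal_grad b x"
proof -
  have "(\<lambda>n. sqrt (e n + x \<bullet> x)) \<longlonglongrightarrow> sqrt (0 + x \<bullet> x)"
    by (rule tendsto_real_sqrt[OF tendsto_add[OF e tendsto_const]])
  then have r: "(\<lambda>n. sqrt (e n + x \<bullet> x)) \<longlonglongrightarrow> norm x" by (simp add: norm_eq_sqrt_inner)
  have E: "(\<lambda>n. exp (- sqrt (e n + x \<bullet> x))) \<longlonglongrightarrow> exp (- norm x)"
    by (rule tendsto_exp[OF tendsto_minus[OF r]])
  have "(\<lambda>n. 1 - e n * (x \<bullet> x)) \<longlonglongrightarrow> 1 - 0 * (x \<bullet> x)"
    by (rule tendsto_diff[OF tendsto_const tendsto_mult[OF e tendsto_const]])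
  then have t: "(\<lambda>n. 1 - e n * (x \<bullet> x)) \<longlonglongrightarrow> 1" by simp
  have flat: "(\<lambda>n. exp 1 * flat p (1 - e n * (x \<bullet> x))) \<longlonglongrightarrow> exp 1 * flat p 1" for p
    by (rule tendsto_mult[OF tendsto_const isCont_tendsto_compose[OF DERIV_isCont[OF flat_has_derivative] t]])
  have f1: "exp 1 * flat [:1:] 1 = 1" "exp 1 * flat [:0, 0, 1:] 1 = 1" by (simp_all add: flat_def exp_minus)
  note X = flat[of "[:1:]", unfolded f1] and X' = flat[of "[:0, 0, 1:]", unfolded f1]
  have "(\<lambda>n. mollified b (e n) x) \<longlonglongrightarrow> (x \<bullet> b) * (exp (- norm x) * 1)"
    unfolding mollified_def by (rule tendsto_mult[OF tendsto_const tendsto_mult[OF E X]])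
  then show "(\<lambda>n. mollified b (e n) x) \<longlonglongrightarrow> extremal b x" by (simp add: extremal_def)
  have "(\<lambda>n. mollified_grad b (e n) x) \<longlonglongrightarrow>
     (exp (- norm x) * 1) *\<^sub>R b - ((x \<bullet> b) * exp (- norm x) * (1 / norm x + 2 * 0 * 1)) *\<^sub>R x"
    unfolding mollified_grad_def using x
    by (intro tendsto_diff tendsto_scaleR[OF _ tendsto_const] tendsto_mult[OF E X] tendsto_mult[OF tendsto_mult[OF tendsto_const E]]
        tendsto_add tendsto_divide[OF X r] tendsto_mult[OF tendsto_mult[OF tendsto_const e] X']) simp
  then show "(\<lambda>n. mollified_grad b (e n) x) \<longlonglongrightarrow> extremal_grad b x"
    by (simp add: extremal_grad_def sgn_div_norm scaleR_diff_right divide_inverse mult_ac)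
qed

text \<open>Dominated convergence with the exponent \<open>k\<close> equal to 0 or 1, which treats
  the plain integrals and the one over \<open>norm x\<close> alike.\<close>

lemma (in dim_ge2) integral_tendsto:
  fixes f :: "nat \<Rightarrow> 'a \<Rightarrow> real"
  assumes m: "\<And>n. f n \<in> borel_measurable lborel" "g \<in> borel_measurable lborel"
    and W: "tame W" and bnd: "\<And>n x. \<bar>f n x\<bar> \<le> exp (- 2 * norm x) * W x / norm x ^ k" and k: "k \<le> 1"
    and lim: "\<And>x. x \<noteq> 0 \<Longrightarrow> (\<lambda>n. f n x) \<longlonglongrightarrow> g x"
  shows "(\<lambda>n. \<integral>x. f n x \<partial>lborel) \<longlonglongrightarrow> (\<integral>x. g x \<partial>lborel)"
proof (rule integral_dominated_convergence[OF m(2,1)])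
  have d: "decaying (\<lambda>x. exp (- 2 * norm x) * W x)" by (rule decaying_mult_tame[OF decaying_exp W]) simp
  have "k = 0 \<or> k = 1" using k by auto
  then show "integrable lborel (\<lambda>x. exp (- 2 * norm x) * W x / norm x ^ k)"
    using decaying_integrable[OF d] decaying_integrable_over_norm[OF d] by auto
  show "AE x in lborel. (\<lambda>n. f n x) \<longlonglongrightarrow> g x" using AE_lborel_nonzero by eventually_elim (rule lim)
  show "AE x in lborel. norm (f n x) \<le> exp (- 2 * norm x) * W x / norm x ^ k" for n using bnd by simp
qed

theorem constant_sharp:
  assumes dim: "2 \<le> CARD('n::finite)" and K: "1 < K"
  shows "\<exists>u \<in> (test_functions :: (real^'n \<Rightarrow> real) set). \<not> deficit u (gradient u) \<ge> K * exp_dist u"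
proof -
  interpret dim_ge2 "TYPE(real^'n)" by unfold_locales (use dim in simp)
  obtain i :: 'n where True by blast
  define b :: "real^'n" where "b = axis i 1"
  have b: "b \<in> Basis" "norm b = 1" by (simp_all add: b_def axis_in_Basis_iff)
  define e where "e n = inverse (real (Suc n))" for n
  have e: "0 < e n" "e n \<le> 1" for n by (auto simp: e_def divide_simps)
  have e0: "e \<longlonglongrightarrow> 0" unfolding e_def[abs_def] by (rule LIMSEQ_inverse_real_of_nat)
  define u where "u n = mollified b (e n)" for n
  have tu: "u n \<in> test_functions" for n unfolding u_def b_def by (rule mollified_test_function[OF e(1)])
  have gu: "gradient (u n) x = mollified_grad b (e n) x" for n x
    unfolding u_def by (rule gradient_eqI[OF GDERIV_mollified[OF e(1)]])
  have mu: "u n \<in> borel_measurable borel" for n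
    unfolding u_def by (rule borel_measurable_continuous_onI[OF GDERIV_continuous[OF GDERIV_mollified[OF e(1)]]])
  have mg: "gradient (u n) \<in> borel_measurable borel" for n
  proof -
    have "C_k 1 (u n)" using tu[of n] by (simp add: test_functions_def)
    then show ?thesis by (rule borel_measurable_continuous_onI[OF C_k_1_D(2)])
  qed
  have mx: "extremal b \<in> borel_measurable borel"
    by (rule tame_measurable[OF decaying_imp_tame[OF decaying_extremal]])
  let ?W = "\<lambda>x::real^'n. (1 + norm x + 4 * exp 1 * (norm x)\<^sup>2)\<^sup>2"
  have W: "tame ?W"
    by (rule tame_power[OF tame_add[OF tame_add[OF tame_const tame_norm] tame_cmult[OF tame_power[OF tame_norm]]]])
  have bg: "\<bar>(norm (gradient (u n) x))\<^sup>2\<bar> \<le> exp (- 2 * norm x) * ?W x / norm x ^ 0" for n x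
  proof -
    have "(norm (gradient (u n) x))\<^sup>2 \<le> (exp (- norm x) * (1 + norm x + 4 * exp 1 * (norm x)\<^sup>2))\<^sup>2"
      unfolding gu using mollified_bounds(2)[OF e b(2)] by (rule power_mono) simp
    then show ?thesis by (simp add: power_mult_distrib power2_eq_square[of "exp _"] exp_minus_norm_square)
  qed
  have bu: "\<bar>\<bar>u n x\<bar>\<^sup>2\<bar> \<le> exp (- 2 * norm x) * (norm x)\<^sup>2" for n x
  proof -
    have "\<bar>u n x\<bar>\<^sup>2 \<le> (exp (- norm x) * norm x)\<^sup>2"
      unfolding u_def using mollified_bounds(1)[OF e b(2)] by (rule power_mono) simp
    then show ?thesis by (simp add: power_mult_distrib power2_eq_square[of "exp _"] exp_minus_norm_square)
  qed
  have W2: "tame (\<lambda>x::real^'n. (norm x)\<^sup>2)" by (rule tame_power[OF tame_norm])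
  have lu: "(\<lambda>n. u n x) \<longlonglongrightarrow> extremal b x" "(\<lambda>n. gradient (u n) x) \<longlonglongrightarrow> extremal_grad b x" if "x \<noteq> 0" for x
    unfolding u_def gu[unfolded u_def] by (rule mollified_tendsto[OF e0 that])+
  have A: "(\<lambda>n. \<integral>x. (norm (gradient (u n) x))\<^sup>2 \<partial>lborel) \<longlonglongrightarrow> (\<integral>x. (norm (extremal_grad b x))\<^sup>2 \<partial>lborel)"
  proof (rule integral_tendsto[OF _ _ W bg])
    show "(\<lambda>x. (norm (gradient (u n) x))\<^sup>2) \<in> borel_measurable lborel" for n using mg by simp
    show "(\<lambda>x. (norm (extremal_grad b x))\<^sup>2) \<in> borel_measurable lborel" using extremal_grad_measurable[of b] by measurable
    show "(\<lambda>n. (norm (gradient (u n) x))\<^sup>2) \<longlonglongrightarrow> (norm (extremal_grad b x))\<^sup>2" if "x \<noteq> 0" for x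
      by (rule tendsto_power[OF tendsto_norm[OF lu(2)[OF that]]])
  qed simp
  have B: "(\<lambda>n. \<integral>x. \<bar>u n x\<bar>\<^sup>2 \<partial>lborel) \<longlonglongrightarrow> (\<integral>x. \<bar>extremal b x\<bar>\<^sup>2 \<partial>lborel)"
  proof (rule integral_tendsto[OF _ _ W2, where k = 0])
    show "(\<lambda>x. \<bar>u n x\<bar>\<^sup>2) \<in> borel_measurable lborel" for n using mu by simp
    show "(\<lambda>x. \<bar>extremal b x\<bar>\<^sup>2) \<in> borel_measurable lborel" using mx by simp
    show "\<bar>\<bar>u n x\<bar>\<^sup>2\<bar> \<le> exp (- 2 * norm x) * (norm x)\<^sup>2 / norm x ^ 0" for n x using bu by simp
    show "(\<lambda>n. \<bar>u n x\<bar>\<^sup>2) \<longlonglongrightarrow> \<bar>extremal b x\<bar>\<^sup>2" if "x \<noteq> 0" for x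
      by (rule tendsto_power[OF tendsto_rabs[OF lu(1)[OF that]]])
  qed simp
  have C: "(\<lambda>n. \<integral>x. \<bar>u n x\<bar>\<^sup>2 / norm x \<partial>lborel) \<longlonglongrightarrow> (\<integral>x. \<bar>extremal b x\<bar>\<^sup>2 / norm x \<partial>lborel)"
  proof (rule integral_tendsto[OF _ _ W2, where k = 1])
    show "(\<lambda>x. \<bar>u n x\<bar>\<^sup>2 / norm x) \<in> borel_measurable lborel" for n using mu by simp
    show "(\<lambda>x. \<bar>extremal b x\<bar>\<^sup>2 / norm x) \<in> borel_measurable lborel" using mx by simp
    show "\<bar>\<bar>u n x\<bar>\<^sup>2 / norm x\<bar> \<le> exp (- 2 * norm x) * (norm x)\<^sup>2 / norm x ^ 1" for n x
      using divide_right_mono[OF bu norm_ge_zero] by simp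
    show "(\<lambda>n. \<bar>u n x\<bar>\<^sup>2 / norm x) \<longlonglongrightarrow> \<bar>extremal b x\<bar>\<^sup>2 / norm x" if "x \<noteq> 0" for x
      by (rule tendsto_divide[OF tendsto_power[OF tendsto_rabs[OF lu(1)[OF that]]] tendsto_const]) (use that in simp)
  qed simp
  have odd: "u n (- x) = - u n x" for n x by (simp add: u_def mollified_def)
  have iw: "integrable lborel (\<lambda>x. \<bar>u n x\<bar>\<^sup>2 / norm x)" for n
  proof (rule Bochner_Integration.integrable_bound)
    show "integrable lborel (\<lambda>x::real^'n. exp (- 2 * norm x) * (norm x)\<^sup>2 / norm x)"
      by (rule decaying_integrable_over_norm[OF decaying_mult_tame[OF decaying_exp W2]]) simp
    show "(\<lambda>x. \<bar>u n x\<bar>\<^sup>2 / norm x) \<in> borel_measurable lborel" using mu by simp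
    show "AE x in lborel. norm (\<bar>u n x\<bar>\<^sup>2 / norm x) \<le> norm (exp (- 2 * norm x) * (norm x)\<^sup>2 / norm x)"
      using divide_right_mono[OF bu norm_ge_zero] by (intro AE_I2) simp
  qed
  \<comment> \<open>Oddness turns the infimum into a single integral, to which dominated convergence
    applies; an infimum would not pass to the limit by itself.\<close>
  have ed: "exp_dist (u n) = (\<integral>x. \<bar>u n x\<bar>\<^sup>2 / norm x \<partial>lborel)" for n
    by (rule exp_dist_odd[OF assms(1) mu odd iw])
  define c where "c = exp_dist (extremal b)"
  have ec: "exp_dist (extremal b) = (\<integral>x. \<bar>extremal b x\<bar>\<^sup>2 / norm x \<partial>lborel)"
    by (rule exp_dist_odd[OF assms(1) mx _ extremal_integrals(3)[OF b(1)]]) (simp add: extremal_def)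
  have c0: "0 < c" unfolding c_def ec extremal_integrals(5)[OF b(1)] using extremal_integrals(1)[OF b(1)] by simp
  have "(\<lambda>n. deficit (u n) (gradient (u n)) - K * exp_dist (u n)) \<longlonglongrightarrow>
      deficit (extremal b) (extremal_grad b) - K * exp_dist (extremal b)"
    unfolding deficit_def ed ec
    by (intro tendsto_diff tendsto_mult tendsto_real_sqrt tendsto_const A B C)
  \<comment> \<open>By equality for the extremal function this limit is \<open>(1 - K) * c\<close>
    with \<open>c > 0\<close>, so the strict inequality already holds for some
    \<open>u n\<close>.\<close>
  moreover have "deficit (extremal b) (extremal_grad b) - K * exp_dist (extremal b) < 0"
    using extremal_attains(3)[OF assms(1) b(1)] K c0 by (simp add: c_def[symmetric])
  ultimately have "eventually (\<lambda>n. deficit (u n) (gradient (u n)) - K * exp_dist (u n) < 0) sequentially"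
    by (rule order_tendstoD(2))
  then obtain n where "deficit (u n) (gradient (u n)) < K * exp_dist (u n)"
    by (auto simp: eventually_sequentially)
  then show ?thesis using tu[of n] by (intro bexI[of _ "u n"]) simp_all
qed

theorem corollary1p1:
  assumes "CARD('n::finite) \<ge> 2"
  shows
    "(\<forall>u \<in> (test_functions :: (real^'n \<Rightarrow> real) set). deficit u (gradient u) \<ge> exp_dist u) \<and>
     (\<forall>K::real. K > 1 \<longrightarrow>
        (\<exists>u \<in> (test_functions :: (real^'n \<Rightarrow> real) set).
           \<not> deficit u (gradient u) \<ge> K * exp_dist u)) \<and>
     (\<exists>(u :: real^'n \<Rightarrow> real) G. natural_space u G \<and>
        \<not> (\<exists>(c::real) (l::real). l > 0 \<and> (AE x in lborel. u x = c * exp (- l * norm x))) \<and>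
        deficit u G = exp_dist u) \<and>
     (\<forall>u \<in> (test_functions :: (real^'n \<Rightarrow> real) set).
        deficit u (gradient u) - exp_dist u \<ge> affine_exp_dist u)"
proof (intro conjI ballI allI impI)
  fix u :: "real^'n \<Rightarrow> real" assume "u \<in> test_functions"
  note le = deficit_ge_dists[OF assms this]
  then show "deficit u (gradient u) - exp_dist u \<ge> affine_exp_dist u" by simp
  show "deficit u (gradient u) \<ge> exp_dist u" using le affine_exp_dist_nonneg[of u] by simp
next
  fix K :: real assume "K > 1"
  with assms show "\<exists>u \<in> (test_functions :: (real^'n \<Rightarrow> real) set). \<not> deficit u (gradient u) \<ge> K * exp_dist u"
    by (rule constant_sharp)
next
  obtain b :: "real^'n" where b: "b \<in> Basis" using nonempty_Basis by blast
  show "\<exists>(u :: real^'n \<Rightarrow> real) G. natural_space u G \<and>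
        \<not> (\<exists>(c::real) (l::real). l > 0 \<and> (AE x in lborel. u x = c * exp (- l * norm x))) \<and>
        deficit u G = exp_dist u"
    using extremal_attains[OF assms b] by blast
qed

end
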